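(* Let $k\ge3$, $m\ge3$, $3\le g\le m$ and $0<\alpha<1$. Among all $k$-uniform linear unicyclic hypergraphs with $m$ hyperedges and girth $g$, the first hypergraph in $S_\alpha$-order is $C_g^{(k)}\cdot P_{m-g}^{(k)}$.
   Context: Hypergraphs are finite; $k$-uniform means every hyperedge has exactly $k$ vertices; linear means any two distinct hyperedges share at most one vertex; unicyclic means connected with exactly one cycle; the girth is the minimum length of a cycle. A cored vertex is a vertex of degree one. The hypercycle $C_g^{(k)}$ (resp. hyperpath $P_r^{(k)}$) is obtained from the cycle graph with $g$ edges (resp. path graph with $r$ edges) by inserting $k-2$ new (cored) vertices into each edge. $C_g^{(k)}\cdot P_{m-g}^{(k)}$ is the coalescence of $C_g^{(k)}$ at one of its cored vertices with $P_{m-g}^{(k)}$ at one of its pendant vertices (an end vertex of the path), i.e. these two vertices are identified; for $g=m$ it is $C_m^{(k)}$. For a $k$-uniform hypergraph $\mathcal{H}$ on $[n]$, $\mathcal{A}(\mathcal{H})$ is the $k$-order $n$-dimensional tensor with entry $\frac1{(k-1)!}$ at $(i_1,\dots,i_k)$ if $\{i_1,\dots,i_k\}\in E(\mathcal{H})$ and $0$ otherwise; $\mathcal{D}(\mathcal{H})$ is the diagonal tensor of vertex degrees; $\mathcal{A}_\alpha(\mathcal{H})=\alpha\mathcal{D}(\mathcal{H})+(1-\alpha)\mathcal{A}(\mathcal{H})$. For a tensor $\mathcal{T}$, $\mathrm{Tr}_d(\mathcal{T})$ is the sum of the $d$-th powers of all $n(k-1)^{n-1}$ eigenvalues of $\mathcal{T}$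 (roots of its characteristic polynomial, with multiplicity); in particular $\mathrm{Tr}_0(\mathcal{T})=n(k-1)^{n-1}$, and for $d\ge1$ $$\mathrm{Tr}_{d}(\mathcal{T})=(k-1)^{n-1}\sum_{d_1+\cdots+d_n=d}\ \prod_{i=1}^{n}\frac{1}{(d_i(k-1))!}\Big(\sum_{\gamma\in[n]^{k-1}}(\mathcal{T})_{i\gamma}\frac{\partial}{\partial a_{i\gamma}}\Big)^{d_i}\mathrm{tr}\big(A^{d(k-1)}\big),$$ with $A=(a_{ij})$ an $n\times n$ matrix of indeterminates, $d_i\ge0$ integers, $\frac{\partial}{\partial a_{i\gamma}}=\frac{\partial}{\partial a_{i i_2}}\cdots\frac{\partial}{\partial a_{i i_k}}$ for $\gamma=i_2\cdots i_k$. $S_\alpha$-order: for $k$-uniform hypergraphs $\mathcal{H}_1,\mathcal{H}_2$ with $n$ vertices, $\mathcal{H}_1\prec_\alpha\mathcal{H}_2$ if there is $d\in\{1,\dots,n(k-1)^{n-1}-1\}$ with $\mathrm{Tr}_t(\mathcal{A}_\alpha(\mathcal{H}_1))=\mathrm{Tr}_t(\mathcal{A}_\alpha(\mathcal{H}_2))$ for $t=0,\dots,d-1$ and $\mathrm{Tr}_d(\mathcal{A}_\alpha(\mathcal{H}_1))<\mathrm{Tr}_d(\mathcal{A}_\alpha(\mathcal{H}_2))$. "$X$ is the first hypergraph in a class" means $X$ is in the class and $X\prec_\alpha\mathcal{H}$ for every $\mathcal{H}$ in the class not isomorphic to $X$. *)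

theory Defs
  imports Complex_Main "HOL-Library.FuncSet" "HOL-Library.Poly_Mapping"
begin

section \<open>Hypergraphs\<close>

type_synonym 'v hypergraph = "'v set \<times> 'v set set"

abbreviation verts :: "'v hypergraph \<Rightarrow> 'v set" where "verts H \<equiv> fst H"
abbreviation hedges :: "'v hypergraph \<Rightarrow> 'v set set" where "hedges H \<equiv> snd H"

definition hypergraph :: "'v hypergraph \<Rightarrow> bool" where
  "hypergraph H \<longleftrightarrow> finite (verts H) \<and> verts H \<noteq> {} \<and> (\<forall>e\<in>hedges H. e \<subseteq> verts H)"

definition uniform :: "nat \<Rightarrow> 'v hypergraph \<Rightarrow> bool" where
  "uniform k H \<longleftrightarrow> (\<forall>e\<in>hedges H. card e = k)"

definition linear_hg :: "'v hypergraph \<Rightarrow> bool" where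
  "linear_hg H \<longleftrightarrow> (\<forall>e\<in>hedges H. \<forall>f\<in>hedges H. e \<noteq> f \<longrightarrow> card (e \<inter> f) \<le> 1)"

definition degree :: "'v hypergraph \<Rightarrow> 'v \<Rightarrow> nat" where
  "degree H v = card {e \<in> hedges H. v \<in> e}"

definition cored :: "'v hypergraph \<Rightarrow> 'v \<Rightarrow> bool" where
  "cored H v \<longleftrightarrow> v \<in> verts H \<and> degree H v = 1"

definition adjacency :: "'v hypergraph \<Rightarrow> ('v \<times> 'v) set" where
  "adjacency H = {(u, v). \<exists>e\<in>hedges H. u \<in> e \<and> v \<in> e}"

definition connected_hg :: "'v hypergraph \<Rightarrow> bool" where
  "connected_hg H \<longleftrightarrow> (\<forall>u\<in>verts H. \<forall>v\<in>verts H. (u, v) \<in> (adjacency H)\<^sup>*)"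

definition isomorphic :: "'v hypergraph \<Rightarrow> 'w hypergraph \<Rightarrow> bool" where
  "isomorphic H1 H2 \<longleftrightarrow>
     (\<exists>f. bij_betw f (verts H1) (verts H2) \<and> hedges H2 = (\<lambda>e. f ` e) ` hedges H1)"

text \<open>
  A cycle is a closed walk v0 e0 v1 e1 ... v(l-1) e(l-1) v0 with distinct vertices and
  distinct hyperedges, each \<open>e i\<close> containing both neighbours of it in the walk.
\<close>

definition is_cycle :: "'v hypergraph \<Rightarrow> 'v list \<Rightarrow> 'v set list \<Rightarrow> bool" where
  "is_cycle H vs es \<longleftrightarrow>
     2 \<le> length es \<and> length vs = length es \<and> distinct vs \<and> distinct es \<and>
     set vs \<subseteq> verts H \<and> set es \<subseteq> hedges H \<and>
     (\<forall>i<length es. vs ! i \<in> es ! i \<and> vs ! ((i + 1) mod length es) \<in> es ! i)"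

text \<open>
  Cycles are counted up to the choice of starting point and orientation: two cyclic walks
  are the same cycle iff they use the same vertex-hyperedge incidences.
\<close>

definition cycle_incidences :: "'v list \<Rightarrow> 'v set list \<Rightarrow> ('v \<times> 'v set) set" where
  "cycle_incidences vs es =
     (\<Union>i<length es. {(vs ! i, es ! i), (vs ! ((i + 1) mod length es), es ! i)})"

definition cycles :: "'v hypergraph \<Rightarrow> ('v \<times> 'v set) set set" where
  "cycles H = {cycle_incidences vs es | vs es. is_cycle H vs es}"

definition unicyclic :: "'v hypergraph \<Rightarrow> bool" where
  "unicyclic H \<longleftrightarrow> connected_hg H \<and> is_singleton (cycles H)"

definition girth :: "'v hypergraph \<Rightarrow> nat" where
  "girth H = (LEAST l. \<exists>vs es. is_cycle H vs es \<and> length es = l)"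

definition linear_unicyclic :: "nat \<Rightarrow> nat \<Rightarrow> nat \<Rightarrow> 'v hypergraph set" where
  "linear_unicyclic k m g =
     {H. hypergraph H \<and> uniform k H \<and> linear_hg H \<and> unicyclic H \<and>
         card (hedges H) = m \<and> girth H = g}"


section \<open>Hypercycles, hyperpaths and coalescence\<close>

definition cycle_graph :: "nat \<Rightarrow> nat hypergraph" where
  "cycle_graph g = ({..<g}, {{i, (i + 1) mod g} | i. i < g})"

definition path_graph :: "nat \<Rightarrow> nat hypergraph" where
  "path_graph r = ({..r}, {{i, i + 1} | i. i < r})"

text \<open>
  The \<open>k - 2\<close> vertices inserted into the edge \<open>e\<close> are \<open>Inr (e, j)\<close> with \<open>j < k - 2\<close>.
\<close>

type_synonym 'v power_vertex = "'v + 'v set \<times> nat"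

definition power_hg :: "nat \<Rightarrow> 'v hypergraph \<Rightarrow> 'v power_vertex hypergraph" where
  "power_hg k G =
     (Inl ` verts G \<union> Inr ` (hedges G \<times> {..<k - 2}),
      (\<lambda>e. Inl ` e \<union> Inr ` ({e} \<times> {..<k - 2})) ` hedges G)"

definition hypercycle :: "nat \<Rightarrow> nat \<Rightarrow> nat power_vertex hypergraph" where
  "hypercycle k g = power_hg k (cycle_graph g)"

definition hyperpath :: "nat \<Rightarrow> nat \<Rightarrow> nat power_vertex hypergraph" where
  "hyperpath k r = power_hg k (path_graph r)"

text \<open>The disjoint union of \<open>H1\<close> and \<open>H2\<close> with \<open>v2\<close> identified with \<open>v1\<close>.\<close>

definition coalescence ::
    "'v hypergraph \<Rightarrow> 'v \<Rightarrow> 'w hypergraph \<Rightarrow> 'w \<Rightarrow> ('v + 'w) hypergraph" where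
  "coalescence H1 v1 H2 v2 =
     (let q = (\<lambda>x. if x = v2 then Inl v1 else Inr x) in
      (Inl ` verts H1 \<union> q ` verts H2,
       (\<lambda>e. Inl ` e) ` hedges H1 \<union> (\<lambda>e. q ` e) ` hedges H2))"

text \<open>
  By symmetry of the hypercycle, the choice of the cored vertex is immaterial up to
  isomorphism; we take the first one inserted into the edge \<open>{0, 1}\<close>. The path is attached
  at its end vertex 0. As \<open>hyperpath k 0\<close> is a single vertex, \<open>r = 0\<close> gives a copy of
  \<open>hypercycle k g\<close>.
\<close>

definition hypercycle_hyperpath ::
    "nat \<Rightarrow> nat \<Rightarrow> nat \<Rightarrow> (nat power_vertex + nat power_vertex) hypergraph" where
  "hypercycle_hyperpath k g r =
     coalescence (hypercycle k g) (Inr ({0, 1}, 0)) (hyperpath k r) (Inl 0)"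

lemma cored_hypercycle:
  assumes "k \<ge> 3" "g \<ge> 3"
  shows "cored (hypercycle k g) (Inr ({0, 1}, 0))"
proof -
  let ?e = "Inl ` {0, 1} \<union> Inr ` ({{0, 1}} \<times> {..<k - 2}) :: nat power_vertex set"
  have e: "{0, 1} \<in> hedges (cycle_graph g)"
    unfolding cycle_graph_def snd_conv mem_Collect_eq
    by (rule exI[of _ 0]) (use assms in auto)
  have "?e \<in> hedges (hypercycle k g)"
    using imageI[OF e] unfolding hypercycle_def power_hg_def snd_conv .
  moreover have "Inr ({0, 1}, 0) \<in> ?e"
    using assms by simp
  moreover have "f = ?e" if "f \<in> hedges (hypercycle k g)" "Inr ({0, 1}, 0) \<in> f" for f
    using that unfolding hypercycle_def power_hg_def by auto
  ultimately have "{e \<in> hedges (hypercycle k g). Inr ({0, 1}, 0) \<in> e} = {?e}"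
    by blast
  then have "degree (hypercycle k g) (Inr ({0, 1}, 0)) = 1"
    by (simp add: degree_def)
  then show ?thesis
    using e assms by (simp add: cored_def hypercycle_def power_hg_def image_iff)
qed


section \<open>Polynomials in the entries of a matrix of indeterminates\<close>

text \<open>
  Polynomials over the reals with indeterminates \<open>a(i,j)\<close>: finitely supported
  functions from monomials (exponent functions) to coefficients, with the convolution
  product of the library.
\<close>

type_synonym 'v mat_poly = "(('v \<times> 'v) \<Rightarrow>\<^sub>0 nat) \<Rightarrow>\<^sub>0 real"

definition indet :: "'v \<times> 'v \<Rightarrow> 'v mat_poly" where
  "indet x = Poly_Mapping.single (Poly_Mapping.single x 1) 1"

definition scalar :: "real \<Rightarrow> 'v mat_poly" where
  "scalar c = Poly_Mapping.single 0 c"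

definition partial :: "'v \<times> 'v \<Rightarrow> 'v mat_poly \<Rightarrow> 'v mat_poly" where
  "partial x p =
     (\<Sum>\<mu>\<in>Poly_Mapping.keys p.
        Poly_Mapping.single (\<mu> - Poly_Mapping.single x 1)
          (real (Poly_Mapping.lookup \<mu> x) * Poly_Mapping.lookup p \<mu>))"

text \<open>Entries and trace of the powers of the matrix \<open>A = (a(i,j))\<close>, with \<open>i, j \<in> V\<close>.\<close>

primrec mat_pow :: "'v set \<Rightarrow> nat \<Rightarrow> 'v \<Rightarrow> 'v \<Rightarrow> 'v mat_poly" where
  "mat_pow V 0 i j = (if i = j then 1 else 0)"
| "mat_pow V (Suc N) i j = (\<Sum>l\<in>V. mat_pow V N i l * indet (l, j))"

definition tr_pow :: "'v set \<Rightarrow> nat \<Rightarrow> 'v mat_poly" where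
  "tr_pow V N = (\<Sum>i\<in>V. mat_pow V N i i)"


section \<open>Tensors and their traces\<close>

text \<open>
  A tensor of order \<open>k\<close> with index set \<open>V\<close> is given by its entries at the lists of length
  \<open>k\<close> over \<open>V\<close>; values at other lists are irrelevant.
\<close>

type_synonym 'v tensor = "'v list \<Rightarrow> real"

definition adj_tensor :: "nat \<Rightarrow> 'v hypergraph \<Rightarrow> 'v tensor" where
  "adj_tensor k H is = (if length is = k \<and> set is \<in> hedges H then 1 / fact (k - 1) else 0)"

definition deg_tensor :: "nat \<Rightarrow> 'v hypergraph \<Rightarrow> 'v tensor" where
  "deg_tensor k H is = (if is = replicate k (hd is) then real (degree H (hd is)) else 0)"

definition A_tensor :: "real \<Rightarrow> nat \<Rightarrow> 'v hypergraph \<Rightarrow> 'v tensor" where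
  "A_tensor \<alpha> k H is = \<alpha> * deg_tensor k H is + (1 - \<alpha>) * adj_tensor k H is"

text \<open>
  The operator \<open>\<Sum>\<gamma>. T(i\<gamma>) \<partial>/\<partial>a(i\<gamma>)\<close>, where \<open>\<gamma>\<close> ranges over the lists of length \<open>k - 1\<close> over
  \<open>V\<close> and \<open>\<partial>/\<partial>a(i\<gamma>)\<close> is the composition of the \<open>\<partial>/\<partial>a(i,j)\<close> for the entries \<open>j\<close> of \<open>\<gamma>\<close>.
\<close>

definition tensor_op :: "'v set \<Rightarrow> nat \<Rightarrow> 'v tensor \<Rightarrow> 'v \<Rightarrow> 'v mat_poly \<Rightarrow> 'v mat_poly" where
  "tensor_op V k T i p =
     (\<Sum>\<gamma> | length \<gamma> = k - 1 \<and> set \<gamma> \<subseteq> V.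
        scalar (T (i # \<gamma>)) * foldr (\<lambda>j. partial (i, j)) \<gamma> p)"

text \<open>
  The trace of order \<open>d\<close>, by the Morozov-Shakirov formula. The product over \<open>i \<in> V\<close> of
  the pairwise commuting operators \<open>(tensor_op V k T i) ^^ \<delta> i\<close> (see
  \<open>comp_fun_commute_tensor_op\<close> below) is their composition, written as a fold over
  the finite set \<open>V\<close>. Together these operators take \<open>d * (k - 1)\<close> derivatives of a homogeneous
  polynomial of that degree, so the outcome is a constant; \<open>lookup _ 0\<close> reads it as a real.
\<close>

definition Tr :: "'v set \<Rightarrow> nat \<Rightarrow> nat \<Rightarrow> 'v tensor \<Rightarrow> real" where
  "Tr V k d T =
     (if d = 0 then real (card V * (k - 1) ^ (card V - 1))
      else real (k - 1) ^ (card V - 1) *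
        (\<Sum>\<delta> | \<delta> \<in> V \<rightarrow>\<^sub>E {..d} \<and> (\<Sum>i\<in>V. \<delta> i) = d.
           (\<Prod>i\<in>V. 1 / fact (\<delta> i * (k - 1))) *
           Poly_Mapping.lookup
             (Finite_Set.fold (\<lambda>i. tensor_op V k T i ^^ \<delta> i) (tr_pow V (d * (k - 1))) V) 0))"

lemma lookup_partial:
  "Poly_Mapping.lookup (partial x p) \<nu> =
     real (Poly_Mapping.lookup \<nu> x + 1) *
     Poly_Mapping.lookup p (\<nu> + Poly_Mapping.single x 1)"
proof -
  let ?s = "Poly_Mapping.single x (1::nat)"
  have "Poly_Mapping.lookup (partial x p) \<nu> =
    (\<Sum>\<mu>\<in>Poly_Mapping.keys p. if \<mu> = \<nu> + ?s
       then real (Poly_Mapping.lookup \<mu> x) * Poly_Mapping.lookup p \<mu> else 0)"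
    unfolding partial_def lookup_sum
  proof (rule sum.cong[OF refl])
    fix \<mu>
    show "Poly_Mapping.lookup (Poly_Mapping.single (\<mu> - ?s)
            (real (Poly_Mapping.lookup \<mu> x) * Poly_Mapping.lookup p \<mu>)) \<nu> =
          (if \<mu> = \<nu> + ?s then real (Poly_Mapping.lookup \<mu> x) * Poly_Mapping.lookup p \<mu> else 0)"
    proof (cases "Poly_Mapping.lookup \<mu> x = 0")
      case True
      then have "\<mu> \<noteq> \<nu> + ?s" by (auto simp: lookup_add)
      with True show ?thesis by simp
    next
      case False
      then have "\<mu> - ?s + ?s = \<mu>"
        by (intro poly_mapping_eqI) (auto simp: lookup_add lookup_minus lookup_single when_def)
      then have "\<mu> - ?s = \<nu> \<longleftrightarrow> \<mu> = \<nu> + ?s"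
        by auto
      then show ?thesis by (simp add: lookup_single when_def)
    qed
  qed
  also have "\<dots> = real (Poly_Mapping.lookup \<nu> x + 1) * Poly_Mapping.lookup p (\<nu> + ?s)"
    by (auto simp: lookup_add in_keys_iff)
  finally show ?thesis .
qed

lemma partial_commute: "partial x (partial y p) = partial y (partial x p)"
  by (rule poly_mapping_eqI, cases "x = y")
     (auto simp: lookup_partial lookup_add lookup_single when_def add_ac mult_ac)

lemma lookup_scalar_mult:
  "Poly_Mapping.lookup (scalar c * p) \<nu> = c * Poly_Mapping.lookup p \<nu>"
  unfolding scalar_def mult_map_scale_conv_mult[symmetric]
  by (simp add: Poly_Mapping.map.rep_eq when_def)

lemma partial_scalar_mult: "partial x (scalar c * p) = scalar c * partial x p"
  by (rule poly_mapping_eqI) (simp add: lookup_partial lookup_scalar_mult)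

lemma partial_sum: "partial x (\<Sum>s\<in>S. f s) = (\<Sum>s\<in>S. partial x (f s))"
  by (rule poly_mapping_eqI) (simp add: lookup_partial lookup_sum sum_distrib_left)

lemma partial_tensor_op:
  "partial x (tensor_op V k T i p) = tensor_op V k T i (partial x p)"
proof -
  have "partial x (foldr (\<lambda>j. partial (i, j)) \<gamma> p) =
        foldr (\<lambda>j. partial (i, j)) \<gamma> (partial x p)" for \<gamma>
    by (induction \<gamma>) (simp_all add: partial_commute[of x])
  then show ?thesis
    by (simp add: tensor_op_def partial_sum partial_scalar_mult)
qed

lemma tensor_op_commute:
  "tensor_op V k T i (tensor_op V k T j p) = tensor_op V k T j (tensor_op V k T i p)"
proof -
  have sum: "tensor_op V k T j (\<Sum>s\<in>S. f s) = (\<Sum>s\<in>S. tensor_op V k T j (f s))"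
    for S and f :: "'a list \<Rightarrow> 'a mat_poly"
  proof -
    have "foldr (\<lambda>l. partial (j, l)) \<gamma> (\<Sum>s\<in>S. f s) =
          (\<Sum>s\<in>S. foldr (\<lambda>l. partial (j, l)) \<gamma> (f s))" for \<gamma>
      by (induction \<gamma>) (simp_all add: partial_sum)
    then show ?thesis
      by (simp add: tensor_op_def sum_distrib_left sum.swap[of _ _ S])
  qed
  have smult: "tensor_op V k T j (scalar c * q) = scalar c * tensor_op V k T j q" for c q
  proof -
    have "foldr (\<lambda>l. partial (j, l)) \<gamma> (scalar c * q) =
          scalar c * foldr (\<lambda>l. partial (j, l)) \<gamma> q" for \<gamma>
      by (induction \<gamma>) (simp_all add: partial_scalar_mult)
    then show ?thesis
      by (simp add: tensor_op_def sum_distrib_left mult.left_commute)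
  qed
  have "foldr (\<lambda>l. partial (i, l)) \<gamma> (tensor_op V k T j p) =
        tensor_op V k T j (foldr (\<lambda>l. partial (i, l)) \<gamma> p)" for \<gamma>
    by (induction \<gamma>) (simp_all add: partial_tensor_op)
  then have "tensor_op V k T i (tensor_op V k T j p) =
    (\<Sum>\<gamma> | length \<gamma> = k - 1 \<and> set \<gamma> \<subseteq> V.
       scalar (T (i # \<gamma>)) * tensor_op V k T j (foldr (\<lambda>l. partial (i, l)) \<gamma> p))"
    by (simp add: tensor_op_def[of V k T i])
  also have "\<dots> = tensor_op V k T j (tensor_op V k T i p)"
    by (simp add: tensor_op_def[of V k T i] sum smult)
  finally show ?thesis .
qed

lemma comp_fun_commute_tensor_op: "comp_fun_commute (\<lambda>i. tensor_op V k T i ^^ \<delta> i)"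
proof
  fix i j
  have 1: "(tensor_op V k T i ^^ a) (tensor_op V k T j p) =
           tensor_op V k T j ((tensor_op V k T i ^^ a) p)" for a p
    by (induction a) (simp_all add: tensor_op_commute[of V k T i j])
  have "(tensor_op V k T i ^^ a) ((tensor_op V k T j ^^ b) p) =
        (tensor_op V k T j ^^ b) ((tensor_op V k T i ^^ a) p)" for a b p
    by (induction b) (simp_all add: 1)
  then show "tensor_op V k T j ^^ \<delta> j \<circ> tensor_op V k T i ^^ \<delta> i =
             tensor_op V k T i ^^ \<delta> i \<circ> tensor_op V k T j ^^ \<delta> j"
    by (simp add: fun_eq_iff)
qed


section \<open>The spectral order\<close>

definition Tr_A :: "real \<Rightarrow> nat \<Rightarrow> nat \<Rightarrow> 'v hypergraph \<Rightarrow> real" where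
  "Tr_A \<alpha> k d H = Tr (verts H) k d (A_tensor \<alpha> k H)"

definition S_less :: "real \<Rightarrow> nat \<Rightarrow> 'v hypergraph \<Rightarrow> 'w hypergraph \<Rightarrow> bool" where
  "S_less \<alpha> k H1 H2 \<longleftrightarrow>
     card (verts H1) = card (verts H2) \<and>
     (\<exists>d\<in>{1..card (verts H1) * (k - 1) ^ (card (verts H1) - 1) - 1}.
        (\<forall>t<d. Tr_A \<alpha> k t H1 = Tr_A \<alpha> k t H2) \<and> Tr_A \<alpha> k d H1 < Tr_A \<alpha> k d H2)"

end

(* Only configurations (a choice, for every vertex, of a list of tensor entries) whose arcs carry a
  closed walk contribute to a trace. In a linear hypergraph and for order at most k + 2 such a
  configuration lives on a single vertex or on a single edge. Hence the traces of order below k are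
  power sums of degrees, and a vertex of degree at least 3 already increases the second one, the
  sums of degrees being fixed. If all degrees are at most 2, an edge contributes a function f of
  the number of its vertices of degree 2, that is, of the degree of the edge in the line graph; this f
  is affine for orders up to k + 1 and strictly convex for order k + 2. The line graph is connected
  and unicyclic, so f summed over its degrees is smallest when it is a cycle with a pendent path,
  the only case with at most one leaf. *)

theory Submission
  imports Defs "HOL-Library.Multiset"
begin

section \<open>Traces as sums over configurations\<close>

text \<open>No trace is evaluated. The coefficients of the vertex and edge terms stay abstract and
  only signs matter: a sum of nonnegative terms is positive as soon as one configuration carries a
  closed walk, and the one that is needed carries an explicit Eulerian circuit. The order k + 2
  arises because activating all vertices of an edge costs a non-diagonal entry at each of them, and
  a second difference in two degrees sees only configurations with diagonal entries at two different
  vertices as well. The number of vertices is forced to be m (k - 1), so with degrees at most 2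
  exactly m vertices have degree 2 and the line graph has average degree 2. Convexity is exploited
  through the secant of f through 2 and 3: in the extremal case only the last edge can lie off it,
  whereas two leaves already give twice the gap at 1. The extremal hypergraph is recovered up to
  isomorphism because, with degrees at most 2, the sizes of the pairwise intersections of the edges
  determine everything.\<close>

definition Partial :: "('v \<times> 'v) multiset \<Rightarrow> 'v mat_poly \<Rightarrow> 'v mat_poly" where
  "Partial M p = fold_mset partial p M"

interpretation partial: comp_fun_commute partial
  by standard (simp add: fun_eq_iff partial_commute)

lemma Partial_empty [simp]: "Partial {#} p = p"
  by (simp add: Partial_def)

lemma Partial_add_mset: "Partial (add_mset x M) p = partial x (Partial M p)"
  by (simp add: Partial_def)

lemma Partial_add_mset': "Partial (add_mset x M) p = Partial M (partial x p)"
  by (simp add: Partial_def partial.fold_mset_fun_left_comm)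

lemma Partial_union: "Partial (M + N) p = Partial M (Partial N p)"
  by (induction M) (simp_all add: Partial_add_mset)

lemma Partial_sum: "Partial M (\<Sum>s\<in>S. f s) = (\<Sum>s\<in>S. Partial M (f s))"
  by (induction M) (simp_all add: Partial_add_mset partial_sum)

lemma Partial_scalar_mult: "Partial M (scalar c * p) = scalar c * Partial M p"
  by (induction M) (simp_all add: Partial_add_mset partial_scalar_mult)

lemma foldr_partial: "foldr (\<lambda>j. partial (i, j)) \<gamma> p = Partial (mset (map (Pair i) \<gamma>)) p"
  by (induction \<gamma>) (simp_all add: Partial_add_mset)

lemma scalar_mult_scalar: "scalar a * scalar b = scalar (a * b)"
  by (simp add: scalar_def mult_single)

lemma scalar_1 [simp]: "scalar 1 = 1"
  by (simp add: scalar_def)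

text \<open>The monomial whose exponents are the multiplicities in \<open>M\<close>; multisets of
  index pairs thus stand for monomials.\<close>

definition expo :: "('v \<times> 'v) multiset \<Rightarrow> ('v \<times> 'v) \<Rightarrow>\<^sub>0 nat" where
  "expo M = (\<Sum>x\<in>#M. Poly_Mapping.single x 1)"

lemma lookup_expo: "Poly_Mapping.lookup (expo M) x = count M x"
  by (induction M) (auto simp: expo_def lookup_add lookup_single when_def)

lemma expo_inject: "expo M = expo N \<longleftrightarrow> M = N"
  by (metis lookup_expo multiset_eqI)

text \<open>The constant left when the monomial of \<open>M\<close> is differentiated once for every
  element of \<open>M\<close>.\<close>

definition mfact :: "'a multiset \<Rightarrow> nat" where
  "mfact M = (\<Prod>x\<in>set_mset M. fact (count M x))"

lemma mfact_pos: "mfact M > 0"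
  by (simp add: mfact_def)

lemma mfact_add_mset: "mfact (add_mset x M) = mfact M * (count M x + 1)"
proof (cases "x \<in># M")
  case True
  then have "mfact (add_mset x M) = fact (count M x + 1) * (\<Prod>y\<in>set_mset M - {x}. fact (count (add_mset x M) y))"
    by (simp add: mfact_def insert_absorb prod.remove[of _ x])
  also have "(\<Prod>y\<in>set_mset M - {x}. fact (count (add_mset x M) y)) = (\<Prod>y\<in>set_mset M - {x}. fact (count M y) :: nat)"
    by (rule prod.cong) auto
  also have "fact (count M x + 1) * \<dots> = (count M x + 1) * mfact M"
    using True by (simp add: mfact_def prod.remove[of _ x] algebra_simps)
  finally show ?thesis by simp
next
  case False
  then have "(\<Prod>y\<in>set_mset M. fact (count (add_mset x M) y)) = (\<Prod>y\<in>set_mset M. fact (count M y) :: nat)"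
    by (intro prod.cong) auto
  with False show ?thesis
    by (simp add: mfact_def count_eq_zero_iff[THEN iffD2])
qed

text \<open>After differentiating along \<open>M\<close>, the constant term sees only the monomial
  \<open>expo M\<close>: any other monomial vanishes or keeps an indeterminate. The induction peels
  off the innermost derivative, so \<open>p\<close> is generalised.\<close>

lemma lookup_Partial_0:
  "Poly_Mapping.lookup (Partial M p) 0 = real (mfact M) * Poly_Mapping.lookup p (expo M)"
proof (induction M arbitrary: p)
  case empty
  then show ?case by (simp add: mfact_def expo_def)
next
  case (add x M)
  have "expo M + Poly_Mapping.single x 1 = expo (add_mset x M)"
    by (simp add: expo_def add.commute)
  then show ?case
    by (simp only: Partial_add_mset' add lookup_partial mfact_add_mset)
       (simp add: lookup_expo algebra_simps)
qed

section \<open>Closed walks as monomials in the trace of a matrix power\<close>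

definition cyc_arcs :: "'v list \<Rightarrow> ('v \<times> 'v) multiset" where
  "cyc_arcs ws = mset (zip ws (rotate1 ws))"

abbreviation words :: "'v set \<Rightarrow> nat \<Rightarrow> 'v list set" where
  "words V N \<equiv> {xs. set xs \<subseteq> V \<and> length xs = N}"

text \<open>A walk is stored as the list of the sources of its arcs, so the end \<open>j\<close> is
  not in the list and is appended to the targets. The positive exponent keeps the list nonempty, so
  that \<open>hd\<close> is the start.\<close>

lemma mat_pow_Suc_walks:
  "finite V \<Longrightarrow> i \<in> V \<Longrightarrow> mat_pow V (Suc N) i j =
     (\<Sum>xs\<in>{xs\<in>words V (Suc N). hd xs = i}. Poly_Mapping.single (expo (mset (zip xs (tl xs @ [j])))) 1)"
proof (induction N arbitrary: j)
  case 0
  have "{xs\<in>words V (Suc 0). hd xs = i} = {[i]}"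
    using 0 by (auto simp: length_Suc_conv)
  moreover have "(\<Sum>l\<in>V. (if i = l then 1 else 0) * indet (l, j)) = (\<Sum>l\<in>V. if i = l then indet (l, j) else 0)"
    by (rule sum.cong) auto
  ultimately show ?case using 0 by (simp add: indet_def expo_def)
next
  case (Suc N)
  let ?B = "{xs\<in>words V (Suc N). hd xs = i}"
  have step: "Poly_Mapping.single (expo (mset (zip xs (tl xs @ [l])))) 1 * indet (l, j) =
      Poly_Mapping.single (expo (mset (zip (xs @ [l]) (tl (xs @ [l]) @ [j])))) 1"
    if "xs \<in> ?B" for xs l
  proof -
    have "zip (xs @ [l]) (tl (xs @ [l]) @ [j]) = zip xs (tl xs @ [l]) @ [(l, j)]"
      using that zip_append[of xs "tl xs @ [l]" "[l]" "[j]"] by (cases xs) auto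
    then show ?thesis by (simp add: indet_def mult_single expo_def add.commute)
  qed
  have "mat_pow V (Suc (Suc N)) i j = (\<Sum>l\<in>V. mat_pow V (Suc N) i l * indet (l, j))"
    by (rule mat_pow.simps)
  also have "\<dots> = (\<Sum>l\<in>V. \<Sum>xs\<in>?B.
      Poly_Mapping.single (expo (mset (zip (xs @ [l]) (tl (xs @ [l]) @ [j])))) 1)"
    using step by (simp only: Suc.IH[OF Suc.prems] sum_distrib_right) (intro sum.cong refl, blast)
  also have "\<dots> = (\<Sum>(l, xs)\<in>V \<times> ?B.
      Poly_Mapping.single (expo (mset (zip (xs @ [l]) (tl (xs @ [l]) @ [j])))) 1)"
    by (rule sum.cartesian_product)
  also have "\<dots> = (\<Sum>xs\<in>{xs\<in>words V (Suc (Suc N)). hd xs = i}.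
      Poly_Mapping.single (expo (mset (zip xs (tl xs @ [j])))) 1)"
  \<comment> \<open>The vertex \<open>l\<close> before the last arc becomes the last letter of the
    longer word.\<close>
  proof (rule sum.reindex_bij_witness[where j = "\<lambda>(l, xs). xs @ [l]" and i = "\<lambda>xs. (last xs, butlast xs)"])
    fix xs assume "xs \<in> {xs \<in> words V (Suc (Suc N)). hd xs = i}"
    moreover from this obtain ys y where "xs = ys @ [y]" by (cases xs rule: rev_cases) auto
    ultimately have "xs = ys @ [y]" "ys \<noteq> []" "set ys \<subseteq> V" "y \<in> V" "length ys = Suc N" "hd xs = i"
      by auto
    then show "(last xs, butlast xs) \<in> V \<times> ?B" "(case (last xs, butlast xs) of (l, xs) \<Rightarrow> xs @ [l]) = xs"
      by auto
  next
    fix a assume "a \<in> V \<times> ?B"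
    moreover from this obtain l ys where "a = (l, ys)" by (cases a)
    ultimately have "a = (l, ys)" "ys \<noteq> []" "set ys \<subseteq> V" "l \<in> V" "length ys = Suc N" "hd ys = i"
      by auto
    then show "(case a of (l, xs) \<Rightarrow> xs @ [l]) \<in> {xs \<in> words V (Suc (Suc N)). hd xs = i}"
      "(last (case a of (l, xs) \<Rightarrow> xs @ [l]), butlast (case a of (l, xs) \<Rightarrow> xs @ [l])) = a"
      by simp_all
    show "Poly_Mapping.single (expo (mset (zip (case a of (l, xs) \<Rightarrow> xs @ [l]) (tl (case a of (l, xs) \<Rightarrow> xs @ [l]) @ [j])))) 1 =
       (case a of (l, xs) \<Rightarrow> Poly_Mapping.single (expo (mset (zip (xs @ [l]) (tl (xs @ [l]) @ [j])))) 1)"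
      by (simp only: \<open>a = (l, ys)\<close> prod.case)
  qed
  finally show ?case .
qed

text \<open>On the diagonal the appended end is the head of the word, so the targets form
  \<open>rotate1\<close> of the word.\<close>

lemma tr_pow_walks:
  assumes "finite V" and "N > 0"
  shows "tr_pow V N = (\<Sum>ws\<in>words V N. Poly_Mapping.single (expo (cyc_arcs ws)) 1)"
proof -
  obtain N' where N: "N = Suc N'" using assms(2) by (cases N) auto
  have fin: "finite (words V N)" by (rule finite_lists_length_eq[OF assms(1)])
  have "tr_pow V N = (\<Sum>i\<in>V. \<Sum>xs\<in>{xs\<in>words V N. hd xs = i}. Poly_Mapping.single (expo (mset (zip xs (tl xs @ [i])))) 1)"
    unfolding tr_pow_def N by (intro sum.cong refl mat_pow_Suc_walks assms(1))
  also have "\<dots> = (\<Sum>i\<in>V. \<Sum>xs\<in>{xs\<in>words V N. hd xs = i}. Poly_Mapping.single (expo (cyc_arcs xs)) 1)"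
  proof (intro sum.cong refl)
    fix i xs assume "xs \<in> {xs\<in>words V N. hd xs = i}"
    then show "Poly_Mapping.single (expo (mset (zip xs (tl xs @ [i])))) 1 = Poly_Mapping.single (expo (cyc_arcs xs)) 1"
      using N by (cases xs) (auto simp: cyc_arcs_def)
  qed
  also have "\<dots> = (\<Sum>ws\<in>words V N. Poly_Mapping.single (expo (cyc_arcs ws)) 1)"
    by (rule sum.group[OF fin assms(1)]) (use N in \<open>auto simp: length_Suc_conv\<close>)
  finally show ?thesis .
qed

text \<open>Closed walks are counted as words, that is, with a marked start; for nonempty
  \<open>M\<close> this is the coefficient of the monomial of \<open>M\<close> in the trace of a
  matrix power.\<close>

definition walks :: "'v set \<Rightarrow> ('v \<times> 'v) multiset \<Rightarrow> nat" where
  "walks V M = card {ws. set ws \<subseteq> V \<and> cyc_arcs ws = M}"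

lemma size_cyc_arcs [simp]: "size (cyc_arcs ws) = length ws"
  by (simp add: cyc_arcs_def)

lemma finite_walks: "finite V \<Longrightarrow> finite {ws. set ws \<subseteq> V \<and> cyc_arcs ws = M}"
  by (rule finite_subset[OF _ finite_lists_length_eq[of V "size M"]]) auto

lemma lookup_Partial_tr_pow:
  assumes "finite V" and "N > 0" and "size M = N"
  shows "Poly_Mapping.lookup (Partial M (tr_pow V N)) 0 = real (mfact M) * real (walks V M)"
proof -
  have fin: "finite (words V N)" by (rule finite_lists_length_eq[OF assms(1)])
  have "Poly_Mapping.lookup (tr_pow V N) (expo M) = (\<Sum>ws\<in>words V N. if cyc_arcs ws = M then 1 else 0)"
    unfolding tr_pow_walks[OF assms(1,2)] lookup_sum
    by (intro sum.cong) (auto simp: lookup_single when_def expo_inject)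
  also have "\<dots> = real (card {ws\<in>words V N. cyc_arcs ws = M})"
    using fin by (simp add: sum.If_cases Int_def)
  also have "{ws\<in>words V N. cyc_arcs ws = M} = {ws. set ws \<subseteq> V \<and> cyc_arcs ws = M}"
    using assms(3) by auto
  finally show ?thesis by (simp add: lookup_Partial_0 walks_def)
qed

section \<open>Expansion of the trace formula over configurations\<close>

abbreviation heads_arcs :: "'v \<Rightarrow> 'v list list \<Rightarrow> ('v \<times> 'v) multiset" where
  "heads_arcs i G \<equiv> mset (map (Pair i) (concat G))"

definition arcs :: "'v set \<Rightarrow> ('v \<Rightarrow> 'v list list) \<Rightarrow> ('v \<times> 'v) multiset" where
  "arcs V \<Gamma> = (\<Sum>i\<in>V. heads_arcs i (\<Gamma> i))"

definition tprod :: "'v set \<Rightarrow> 'v tensor \<Rightarrow> ('v \<Rightarrow> 'v list list) \<Rightarrow> real" where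
  "tprod V T \<Gamma> = (\<Prod>i\<in>V. \<Prod>\<gamma>\<leftarrow>\<Gamma> i. T (i # \<gamma>))"

lemma tensor_op_words:
  "tensor_op V k T i p = (\<Sum>\<gamma>\<in>words V (k - 1). scalar (T (i # \<gamma>)) * Partial (mset (map (Pair i) \<gamma>)) p)"
  unfolding tensor_op_def by (simp only: foldr_partial conj_commute)

text \<open>Each of the \<open>n\<close> applications picks one index list, hence the list
  \<open>G\<close>. Scalars commute with derivatives, so the picks separate into a product of
  entries and one multiset of arcs.\<close>

lemma tensor_op_pow:
  assumes "finite V"
  shows "(tensor_op V k T i ^^ n) p =
    (\<Sum>G\<in>words (words V (k - 1)) n. scalar (\<Prod>\<gamma>\<leftarrow>G. T (i # \<gamma>)) * Partial (heads_arcs i G) p)"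
proof (induction n)
  case 0
  have "words (words V (k - 1)) 0 = {[]}" by auto
  then show ?case by simp
next
  case (Suc n)
  let ?W = "words V (k - 1)"
  have "(tensor_op V k T i ^^ Suc n) p = (\<Sum>\<gamma>\<in>?W. \<Sum>G\<in>words ?W n. 
      scalar (T (i # \<gamma>)) * (scalar (\<Prod>\<gamma>\<leftarrow>G. T (i # \<gamma>)) * Partial (mset (map (Pair i) \<gamma>)) (Partial (heads_arcs i G) p)))"
    by (simp only: funpow.simps o_apply Suc tensor_op_words Partial_sum Partial_scalar_mult sum_distrib_left)
  also have "\<dots> = (\<Sum>\<gamma>\<in>?W. \<Sum>G\<in>words ?W n. 
      scalar (\<Prod>\<gamma>\<leftarrow>\<gamma> # G. T (i # \<gamma>)) * Partial (heads_arcs i (\<gamma> # G)) p)"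
    by (simp add: mult.assoc[symmetric] scalar_mult_scalar Partial_union)
  also have "\<dots> = (\<Sum>(\<gamma>, G)\<in>?W \<times> words ?W n. 
      scalar (\<Prod>\<gamma>\<leftarrow>\<gamma> # G. T (i # \<gamma>)) * Partial (heads_arcs i (\<gamma> # G)) p)"
    by (rule sum.cartesian_product)
  also have "\<dots> = (\<Sum>G\<in>words ?W (Suc n). scalar (\<Prod>\<gamma>\<leftarrow>G. T (i # \<gamma>)) * Partial (heads_arcs i G) p)"
    by (rule sum.reindex_bij_witness[where j = "\<lambda>(\<gamma>, G). \<gamma> # G" and i = "\<lambda>G. (hd G, tl G)"])
       (auto simp: length_Suc_conv)
  finally show ?case .
qed

lemma sum_PiE_insert:
  assumes "i \<notin> A"
  shows "(\<Sum>\<Gamma>\<in>PiE (insert i A) B. h \<Gamma>) = (\<Sum>y\<in>B i. \<Sum>\<Gamma>\<in>PiE A B. h (\<Gamma>(i := y)))"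
proof -
  have "(\<Sum>\<Gamma>\<in>PiE (insert i A) B. h \<Gamma>) = (\<Sum>(y, \<Gamma>)\<in>B i \<times> PiE A B. h (\<Gamma>(i := y)))"
    unfolding PiE_insert_eq using inj_combinator[OF assms, of B]
    by (subst sum.reindex) (auto simp: case_prod_unfold)
  then show ?thesis by (simp add: sum.cartesian_product)
qed

text \<open>The rows \<open>A\<close> treated so far are kept apart from the index range
  \<open>V\<close>: the induction enlarges \<open>A\<close>, while the entries always range over
  \<open>V\<close>.\<close>

lemma fold_tensor_op:
  assumes "finite A" and "finite V"
  shows "Finite_Set.fold (\<lambda>i. tensor_op V k T i ^^ \<delta> i) p A =
    (\<Sum>\<Gamma>\<in>(\<Pi>\<^sub>E i\<in>A. words (words V (k - 1)) (\<delta> i)). scalar (tprod A T \<Gamma>) * Partial (arcs A \<Gamma>) p)"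
  using assms(1)
proof induction
  case empty
  then show ?case by (simp add: tprod_def arcs_def)
next
  case (insert i A)
  interpret comp_fun_commute "\<lambda>i. tensor_op V k T i ^^ \<delta> i" by (rule comp_fun_commute_tensor_op)
  let ?B = "\<lambda>i. words (words V (k - 1)) (\<delta> i)"
  have upd: "tprod (insert i A) T (\<Gamma>(i := G)) = (\<Prod>\<gamma>\<leftarrow>G. T (i # \<gamma>)) * tprod A T \<Gamma>"
    "arcs (insert i A) (\<Gamma>(i := G)) = heads_arcs i G + arcs A \<Gamma>" for \<Gamma> G
  proof -
    have "\<And>j. j \<in> A \<Longrightarrow> (\<Gamma>(i := G)) j = \<Gamma> j" using insert by auto
    then show "tprod (insert i A) T (\<Gamma>(i := G)) = (\<Prod>\<gamma>\<leftarrow>G. T (i # \<gamma>)) * tprod A T \<Gamma>"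
      "arcs (insert i A) (\<Gamma>(i := G)) = heads_arcs i G + arcs A \<Gamma>"
      using insert(1,2) by (simp_all add: tprod_def arcs_def)
  qed
  have "Finite_Set.fold (\<lambda>i. tensor_op V k T i ^^ \<delta> i) p (insert i A) =
    (tensor_op V k T i ^^ \<delta> i) (Finite_Set.fold (\<lambda>i. tensor_op V k T i ^^ \<delta> i) p A)"
    using insert(1,2) by simp
  also have "\<dots> = (\<Sum>G\<in>?B i. \<Sum>\<Gamma>\<in>PiE A ?B. 
     scalar (\<Prod>\<gamma>\<leftarrow>G. T (i # \<gamma>)) * (scalar (tprod A T \<Gamma>) * Partial (heads_arcs i G) (Partial (arcs A \<Gamma>) p)))"
    by (simp only: tensor_op_pow[OF assms(2)] insert.IH Partial_sum Partial_scalar_mult sum_distrib_left)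
  also have "\<dots> = (\<Sum>G\<in>?B i. \<Sum>\<Gamma>\<in>PiE A ?B. 
     scalar (tprod (insert i A) T (\<Gamma>(i := G))) * Partial (arcs (insert i A) (\<Gamma>(i := G))) p)"
    by (simp only: mult.assoc[symmetric] scalar_mult_scalar Partial_union upd)
  also have "\<dots> = (\<Sum>\<Gamma>\<in>PiE (insert i A) ?B. scalar (tprod (insert i A) T \<Gamma>) * Partial (arcs (insert i A) \<Gamma>) p)"
    by (rule sum_PiE_insert[OF insert(2), symmetric])
  finally show ?case .
qed

text \<open>The exponents of the individual operators are not stored: they are the lengths of the
  lists, of which only the sum is prescribed.\<close>

definition conf :: "'v set \<Rightarrow> nat \<Rightarrow> nat \<Rightarrow> ('v \<Rightarrow> 'v list list) set" where
  "conf V k d = {\<Gamma> \<in> V \<rightarrow>\<^sub>E {G. set G \<subseteq> words V (k - 1)}. (\<Sum>i\<in>V. length (\<Gamma> i)) = d}"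

text \<open>What the trace formula attaches to a configuration apart from the tensor entries and the
  global power of \<open>k - 1\<close>: the factorials in the denominator, the constant from
  differentiating, and the number of closed walks.\<close>

definition weight :: "'v set \<Rightarrow> nat \<Rightarrow> ('v \<Rightarrow> 'v list list) \<Rightarrow> real" where
  "weight V k \<Gamma> = (\<Prod>i\<in>V. 1 / fact (length (\<Gamma> i) * (k - 1))) * real (mfact (arcs V \<Gamma>)) * real (walks V (arcs V \<Gamma>))"

lemma size_arcs:
  assumes "finite V" and "\<Gamma> \<in> conf V k d"
  shows "size (arcs V \<Gamma>) = d * (k - 1)"
proof -
  have *: "length (concat G) = length G * (k - 1)" if "set G \<subseteq> words V (k - 1)" for G
    using that by (induction G) auto
  have "size (arcs V \<Gamma>) = (\<Sum>i\<in>V. length (concat (\<Gamma> i)))"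
    unfolding arcs_def using assms(1) by (induction rule: finite_induct) (auto simp: length_concat)
  also have "\<dots> = (\<Sum>i\<in>V. length (\<Gamma> i) * (k - 1))"
    by (intro sum.cong refl *) (use assms(2) in \<open>auto simp: conf_def PiE_def Pi_def\<close>)
  also have "\<dots> = d * (k - 1)"
    using assms(2) by (simp add: conf_def sum_distrib_right[symmetric])
  finally show ?thesis .
qed

lemma finite_conf:
  assumes "finite V"
  shows "finite (conf V k d)"
proof (rule finite_subset)
  have "finite (words V (k - 1))" by (rule finite_lists_length_eq[OF assms])
  then show "finite (V \<rightarrow>\<^sub>E {G. set G \<subseteq> words V (k - 1) \<and> length G \<le> d})"
    by (intro finite_PiE assms finite_lists_length_le)
  show "conf V k d \<subseteq> (V \<rightarrow>\<^sub>E {G. set G \<subseteq> words V (k - 1) \<and> length G \<le> d})"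
  proof
    fix \<Gamma> assume \<Gamma>: "\<Gamma> \<in> conf V k d"
    then have "length (\<Gamma> i) \<le> d" if "i \<in> V" for i
      using member_le_sum[of i V "\<lambda>i. length (\<Gamma> i)"] assms that by (auto simp: conf_def)
    with \<Gamma> show "\<Gamma> \<in> (V \<rightarrow>\<^sub>E {G. set G \<subseteq> words V (k - 1) \<and> length G \<le> d})"
      by (auto simp: conf_def PiE_def Pi_def)
  qed
qed

text \<open>The sum over exponent vectors and the expansion of the operators merge into one sum,
  since the exponent vector is a function of the configuration.\<close>

theorem Tr_conf:
  assumes "finite V" and "d > 0" and "k > 1"
  shows "Tr V k d T = real (k - 1) ^ (card V - 1) * (\<Sum>\<Gamma>\<in>conf V k d. weight V k \<Gamma> * tprod V T \<Gamma>)"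
proof -
  let ?\<Delta> = "{\<delta> \<in> V \<rightarrow>\<^sub>E {..d}. (\<Sum>i\<in>V. \<delta> i) = d}"
  let ?B = "\<lambda>\<delta>. \<Pi>\<^sub>E i\<in>V. words (words V (k - 1)) (\<delta> i)"
  let ?len = "\<lambda>\<Gamma>. \<lambda>i\<in>V. length (\<Gamma> i)"
  have fin: "finite ?\<Delta>"
    by (rule finite_subset[of _ "V \<rightarrow>\<^sub>E {..d}"]) (auto intro!: finite_PiE assms(1))
  have B: "?B \<delta> = {\<Gamma>\<in>conf V k d. ?len \<Gamma> = \<delta>}" if "\<delta> \<in> ?\<Delta>" for \<delta>
  proof (intro set_eqI iffI)
    fix \<Gamma> assume \<Gamma>: "\<Gamma> \<in> ?B \<delta>"
    then have "\<And>i. i \<in> V \<Longrightarrow> length (\<Gamma> i) = \<delta> i" by (auto simp: PiE_def Pi_def)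
    moreover have "?len \<Gamma> = \<delta>"
      using calculation that by (auto simp: fun_eq_iff PiE_def extensional_def)
    ultimately show "\<Gamma> \<in> {\<Gamma>\<in>conf V k d. ?len \<Gamma> = \<delta>}"
      using \<Gamma> that by (auto simp: conf_def PiE_def Pi_def)
  next
    fix \<Gamma> assume \<Gamma>: "\<Gamma> \<in> {\<Gamma>\<in>conf V k d. ?len \<Gamma> = \<delta>}"
    then show "\<Gamma> \<in> ?B \<delta>" by (auto simp: conf_def PiE_def Pi_def)
  qed
  have L: "Poly_Mapping.lookup (Finite_Set.fold (\<lambda>i. tensor_op V k T i ^^ \<delta> i) (tr_pow V (d * (k - 1))) V) 0 =
      (\<Sum>\<Gamma>\<in>{\<Gamma>\<in>conf V k d. ?len \<Gamma> = \<delta>}. tprod V T \<Gamma> * (real (mfact (arcs V \<Gamma>)) * real (walks V (arcs V \<Gamma>))))"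
    if "\<delta> \<in> ?\<Delta>" for \<delta>
    unfolding fold_tensor_op[OF assms(1,1)] B[OF that] lookup_sum lookup_scalar_mult
    using assms by (intro sum.cong refl arg_cong[where f = "\<lambda>x. _ * x"] lookup_Partial_tr_pow size_arcs) auto
  have "(\<Sum>\<delta>\<in>?\<Delta>. (\<Prod>i\<in>V. 1 / fact (\<delta> i * (k - 1))) *
           Poly_Mapping.lookup
             (Finite_Set.fold (\<lambda>i. tensor_op V k T i ^^ \<delta> i) (tr_pow V (d * (k - 1))) V) 0) =
       (\<Sum>\<delta>\<in>?\<Delta>. \<Sum>\<Gamma>\<in>{\<Gamma>\<in>conf V k d. ?len \<Gamma> = \<delta>}. weight V k \<Gamma> * tprod V T \<Gamma>)"
  proof (rule sum.cong[OF refl])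
    fix \<delta> assume \<delta>: "\<delta> \<in> ?\<Delta>"
    show "(\<Prod>i\<in>V. 1 / fact (\<delta> i * (k - 1))) *
           Poly_Mapping.lookup
             (Finite_Set.fold (\<lambda>i. tensor_op V k T i ^^ \<delta> i) (tr_pow V (d * (k - 1))) V) 0 =
         (\<Sum>\<Gamma>\<in>{\<Gamma>\<in>conf V k d. ?len \<Gamma> = \<delta>}. weight V k \<Gamma> * tprod V T \<Gamma>)"
      unfolding L[OF \<delta>] sum_distrib_left
    proof (rule sum.cong[OF refl])
      fix \<Gamma> assume "\<Gamma> \<in> {\<Gamma>\<in>conf V k d. ?len \<Gamma> = \<delta>}"
      then have "(\<Prod>i\<in>V. 1 / fact (\<delta> i * (k - 1))) = (\<Prod>i\<in>V. 1 / fact (length (\<Gamma> i) * (k - 1)) :: real)"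
        by (intro prod.cong) auto
      then show "(\<Prod>i\<in>V. 1 / fact (\<delta> i * (k - 1))) * (tprod V T \<Gamma> * (real (mfact (arcs V \<Gamma>)) * real (walks V (arcs V \<Gamma>)))) = weight V k \<Gamma> * tprod V T \<Gamma>"
        by (simp add: weight_def)
    qed
  qed
  also have "\<dots> = (\<Sum>\<Gamma>\<in>conf V k d. weight V k \<Gamma> * tprod V T \<Gamma>)"
  proof (rule sum.group[OF finite_conf[OF assms(1)] fin], rule image_subsetI)
    fix \<Gamma> assume "\<Gamma> \<in> conf V k d"
    then show "?len \<Gamma> \<in> ?\<Delta>"
      using member_le_sum[of _ V "\<lambda>i. length (\<Gamma> i)"] assms(1) by (auto simp: conf_def)
  qed
  finally show ?thesis using assms(2) by (simp add: Tr_def)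
qed

section \<open>Closed walks and transport of configurations\<close>

lemma image_fst_cyc_arcs: "image_mset fst (cyc_arcs ws) = mset ws"
  by (simp add: cyc_arcs_def flip: mset_map)

text \<open>A word and its rotation are the same multiset: a closed walk enters every vertex as
  often as it leaves it, which is the source of balance.\<close>

lemma image_snd_cyc_arcs: "image_mset snd (cyc_arcs ws) = mset ws"
  by (cases ws) (simp_all add: cyc_arcs_def flip: mset_map)

lemma cyc_arcs_map: "cyc_arcs (map f ws) = image_mset (map_prod f f) (cyc_arcs ws)"
  by (simp add: cyc_arcs_def rotate1_map zip_map_map map_prod_def case_prod_unfold flip: mset_map)

text \<open>Following the walk cyclically from an occurrence of \<open>v\<close> reaches every
  position.\<close>

lemma cyc_arcs_closed:
  assumes "v \<in> set ws" and "v \<in> B" and "\<And>x y. (x, y) \<in># cyc_arcs ws \<Longrightarrow> x \<in> B \<Longrightarrow> y \<in> B"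
  shows "set ws \<subseteq> B"
proof -
  let ?n = "length ws"
  obtain i where i: "i < ?n" "ws ! i = v" using assms(1) by (auto simp: in_set_conv_nth)
  have step: "ws ! (Suc j mod ?n) \<in> B" if "j < ?n" "ws ! j \<in> B" for j
  proof -
    have "(ws ! j, rotate1 ws ! j) \<in> set (zip ws (rotate1 ws))"
      using that(1) by (auto simp: set_zip)
    then show ?thesis
      using assms(3)[of "ws ! j" "rotate1 ws ! j"] that by (simp add: cyc_arcs_def nth_rotate1)
  qed
  have all: "ws ! ((i + t) mod ?n) \<in> B" for t
  proof (induction t)
    case 0
    then show ?case using i assms(2) by simp
  next
    case (Suc t)
    then show ?case using step[of "(i + t) mod ?n"] i(1) mod_less_divisor[of ?n "i + t"]
      by (cases ?n) (simp_all add: mod_Suc_eq)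
  qed
  show ?thesis
  proof
    fix x assume "x \<in> set ws"
    then obtain j where j: "j < ?n" "ws ! j = x" by (auto simp: in_set_conv_nth)
    \<comment> \<open>Adding the length before subtracting keeps the difference of naturals from
      being cut off at 0.\<close>
    then show "x \<in> B" using all[of "j + ?n - i"] i(1) by simp
  qed
qed

definition active :: "'v set \<Rightarrow> ('v \<Rightarrow> 'v list list) \<Rightarrow> 'v set" where
  "active V \<Gamma> = {i\<in>V. \<Gamma> i \<noteq> []}"

lemma in_arcs_iff:
  assumes "finite V"
  shows "(i, j) \<in># arcs V \<Gamma> \<longleftrightarrow> i \<in> V \<and> (\<exists>\<gamma>\<in>set (\<Gamma> i). j \<in> set \<gamma>)"
  unfolding arcs_def set_mset_sum[OF assms] by auto

lemma conf_D:
  assumes "\<Gamma> \<in> conf V k d" and "i \<in> V" and "\<gamma> \<in> set (\<Gamma> i)"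
  shows "set \<gamma> \<subseteq> V" and "length \<gamma> = k - 1"
  using assms by (auto simp: conf_def PiE_def Pi_def)

lemma weight_nonneg: "weight V k \<Gamma> \<ge> 0"
  by (simp add: weight_def prod_nonneg)

lemma count_fst_arcs:
  assumes "finite V" and "\<Gamma> \<in> conf V k d" and "i \<in> V"
  shows "count (image_mset fst (arcs V \<Gamma>)) i = length (\<Gamma> i) * (k - 1)"
proof -
  have c: "count (image_mset fst (heads_arcs j G)) i = (if i = j then length (concat G) else 0)" for j G
  proof -
    have "image_mset fst (heads_arcs j G) = replicate_mset (length (concat G)) j"
      by (simp add: image_mset.compositionality comp_def image_mset_const_eq)
    then show ?thesis by simp
  qed
  have l: "length (concat G) = length G * (k - 1)" if "set G \<subseteq> words V (k - 1)" for G
    using that by (induction G) auto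
  have "count (image_mset fst (arcs V \<Gamma>)) i = (\<Sum>j\<in>V. count (image_mset fst (heads_arcs j (\<Gamma> j))) i)"
    unfolding arcs_def using assms(1) by (induction rule: finite_induct) auto
  also have "\<dots> = length (concat (\<Gamma> i))"
    unfolding c using assms(1,3) by simp
  also have "\<dots> = length (\<Gamma> i) * (k - 1)"
    by (rule l) (use assms(2,3) in \<open>auto simp: conf_def PiE_def Pi_def\<close>)
  finally show ?thesis .
qed

text \<open>A configuration of nonzero weight has a closed walk through its arcs, so the arcs are
  balanced and strongly connect the active vertices.\<close>

context
  fixes V :: "'v set" and k d :: nat and \<Gamma>
  assumes fin: "finite V" and k: "k > 1" and \<Gamma>: "\<Gamma> \<in> conf V k d" and nz: "weight V k \<Gamma> \<noteq> 0"
begin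

text \<open>A nonzero weight includes a nonzero number of closed walks. The vertices of such a walk
  are the sources of its arcs, and since \<open>k > 1\<close> every chosen entry yields at least one
  arc.\<close>

lemma obtain_walk: obtains ws where "set ws \<subseteq> V" "cyc_arcs ws = arcs V \<Gamma>" "set ws = active V \<Gamma>"
proof -
  have "walks V (arcs V \<Gamma>) \<noteq> 0" using nz by (auto simp: weight_def)
  then obtain ws where ws: "set ws \<subseteq> V" "cyc_arcs ws = arcs V \<Gamma>"
    by (metis (mono_tags, lifting) Collect_empty_eq card.empty walks_def)
  have "i \<in> active V \<Gamma> \<longleftrightarrow> (\<exists>j. (i, j) \<in># arcs V \<Gamma>)" for i
  proof -
    have "\<exists>j. j \<in> set (hd (\<Gamma> i))" if "i \<in> V" "\<Gamma> i \<noteq> []"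
    proof -
      have "length (hd (\<Gamma> i)) = k - 1" using conf_D(2)[OF \<Gamma>] that by simp
      then show ?thesis using k by (cases "hd (\<Gamma> i)") auto
    qed
    then show ?thesis using hd_in_set[of "\<Gamma> i"] by (fastforce simp: active_def in_arcs_iff[OF fin])
  qed
  moreover have "i \<in> set ws \<longleftrightarrow> (\<exists>j. (i, j) \<in># arcs V \<Gamma>)" for i
    using arg_cong[OF image_fst_cyc_arcs[of ws], of set_mset] ws(2) by force
  ultimately have "set ws = active V \<Gamma>" by blast
  with ws that show thesis by blast
qed

text \<open>Every vertex that a closed walk enters is one that it leaves, so targets of arcs are
  active again.\<close>

lemma entry_active:
  assumes "i \<in> V" and "\<gamma> \<in> set (\<Gamma> i)"
  shows "set \<gamma> \<subseteq> active V \<Gamma>"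
proof
  fix j assume "j \<in> set \<gamma>"
  obtain ws where ws: "set ws \<subseteq> V" "cyc_arcs ws = arcs V \<Gamma>" "set ws = active V \<Gamma>" by (rule obtain_walk)
  have "(i, j) \<in># cyc_arcs ws" using assms \<open>j \<in> set \<gamma>\<close> ws(2) by (auto simp: in_arcs_iff[OF fin])
  then have "j \<in># image_mset snd (cyc_arcs ws)" by force
  then show "j \<in> active V \<Gamma>" using ws(3) by (simp add: image_snd_cyc_arcs)
qed

lemma balanced:
  assumes "i \<in> V"
  shows "count (image_mset snd (arcs V \<Gamma>)) i = length (\<Gamma> i) * (k - 1)"
proof -
  obtain ws where ws: "set ws \<subseteq> V" "cyc_arcs ws = arcs V \<Gamma>" by (rule obtain_walk)
  then show ?thesis
    using count_fst_arcs[OF fin \<Gamma> assms] by (metis image_fst_cyc_arcs image_snd_cyc_arcs)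
qed

text \<open>One closed walk visits all active vertices, and it cannot leave a set that is closed
  under the chosen entries.\<close>

lemma active_subset_closed:
  assumes "v \<in> active V \<Gamma>" and "v \<in> B"
    and "\<And>i \<gamma>. i \<in> V \<Longrightarrow> i \<in> B \<Longrightarrow> \<gamma> \<in> set (\<Gamma> i) \<Longrightarrow> set \<gamma> \<subseteq> B"
  shows "active V \<Gamma> \<subseteq> B"
proof -
  obtain ws where ws: "cyc_arcs ws = arcs V \<Gamma>" "set ws = active V \<Gamma>" by (rule obtain_walk)
  have "set ws \<subseteq> B"
    by (rule cyc_arcs_closed[of v]) (use ws assms in \<open>auto simp: in_arcs_iff[OF fin]\<close>)
  then show ?thesis using ws by simp
qed

end

section \<open>Invariance under injective relabelling\<close>

lemma mfact_image_mset:
  assumes "inj_on f (set_mset M)"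
  shows "mfact (image_mset f M) = mfact M"
proof -
  have "count (image_mset f M) (f x) = count M x" if "x \<in># M" for x
  proof -
    have "f -` {f x} \<inter> set_mset M = {x}" using assms that by (auto simp: inj_on_def)
    then show ?thesis by (simp add: count_image_mset)
  qed
  then show ?thesis using assms by (simp add: mfact_def prod.reindex)
qed

text \<open>Relabelling maps walks to walks bijectively. Enlarging the vertex set beyond the image
  adds none, because the arcs prescribe all vertices of a walk.\<close>

lemma walks_image_mset:
  assumes "inj_on \<pi> S" and "\<pi> ` S \<subseteq> V" and "set_mset M \<subseteq> S \<times> S"
  shows "walks V (image_mset (map_prod \<pi> \<pi>) M) = walks S M"
proof -
  let ?\<iota> = "inv_into S \<pi>"
  have \<iota>: "image_mset (map_prod ?\<iota> ?\<iota>) (image_mset (map_prod \<pi> \<pi>) M) = M"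
  proof -
    have "image_mset (map_prod ?\<iota> ?\<iota> \<circ> map_prod \<pi> \<pi>) M = image_mset id M"
      using assms(1,3) by (intro image_mset_cong) auto
    then show ?thesis by (simp add: multiset.map_comp)
  qed
  have "bij_betw (map \<pi>) {ws. set ws \<subseteq> S \<and> cyc_arcs ws = M}
      {ws. set ws \<subseteq> V \<and> cyc_arcs ws = image_mset (map_prod \<pi> \<pi>) M}"
  proof (rule bij_betw_byWitness[where f' = "map ?\<iota>"])
    show "\<forall>ws\<in>{ws. set ws \<subseteq> S \<and> cyc_arcs ws = M}. map ?\<iota> (map \<pi> ws) = ws"
      using assms(1) by (auto intro!: map_idI)
    have sub: "set ws \<subseteq> \<pi> ` S" if "cyc_arcs ws = image_mset (map_prod \<pi> \<pi>) M" for ws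
    proof -
      have "mset ws = image_mset fst (image_mset (map_prod \<pi> \<pi>) M)"
        using image_fst_cyc_arcs[of ws] that by simp
      then have "set ws = fst ` map_prod \<pi> \<pi> ` set_mset M" by (metis set_image_mset set_mset_mset)
      then show ?thesis using assms(3) by auto
    qed
    show "\<forall>ws\<in>{ws. set ws \<subseteq> V \<and> cyc_arcs ws = image_mset (map_prod \<pi> \<pi>) M}. map \<pi> (map ?\<iota> ws) = ws"
      using sub by (auto intro!: map_idI simp: f_inv_into_f subset_iff)
    show "map \<pi> ` {ws. set ws \<subseteq> S \<and> cyc_arcs ws = M} \<subseteq> {ws. set ws \<subseteq> V \<and> cyc_arcs ws = image_mset (map_prod \<pi> \<pi>) M}"
      using assms(2) by (fastforce simp: cyc_arcs_map)
    show "map ?\<iota> ` {ws. set ws \<subseteq> V \<and> cyc_arcs ws = image_mset (map_prod \<pi> \<pi>) M} \<subseteq> {ws. set ws \<subseteq> S \<and> cyc_arcs ws = M}"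
    proof (rule image_subsetI)
      fix ws assume "ws \<in> {ws. set ws \<subseteq> V \<and> cyc_arcs ws = image_mset (map_prod \<pi> \<pi>) M}"
      then have "cyc_arcs ws = image_mset (map_prod \<pi> \<pi>) M" "set ws \<subseteq> \<pi> ` S" using sub by auto
      then show "map ?\<iota> ws \<in> {ws. set ws \<subseteq> S \<and> cyc_arcs ws = M}"
        by (auto simp: cyc_arcs_map \<iota> inv_into_into subset_iff)
    qed
  qed
  then show ?thesis by (simp add: walks_def bij_betw_same_card)
qed

text \<open>Copies a configuration along \<open>\<pi>\<close> into a larger vertex set, with no
  entries chosen outside the image; the restriction to \<open>V\<close> places it in the extensional
  function space underlying \<open>conf\<close>.\<close>

definition transport :: "('u \<Rightarrow> 'v) \<Rightarrow> 'u set \<Rightarrow> 'v set \<Rightarrow> ('u \<Rightarrow> 'u list list) \<Rightarrow> ('v \<Rightarrow> 'v list list)" where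
  "transport \<pi> S V \<Gamma> = (\<lambda>v\<in>V. if v \<in> \<pi> ` S then map (map \<pi>) (\<Gamma> (inv_into S \<pi> v)) else [])"

context
  fixes \<pi> :: "'u \<Rightarrow> 'v" and S V
  assumes finV: "finite V" and inj: "inj_on \<pi> S" and sub: "\<pi> ` S \<subseteq> V"
begin

lemma transport_image: "s \<in> S \<Longrightarrow> transport \<pi> S V \<Gamma> (\<pi> s) = map (map \<pi>) (\<Gamma> s)"
  using inj sub by (auto simp: transport_def)

lemma transport_outside: "v \<in> V \<Longrightarrow> v \<notin> \<pi> ` S \<Longrightarrow> transport \<pi> S V \<Gamma> v = []"
  by (simp add: transport_def)

lemma sum_transport:
  assumes "\<And>v. v \<in> V \<Longrightarrow> h v [] = 0"
  shows "(\<Sum>v\<in>V. h v (transport \<pi> S V \<Gamma> v)) = (\<Sum>s\<in>S. h (\<pi> s) (map (map \<pi>) (\<Gamma> s)))"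
proof -
  have "(\<Sum>v\<in>V. h v (transport \<pi> S V \<Gamma> v)) = (\<Sum>v\<in>\<pi> ` S. h v (transport \<pi> S V \<Gamma> v))"
    using finV sub assms by (intro sum.mono_neutral_right) (auto simp: transport_outside)
  also have "\<dots> = (\<Sum>s\<in>S. h (\<pi> s) (map (map \<pi>) (\<Gamma> s)))"
    using inj by (simp add: sum.reindex transport_image)
  finally show ?thesis .
qed

lemma prod_transport:
  assumes "\<And>v. v \<in> V \<Longrightarrow> h v [] = 1"
  shows "(\<Prod>v\<in>V. h v (transport \<pi> S V \<Gamma> v)) = (\<Prod>s\<in>S. h (\<pi> s) (map (map \<pi>) (\<Gamma> s)))"
proof -
  have "(\<Prod>v\<in>V. h v (transport \<pi> S V \<Gamma> v)) = (\<Prod>v\<in>\<pi> ` S. h v (transport \<pi> S V \<Gamma> v))"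
    using finV sub assms by (intro prod.mono_neutral_right) (auto simp: transport_outside)
  also have "\<dots> = (\<Prod>s\<in>S. h (\<pi> s) (map (map \<pi>) (\<Gamma> s)))"
    using inj by (simp add: prod.reindex transport_image)
  finally show ?thesis .
qed

lemma arcs_transport: "arcs V (transport \<pi> S V \<Gamma>) = image_mset (map_prod \<pi> \<pi>) (arcs S \<Gamma>)"
proof -
  have finS: "finite S" using finV inj sub by (metis finite_imageD finite_subset)
  have h: "heads_arcs (\<pi> s) (map (map \<pi>) G) = image_mset (map_prod \<pi> \<pi>) (heads_arcs s G)" for s G
    by (induction G) (auto simp: image_mset.compositionality comp_def)
  have "arcs V (transport \<pi> S V \<Gamma>) = (\<Sum>s\<in>S. heads_arcs (\<pi> s) (map (map \<pi>) (\<Gamma> s)))"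
    unfolding arcs_def by (rule sum_transport) simp
  also have "\<dots> = image_mset (map_prod \<pi> \<pi>) (arcs S \<Gamma>)"
    unfolding h arcs_def using finS by (induction rule: finite_induct) auto
  finally show ?thesis .
qed

lemma tprod_transport: "tprod V T (transport \<pi> S V \<Gamma>) = tprod S (\<lambda>l. T (map \<pi> l)) \<Gamma>"
  unfolding tprod_def by (subst prod_transport) (auto simp: comp_def)

lemma weight_transport:
  assumes "\<Gamma> \<in> conf S k d"
  shows "weight V k (transport \<pi> S V \<Gamma>) = weight S k \<Gamma>"
proof -
  have finS: "finite S" using finV inj sub by (metis finite_imageD finite_subset)
  have M: "set_mset (arcs S \<Gamma>) \<subseteq> S \<times> S"
    using conf_D(1)[OF assms] by (fastforce simp: in_arcs_iff[OF finS])
  have "inj_on (map_prod \<pi> \<pi>) (set_mset (arcs S \<Gamma>))"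
    by (rule inj_on_subset[OF map_prod_inj_on[OF inj inj] M])
  moreover have "(\<Prod>i\<in>V. 1 / fact (length (transport \<pi> S V \<Gamma> i) * (k - 1))) = (\<Prod>i\<in>S. 1 / fact (length (\<Gamma> i) * (k - 1)) :: real)"
    by (subst prod_transport[where h = "\<lambda>_ G. 1 / fact (length G * (k - 1))"]) auto
  ultimately show ?thesis
    by (simp add: weight_def arcs_transport mfact_image_mset walks_image_mset[OF inj sub M])
qed

end

text \<open>The contribution of the configurations with active set exactly \<open>S\<close>, written
  intrinsically so that it no longer refers to a surrounding hypergraph.\<close>

definition full_sum :: "'v set \<Rightarrow> nat \<Rightarrow> nat \<Rightarrow> 'v tensor \<Rightarrow> real" where
  "full_sum S k d T = (\<Sum>\<Gamma>\<in>{\<Gamma>\<in>conf S k d. active S \<Gamma> = S}. weight S k \<Gamma> * tprod S T \<Gamma>)"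

text \<open>Closed walks confine the entries of a contributing configuration to its active set, so
  it is the copy of a configuration on \<open>S\<close>; the sum depends only on the tensor
  restricted to that set.\<close>

lemma sum_conf_active:
  assumes fin: "finite V" and inj: "inj_on \<pi> S" and sub: "\<pi> ` S \<subseteq> V" and k: "k > 1"
  shows "(\<Sum>\<Gamma>\<in>{\<Gamma>\<in>conf V k d. active V \<Gamma> = \<pi> ` S}. weight V k \<Gamma> * tprod V T \<Gamma>) =
    full_sum S k d (\<lambda>l. T (map \<pi> l))"
proof -
  let ?\<iota> = "inv_into S \<pi>"
  let ?C = "{\<Gamma>\<in>conf V k d. active V \<Gamma> = \<pi> ` S}"
  let ?C' = "{\<Gamma>\<in>?C. \<forall>i\<in>V. \<forall>\<gamma>\<in>set (\<Gamma> i). set \<gamma> \<subseteq> \<pi> ` S}"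
  \<comment> \<open>Configurations with an entry that leaves the active set have weight 0.\<close>
  have "(\<Sum>\<Gamma>\<in>?C. weight V k \<Gamma> * tprod V T \<Gamma>) = (\<Sum>\<Gamma>\<in>?C'. weight V k \<Gamma> * tprod V T \<Gamma>)"
    using entry_active[OF fin k] finite_conf[OF fin, of k d] by (intro sum.mono_neutral_right) fastforce+
  also have "\<dots> = full_sum S k d (\<lambda>l. T (map \<pi> l))"
    unfolding full_sum_def
  proof (rule sum.reindex_bij_witness[where i = "transport \<pi> S V" and j = "\<lambda>\<Gamma>. \<lambda>s\<in>S. map (map ?\<iota>) (\<Gamma> (\<pi> s))"])
    fix \<Gamma> assume \<Gamma>: "\<Gamma> \<in> ?C'"
    then have conf: "\<Gamma> \<in> conf V k d" and act: "active V \<Gamma> = \<pi> ` S"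
      and ent: "\<And>i \<gamma>. i \<in> V \<Longrightarrow> \<gamma> \<in> set (\<Gamma> i) \<Longrightarrow> set \<gamma> \<subseteq> \<pi> ` S" by auto
    let ?\<Delta> = "\<lambda>s\<in>S. map (map ?\<iota>) (\<Gamma> (\<pi> s))"
    have inverse_map: "map (map \<pi>) (map (map ?\<iota>) (\<Gamma> i)) = \<Gamma> i" if "i \<in> V" for i
      using ent[OF that] by (auto intro!: map_idI simp: f_inv_into_f subset_iff)
    show tr: "transport \<pi> S V ?\<Delta> = \<Gamma>"
    proof
      fix v
      consider "v \<notin> V" | "v \<in> V" "v \<notin> \<pi> ` S" | s where "s \<in> S" "v = \<pi> s" by auto
      then show "transport \<pi> S V ?\<Delta> v = \<Gamma> v"
      proof cases
        case 1
        then show ?thesis using conf by (auto simp: transport_def conf_def PiE_def extensional_def)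
      next
        case 2
        then show ?thesis using act by (auto simp: transport_def active_def)
      next
        case 3
        then show ?thesis using inverse_map[of v] sub transport_image[OF fin inj sub, of s ?\<Delta>] by auto
      qed
    qed
    have "(\<Sum>v\<in>V. length (\<Gamma> v)) = (\<Sum>s\<in>S. length (?\<Delta> s))"
      using sum_transport[OF fin inj sub, of "\<lambda>_. length" ?\<Delta>] unfolding tr by simp
    then have "(\<Sum>s\<in>S. length (?\<Delta> s)) = d" using conf by (simp add: conf_def)
    moreover have "map (map ?\<iota>) (\<Gamma> (\<pi> s)) \<in> {G. set G \<subseteq> words S (k - 1)}" if "s \<in> S" for s
    proof -
      have "\<pi> s \<in> V" using that sub by auto
      then show ?thesis
        using ent[of "\<pi> s"] conf_D(2)[OF conf, of "\<pi> s"] by (fastforce simp: inv_into_into)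
    qed
    ultimately have "?\<Delta> \<in> conf S k d" by (auto simp: conf_def)
    moreover have "active S ?\<Delta> = S" using act sub by (auto simp: active_def)
    ultimately show "?\<Delta> \<in> {\<Gamma>\<in>conf S k d. active S \<Gamma> = S}" by simp
    show "weight S k ?\<Delta> * tprod S (\<lambda>l. T (map \<pi> l)) ?\<Delta> = weight V k \<Gamma> * tprod V T \<Gamma>"
      using weight_transport[OF fin inj sub \<open>?\<Delta> \<in> conf S k d\<close>] tprod_transport[OF fin inj sub, of T ?\<Delta>]
      unfolding tr by simp
  next
    fix \<Gamma> assume "\<Gamma> \<in> {\<Gamma>\<in>conf S k d. active S \<Gamma> = S}"
    then have conf: "\<Gamma> \<in> conf S k d" and act: "active S \<Gamma> = S" by auto
    show "(\<lambda>s\<in>S. map (map ?\<iota>) (transport \<pi> S V \<Gamma> (\<pi> s))) = \<Gamma>"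
    proof
      fix s
      show "(\<lambda>s\<in>S. map (map ?\<iota>) (transport \<pi> S V \<Gamma> (\<pi> s))) s = \<Gamma> s"
      proof (cases "s \<in> S")
        case True
        have "map (map ?\<iota>) (map (map \<pi>) (\<Gamma> s)) = \<Gamma> s"
          using conf_D(1)[OF conf True] inj by (fastforce intro!: map_idI inv_into_f_f)
        with True show ?thesis using transport_image[OF fin inj sub True, of \<Gamma>] by simp
      next
        case False
        then show ?thesis using conf by (auto simp: conf_def PiE_def extensional_def)
      qed
    qed
    have ent: "\<gamma> \<in> words (\<pi> ` S) (k - 1)" if v: "v \<in> V" "\<gamma> \<in> set (transport \<pi> S V \<Gamma> v)" for v \<gamma>
    proof (cases "v \<in> \<pi> ` S")
      case True
      then obtain s where s: "s \<in> S" "v = \<pi> s" by auto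
      then obtain \<gamma>' where "\<gamma>' \<in> set (\<Gamma> s)" "\<gamma> = map \<pi> \<gamma>'"
        using v transport_image[OF fin inj sub, of s \<Gamma>] by auto
      then show ?thesis using conf_D[OF conf s(1)] by auto
    next
      case False
      then show ?thesis using that by (simp add: transport_def)
    qed
    have "(\<Sum>v\<in>V. length (transport \<pi> S V \<Gamma> v)) = d"
      using sum_transport[OF fin inj sub, of "\<lambda>_. length" \<Gamma>] conf by (simp add: conf_def)
    then have "transport \<pi> S V \<Gamma> \<in> conf V k d"
      using ent sub by (fastforce simp: conf_def transport_def)
    moreover have "active V (transport \<pi> S V \<Gamma>) = \<pi> ` S"
    proof -
      have "transport \<pi> S V \<Gamma> (\<pi> s) \<noteq> []" if "s \<in> S" for s
        using act that transport_image[OF fin inj sub that, of \<Gamma>] by (auto simp: active_def)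
      moreover have "transport \<pi> S V \<Gamma> v = []" if "v \<in> V" "v \<notin> \<pi> ` S" for v
        using that by (simp add: transport_def)
      ultimately show ?thesis using sub unfolding active_def by blast
    qed
    ultimately show "transport \<pi> S V \<Gamma> \<in> ?C'" using ent by auto
  qed
  finally show ?thesis .
qed

lemma full_sum_cong:
  assumes "\<And>l. set l \<subseteq> S \<Longrightarrow> length l = k \<Longrightarrow> T l = T' l" and "k > 0"
  shows "full_sum S k d T = full_sum S k d T'"
proof -
  have "tprod S T \<Gamma> = tprod S T' \<Gamma>" if "\<Gamma> \<in> conf S k d" for \<Gamma>
  proof -
    have "map (\<lambda>\<gamma>. T (i # \<gamma>)) (\<Gamma> i) = map (\<lambda>\<gamma>. T' (i # \<gamma>)) (\<Gamma> i)" if "i \<in> S" for i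
      using conf_D[OF \<open>\<Gamma> \<in> conf S k d\<close> that] assms that by (auto intro!: assms(1))
    then show ?thesis unfolding tprod_def by (intro prod.cong refl arg_cong[where f = prod_list])
  qed
  then show ?thesis by (simp add: full_sum_def)
qed

lemma full_sum_bij:
  assumes "finite V" and "bij_betw \<pi> S V" and "k > 1"
  shows "full_sum V k d T = full_sum S k d (\<lambda>l. T (map \<pi> l))"
  using sum_conf_active[OF assms(1) bij_betw_imp_inj_on[OF assms(2)] _ assms(3)] bij_betw_imp_surj_on[OF assms(2)]
  by (simp add: full_sum_def)

section \<open>Contributions of vertices and edges\<close>

lemma tprod_nonzero_D:
  assumes "finite V" and "tprod V T \<Gamma> \<noteq> 0" and "i \<in> V" and "\<gamma> \<in> set (\<Gamma> i)"
  shows "T (i # \<gamma>) \<noteq> 0"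
proof -
  have "(\<Prod>\<gamma>\<leftarrow>\<Gamma> i. T (i # \<gamma>)) \<noteq> 0" using assms by (simp add: tprod_def)
  then show ?thesis using assms(4) by (auto simp: prod_list_zero_iff)
qed

lemma A_tensor_nonzero_D:
  assumes "A_tensor \<alpha> k H (i # \<gamma>) \<noteq> 0" and "k > 0" and "length \<gamma> = k - 1"
  shows "\<gamma> = replicate (k - 1) i \<or> insert i (set \<gamma>) \<in> hedges H"
proof (cases "insert i (set \<gamma>) \<in> hedges H")
  case False
  then have "i # \<gamma> = replicate k i"
    using assms(1) by (auto simp: A_tensor_def adj_tensor_def deg_tensor_def split: if_splits)
  then show ?thesis using assms(2) by (cases k) auto
qed simp

lemma card_active_le:
  assumes "finite V" and "\<Gamma> \<in> conf V k d"
  shows "card (active V \<Gamma>) \<le> d"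
proof -
  have "card (active V \<Gamma>) = (\<Sum>i\<in>active V \<Gamma>. 1)" by simp
  also have "\<dots> \<le> (\<Sum>i\<in>active V \<Gamma>. length (\<Gamma> i))"
    by (rule sum_mono) (auto simp: active_def Suc_le_eq)
  also have "\<dots> \<le> (\<Sum>i\<in>V. length (\<Gamma> i))"
    using assms(1) by (intro sum_mono2) (auto simp: active_def)
  finally show ?thesis using assms(2) by (simp add: conf_def)
qed

lemma count_snd_arcs:
  assumes "finite V"
  shows "count (image_mset snd (arcs V \<Gamma>)) v = (\<Sum>i\<in>V. count (mset (concat (\<Gamma> i))) v)"
  unfolding arcs_def using assms
  by (induction rule: finite_induct) (auto simp: image_mset.compositionality comp_def)

text \<open>Two distinct edges through active vertices would need \<open>2k - 1\<close> of them, so \<open>k = 3\<close> and \<open>d = 5\<close>;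
  then every vertex is the root of exactly one edge and balance makes each of the
  two edges have three roots, which is one root too many.\<close>

lemma active_vertex_or_edge:
  assumes hyp: "hypergraph H" and uni: "uniform k H" and lin: "linear_hg H"
    and k: "k \<ge> 3" and d: "1 \<le> d" "d \<le> k + 2"
    and \<Gamma>: "\<Gamma> \<in> conf (verts H) k d" and w: "weight (verts H) k \<Gamma> \<noteq> 0"
    and t: "tprod (verts H) (A_tensor \<alpha> k H) \<Gamma> \<noteq> 0"
  shows "active (verts H) \<Gamma> \<in> (\<lambda>v. {v}) ` verts H \<union> hedges H"
proof -
  let ?V = "verts H" and ?S = "active (verts H) \<Gamma>"
  have fin: "finite ?V" using hyp by (simp add: hypergraph_def)
  have k1: "k > 1" using k by simp
  have finS: "finite ?S" and SV: "?S \<subseteq> ?V" using fin by (auto simp: active_def)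
  have cardS: "card ?S \<le> d" by (rule card_active_le[OF fin \<Gamma>])
  have card_edge: "card e = k" if "e \<in> hedges H" for e using that uni by (auto simp: uniform_def)
  have "\<exists>v\<in>?V. \<Gamma> v \<noteq> []"
  proof (rule ccontr)
    assume "\<not> ?thesis"
    then have "(\<Sum>i\<in>?V. length (\<Gamma> i)) = 0" by simp
    then show False using \<Gamma> d by (simp add: conf_def)
  qed
  then obtain v where v: "v \<in> ?S" by (auto simp: active_def)
  have ent: "\<gamma> = replicate (k - 1) i \<or> insert i (set \<gamma>) \<in> hedges H"
    if "i \<in> ?V" "\<gamma> \<in> set (\<Gamma> i)" for i \<gamma>
    using A_tensor_nonzero_D[OF tprod_nonzero_D[OF fin t that]] conf_D(2)[OF \<Gamma> that] k by simp
  have entS: "insert i (set \<gamma>) \<subseteq> ?S" if "i \<in> ?V" "\<gamma> \<in> set (\<Gamma> i)" for i \<gamma>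
    using entry_active[OF fin k1 \<Gamma> w that] that by (auto simp: active_def)
  note closed = active_subset_closed[OF fin k1 \<Gamma> w]
  show ?thesis
  proof (cases "\<forall>i\<in>?V. \<forall>\<gamma>\<in>set (\<Gamma> i). \<gamma> = replicate (k - 1) i")
    case True
    have "?S \<subseteq> {v}"
    proof (rule closed[OF v])
      fix i \<gamma> assume "i \<in> ?V" "i \<in> {v}" "\<gamma> \<in> set (\<Gamma> i)"
      then have "\<gamma> = replicate (k - 1) v" using True by blast
      then show "set \<gamma> \<subseteq> {v}" by (simp add: set_replicate_conv_if)
    qed simp
    then have "?S = {v}" using v by auto
    then show ?thesis using v SV by auto
  next
    case False
    then obtain i0 \<gamma>0 where i0: "i0 \<in> ?V" "\<gamma>0 \<in> set (\<Gamma> i0)" "\<gamma>0 \<noteq> replicate (k - 1) i0" by auto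
    define e where "e = insert i0 (set \<gamma>0)"
    have e: "e \<in> hedges H" "e \<subseteq> ?S" using ent[OF i0(1,2)] i0(3) entS[OF i0(1,2)] by (auto simp: e_def)
    have fine: "finite e" by (simp add: e_def)
    \<comment> \<open>A vertex with diagonal entries only cannot be left by the walk and would be
      the only active one, while \<open>e\<close> already has \<open>k\<close> of them.\<close>
    have nonloop: "\<exists>\<gamma>\<in>set (\<Gamma> i). \<gamma> \<noteq> replicate (k - 1) i" if "i \<in> ?S" for i
    proof (rule ccontr)
      assume "\<not> ?thesis"
      then have "?S \<subseteq> {i}" by (intro closed[OF that]) auto
      then have "card e \<le> card {i}" using e(2) by (intro card_mono) auto
      then show False using card_edge[OF e(1)] k by simp
    qed
    have "?S = e"
    proof (rule ccontr)
      assume "?S \<noteq> e"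
      \<comment> \<open>If all entries rooted in \<open>e\<close> stayed in \<open>e\<close>, the
        walk would never leave it; hence a second edge \<open>f\<close> is rooted at some vertex of
        \<open>e\<close>.\<close>
      have "\<not> (\<forall>i\<in>?V. i \<in> e \<longrightarrow> (\<forall>\<gamma>\<in>set (\<Gamma> i). set \<gamma> \<subseteq> e))"
      proof
        assume "\<forall>i\<in>?V. i \<in> e \<longrightarrow> (\<forall>\<gamma>\<in>set (\<Gamma> i). set \<gamma> \<subseteq> e)"
        then have "?S \<subseteq> e" using e(2) i0(1) by (intro closed[of i0 e]) (auto simp: e_def)
        then show False using e(2) \<open>?S \<noteq> e\<close> by blast
      qed
      then obtain i \<gamma> where i: "i \<in> ?V" "i \<in> e" "\<gamma> \<in> set (\<Gamma> i)" "\<not> set \<gamma> \<subseteq> e" by auto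
      define f where "f = insert i (set \<gamma>)"
      have "\<gamma> \<noteq> replicate (k - 1) i" using i by auto
      then have f: "f \<in> hedges H" "f \<subseteq> ?S" "f \<noteq> e" "finite f"
        using ent[OF i(1,3)] entS[OF i(1,3)] i by (auto simp: f_def)
      have "card (e \<inter> f) \<le> 1" using lin e f by (auto simp: linear_hg_def)
      moreover have "card e + card f = card (e \<union> f) + card (e \<inter> f)"
        by (rule card_Un_Int) (use fine f in auto)
      moreover have "card (e \<union> f) \<le> card ?S" using e f finS by (intro card_mono) auto
      \<comment> \<open>There are at least 2k - 1 active vertices in \<open>e \<union> f\<close> and
        at most \<open>d \<le> k + 2\<close> in all, so with \<open>k \<ge> 3\<close> all
        inequalities are equalities.\<close>
      ultimately have k3: "k = 3" and d5: "d = 5" and S5: "card ?S = 5" "card (e \<union> f) = 5"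
        using cardS d k card_edge[OF e(1)] card_edge[OF f(1)] by auto
      have Sef: "?S = e \<union> f" using S5 e f finS by (intro card_subset_eq[symmetric]) auto
      have len: "length (\<Gamma> j) = 1" if "j \<in> ?S" for j
      proof -
        have ge: "1 \<le> length (\<Gamma> j)" if "j \<in> ?S" for j using that by (auto simp: active_def Suc_le_eq)
        have "(\<Sum>j\<in>?S. length (\<Gamma> j)) = (\<Sum>j\<in>?V. length (\<Gamma> j))"
          using fin by (intro sum.mono_neutral_left) (auto simp: active_def)
        also have "\<dots> = (\<Sum>j\<in>?S. 1)" using \<Gamma> d5 S5 by (simp add: conf_def)
        finally have "(\<Sum>j\<in>?S. length (\<Gamma> j)) = (\<Sum>j\<in>?S. 1)" .
        then show ?thesis using sum_mono_inv[of "\<lambda>_. 1" ?S "\<lambda>j. length (\<Gamma> j)" j] ge that finS by auto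
      qed
      define E where "E j = insert j (set (hd (\<Gamma> j)))" for j
      have E: "E j \<in> hedges H" "E j \<subseteq> ?S" "\<Gamma> j = [hd (\<Gamma> j)]" if j: "j \<in> ?S" for j
      proof -
        obtain \<gamma>' where \<gamma>': "\<Gamma> j = [\<gamma>']" using len[OF j] by (auto simp: length_Suc_conv)
        show "E j \<in> hedges H" "E j \<subseteq> ?S" "\<Gamma> j = [hd (\<Gamma> j)]"
          using nonloop[OF j] ent[of j \<gamma>'] entS[of j \<gamma>'] j SV \<gamma>' by (auto simp: E_def)
      qed
      \<comment> \<open>A third edge would share at most one vertex with each of \<open>e\<close>
        and \<open>f\<close>, hence have at most two vertices inside their union.\<close>
      have E_ef: "E j = e \<or> E j = f" if "j \<in> ?S" for j
      proof (rule ccontr)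
        assume "\<not> ?thesis"
        then have "card (E j \<inter> e) \<le> 1" "card (E j \<inter> f) \<le> 1"
          using lin e f E[OF that] by (auto simp: linear_hg_def)
        moreover have "E j = (E j \<inter> e) \<union> (E j \<inter> f)" using E(2)[OF that] Sef by auto
        then have "card (E j) \<le> card (E j \<inter> e) + card (E j \<inter> f)" by (metis card_Un_le)
        ultimately show False using card_edge[OF E(1)[OF that]] k3 by simp
      qed
      have three: "card {j\<in>?S. E j = x} = 3"
        if x: "x \<in> {e, f}" and y: "y \<in> {e, f}" and xy: "x \<noteq> y" for x y
      proof -
        have xe: "x \<in> hedges H" "y \<in> hedges H" "x \<subseteq> ?S" "finite y" using x y e f fine by auto
        then have "\<not> x \<subseteq> y" using xy card_edge by (metis card_subset_eq)
        \<comment> \<open>Of the two edges, \<open>u\<close> lies only on \<open>x\<close>. Balance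
          at \<open>u\<close> asks for \<open>k - 1 = 2\<close> incoming arcs, one from each other
          root of \<open>x\<close>, and \<open>u\<close> itself is the third root.\<close>
        then obtain u where u: "u \<in> x" "u \<notin> y" by auto
        have uS: "u \<in> ?S" using u xe by auto
        have in_E: "u \<in> E j \<longleftrightarrow> E j = x" if "j \<in> ?S" for j
          using E_ef[OF that] x y xy u by auto
        have cnt: "count (mset (concat (\<Gamma> j))) u = (if j \<noteq> u \<and> E j = x then 1 else 0)" if "j \<in> ?S" for j
        proof -
          let ?\<gamma> = "hd (\<Gamma> j)"
          have g: "\<Gamma> j = [?\<gamma>]" by (rule E(3)[OF that])
          have "?\<gamma> \<in> set (\<Gamma> j)" using g by (metis list.set_intros(1))
          then have "length ?\<gamma> = 2" using conf_D(2)[OF \<Gamma>, of j ?\<gamma>] that SV k3 by auto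
          moreover have "card (insert j (set ?\<gamma>)) = 3" using card_edge[OF E(1)[OF that]] k3 by (simp add: E_def)
          ultimately have "j \<notin> set ?\<gamma>" "distinct ?\<gamma>"
            using card_length[of ?\<gamma>] by (auto simp: card_insert_if card_distinct split: if_splits)
          then have "count (mset ?\<gamma>) u = (if u \<in> set ?\<gamma> then 1 else 0)"
            by (simp add: distinct_count_atmost_1)
          moreover have "concat (\<Gamma> j) = ?\<gamma>" by (subst g) simp
          moreover have "u \<in> set ?\<gamma> \<longleftrightarrow> j \<noteq> u \<and> E j = x"
            using in_E[OF that] \<open>j \<notin> set ?\<gamma>\<close> by (auto simp: E_def)
          ultimately show ?thesis by simp
        qed
        have "2 = count (image_mset snd (arcs ?V \<Gamma>)) u"
          using balanced[OF fin k1 \<Gamma> w, of u] len[OF uS] uS SV k3 by auto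
        also have "\<dots> = (\<Sum>j\<in>?S. count (mset (concat (\<Gamma> j))) u)"
          unfolding count_snd_arcs[OF fin] using fin by (intro sum.mono_neutral_right) (auto simp: active_def)
        also have "\<dots> = card {j\<in>?S. j \<noteq> u \<and> E j = x}"
          using finS by (simp add: cnt sum.If_cases Int_def)
        finally have "card {j\<in>?S. j \<noteq> u \<and> E j = x} = 2" by simp
        moreover have "{j\<in>?S. E j = x} = insert u {j\<in>?S. j \<noteq> u \<and> E j = x}"
          using in_E[OF uS] uS by (auto simp: E_def)
        ultimately show ?thesis using finS by simp
      qed
      have "?S = {j\<in>?S. E j = e} \<union> {j\<in>?S. E j = f}" using E_ef by auto
      moreover have "card ({j\<in>?S. E j = e} \<union> {j\<in>?S. E j = f}) = card {j\<in>?S. E j = e} + card {j\<in>?S. E j = f}"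
        using finS f(3) by (intro card_Un_disjoint) auto
      ultimately show False using three[of e f] three[of f e] f(3) S5 by simp
    qed
    then show ?thesis using e by simp
  qed
qed

text \<open>The restriction of \<open>A_tensor\<close> to one edge, carried over to
  \<open>{..<k}\<close>. The degrees become a free parameter \<open>D\<close>, which is all that the
  rest of the hypergraph leaves behind.\<close>

definition edge_tensor :: "real \<Rightarrow> nat \<Rightarrow> (nat \<Rightarrow> real) \<Rightarrow> nat tensor" where
  "edge_tensor \<alpha> k D l = \<alpha> * (if l = replicate k (hd l) then D (hd l) else 0) +
     (1 - \<alpha>) * (if length l = k \<and> set l = {..<k} then 1 / fact (k - 1) else 0)"

definition edge_sum :: "real \<Rightarrow> nat \<Rightarrow> nat \<Rightarrow> (nat \<Rightarrow> real) \<Rightarrow> real" where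
  "edge_sum \<alpha> k d D = full_sum {..<k} k d (edge_tensor \<alpha> k D)"

text \<open>The contribution of a single vertex with diagonal entry 1, with \<open>unit\<close> as
  the one-vertex model. About its value only the sign is established.\<close>

definition vertex_coeff :: "nat \<Rightarrow> nat \<Rightarrow> real" where
  "vertex_coeff k d = full_sum {()} k d (\<lambda>_. 1)"

lemma full_sum_vertex: "full_sum {()} k d (\<lambda>_. c) = vertex_coeff k d * c ^ d"
proof -
  have "tprod {()} (\<lambda>_. c) \<Gamma> = c ^ d" if "\<Gamma> \<in> conf {()} k d" for \<Gamma>
    using that by (simp add: tprod_def conf_def map_replicate_const)
  moreover have "tprod {()} (\<lambda>_. 1) \<Gamma> = 1" for \<Gamma>
    by (simp add: tprod_def map_replicate_const)
  ultimately show ?thesis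
    by (simp add: full_sum_def vertex_coeff_def sum_distrib_right)
qed

lemma map_eq_replicate_hd_iff:
  assumes "inj_on f S" and "set l \<subseteq> S" and "l \<noteq> []"
  shows "map f l = replicate k (f (hd l)) \<longleftrightarrow> l = replicate k (hd l)"
proof
  assume "map f l = replicate k (f (hd l))"
  then have "map f l = map f (replicate k (hd l))" by simp
  then show "l = replicate k (hd l)"
  proof (rule map_inj_on)
    have "set l \<union> set (replicate k (hd l)) \<subseteq> S"
      using assms(2) hd_in_set[OF assms(3)] by (auto simp: set_replicate_conv_if)
    then show "inj_on f (set l \<union> set (replicate k (hd l)))" by (rule inj_on_subset[OF assms(1)])
  qed
next
  assume "l = replicate k (hd l)"
  then show "map f l = replicate k (f (hd l))" by (metis map_replicate)
qed

text \<open>A list over \<open>e\<close> whose letters form a hyperedge has \<open>k\<close>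
  different letters by uniformity, so it exhausts \<open>e\<close>; no other hyperedge interferes
  with the model.\<close>

lemma A_tensor_edge:
  assumes "uniform k H" and "e \<in> hedges H" and "bij_betw \<pi> {..<k} e" and "k > 0"
    and "set l \<subseteq> {..<k}" and "length l = k"
  shows "A_tensor \<alpha> k H (map \<pi> l) = edge_tensor \<alpha> k (\<lambda>i. real (degree H (\<pi> i))) l"
proof -
  have inj: "inj_on \<pi> {..<k}" and im: "\<pi> ` {..<k} = e" using assms(3) by (auto simp: bij_betw_def)
  have ne: "l \<noteq> []" using assms by auto
  have hd: "hd (map \<pi> l) = \<pi> (hd l)" using ne by (simp add: hd_map)
  have "map \<pi> l = replicate k (\<pi> (hd l)) \<longleftrightarrow> l = replicate k (hd l)"
    by (rule map_eq_replicate_hd_iff[OF inj assms(5) ne])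
  moreover have "set (map \<pi> l) \<in> hedges H \<longleftrightarrow> set l = {..<k}"
  proof
    assume "set (map \<pi> l) \<in> hedges H"
    then have "card (\<pi> ` set l) = k" using assms(1) by (auto simp: uniform_def)
    moreover have "card (\<pi> ` set l) = card (set l)"
      by (rule card_image) (rule inj_on_subset[OF inj assms(5)])
    ultimately show "set l = {..<k}" using assms(5) by (intro card_subset_eq) auto
  qed (use im assms(2) in auto)
  ultimately show ?thesis
    using assms(6) by (simp add: A_tensor_def deg_tensor_def adj_tensor_def edge_tensor_def hd)
qed

text \<open>Contributing configurations are grouped by active set. Singletons and edges do not
  overlap because \<open>k \<ge> 3\<close>, and each edge may be numbered by any bijection
  \<open>\<pi> e\<close>.\<close>

theorem Tr_A_decomposition:
  assumes hyp: "hypergraph H" and uni: "uniform k H" and lin: "linear_hg H"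
    and k: "k \<ge> 3" and d: "1 \<le> d" "d \<le> k + 2"
    and \<pi>: "\<And>e. e \<in> hedges H \<Longrightarrow> bij_betw (\<pi> e) {..<k} e"
  shows "Tr_A \<alpha> k d H = real (k - 1) ^ (card (verts H) - 1) *
    (vertex_coeff k d * (\<Sum>v\<in>verts H. (\<alpha> * real (degree H v)) ^ d) +
     (\<Sum>e\<in>hedges H. edge_sum \<alpha> k d (\<lambda>i. real (degree H (\<pi> e i)))))"
proof -
  let ?V = "verts H" and ?T = "A_tensor \<alpha> k H"
  let ?f = "\<lambda>\<Gamma>. weight ?V k \<Gamma> * tprod ?V ?T \<Gamma>"
  let ?F = "\<lambda>S. \<Sum>\<Gamma>\<in>{\<Gamma>\<in>conf ?V k d. active ?V \<Gamma> = S}. ?f \<Gamma>"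
  let ?\<Omega> = "(\<lambda>v. {v}) ` ?V \<union> hedges H"
  have fin: "finite ?V" and eV: "\<And>e. e \<in> hedges H \<Longrightarrow> e \<subseteq> ?V" using hyp by (auto simp: hypergraph_def)
  have finE: "finite (hedges H)" by (rule finite_subset[of _ "Pow ?V"]) (use fin eV in auto)
  have k1: "k > 1" using k by simp
  have disj: "(\<lambda>v. {v}) ` ?V \<inter> hedges H = {}" using uni k by (auto simp: uniform_def)
  have "(\<Sum>\<Gamma>\<in>conf ?V k d. ?f \<Gamma>) = (\<Sum>\<Gamma>\<in>{\<Gamma>\<in>conf ?V k d. active ?V \<Gamma> \<in> ?\<Omega>}. ?f \<Gamma>)"
  proof (rule sum.mono_neutral_right[OF finite_conf[OF fin]])
    show "\<forall>\<Gamma>\<in>conf ?V k d - {\<Gamma>\<in>conf ?V k d. active ?V \<Gamma> \<in> ?\<Omega>}. ?f \<Gamma> = 0"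
      using active_vertex_or_edge[OF hyp uni lin k d] by (metis (mono_tags, lifting) DiffD1 DiffD2 mem_Collect_eq mult_eq_0_iff)
  qed auto
  also have "\<dots> = (\<Sum>S\<in>?\<Omega>. \<Sum>\<Gamma>\<in>{\<Gamma>\<in>{\<Gamma>\<in>conf ?V k d. active ?V \<Gamma> \<in> ?\<Omega>}. active ?V \<Gamma> = S}. ?f \<Gamma>)"
    by (rule sum.group[symmetric]) (use finite_conf[OF fin] fin finE in auto)
  also have "\<dots> = (\<Sum>S\<in>?\<Omega>. ?F S)"
    by (intro sum.cong refl) auto
  also have "\<dots> = (\<Sum>S\<in>(\<lambda>v. {v}) ` ?V. ?F S) + (\<Sum>S\<in>hedges H. ?F S)"
    by (rule sum.union_disjoint) (use fin finE disj in auto)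
  also have "(\<Sum>S\<in>(\<lambda>v. {v}) ` ?V. ?F S) = (\<Sum>v\<in>?V. ?F {v})"
    by (subst sum.reindex) auto
  also have "\<dots> = (\<Sum>v\<in>?V. vertex_coeff k d * (\<alpha> * real (degree H v)) ^ d)"
  proof (rule sum.cong[OF refl])
    fix v assume v: "v \<in> ?V"
    have "?F {v} = full_sum {()} k d (\<lambda>l. ?T (map (\<lambda>_. v) l))"
      using sum_conf_active[OF fin, where \<pi> = "\<lambda>_. v" and S = "{()}" and k = k and d = d and T = ?T] v k1 by simp
    also have "\<dots> = full_sum {()} k d (\<lambda>_. \<alpha> * real (degree H v))"
    proof (rule full_sum_cong)
      fix l :: "unit list" assume "length l = k"
      then have "map (\<lambda>_. v) l = replicate k v" by (simp add: map_replicate_const)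
      moreover have "{v} \<notin> hedges H" using disj v by auto
      ultimately show "?T (map (\<lambda>_. v) l) = \<alpha> * real (degree H v)"
        using k by (simp add: A_tensor_def adj_tensor_def deg_tensor_def set_replicate_conv_if)
    qed (use k in simp)
    finally show "?F {v} = vertex_coeff k d * (\<alpha> * real (degree H v)) ^ d"
      by (simp add: full_sum_vertex)
  qed
  also have "(\<Sum>S\<in>hedges H. ?F S) = (\<Sum>e\<in>hedges H. edge_sum \<alpha> k d (\<lambda>i. real (degree H (\<pi> e i))))"
  proof (rule sum.cong[OF refl])
    fix e assume e: "e \<in> hedges H"
    have "?F e = full_sum {..<k} k d (\<lambda>l. ?T (map (\<pi> e) l))"
      using sum_conf_active[OF fin, where \<pi> = "\<pi> e" and S = "{..<k}" and k = k and d = d and T = ?T] \<pi>[OF e] eV[OF e] k1 by (simp add: bij_betw_def)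
    also have "\<dots> = edge_sum \<alpha> k d (\<lambda>i. real (degree H (\<pi> e i)))"
      unfolding edge_sum_def by (rule full_sum_cong) (use A_tensor_edge[OF uni e \<pi>[OF e]] k in auto)
    finally show "?F e = edge_sum \<alpha> k d (\<lambda>i. real (degree H (\<pi> e i)))" .
  qed
  finally show ?thesis
    unfolding Tr_A_def using Tr_conf[OF fin, where d = d and k = k and T = ?T] d k by (simp add: sum_distrib_left)
qed

lemma weight_pos:
  assumes "finite V" and "set ws \<subseteq> V" and "cyc_arcs ws = arcs V \<Gamma>"
  shows "weight V k \<Gamma> > 0"
proof -
  have "walks V (arcs V \<Gamma>) > 0"
    using assms finite_walks[OF assms(1)] by (auto simp: walks_def card_gt_0_iff)
  then show ?thesis using mfact_pos[of "arcs V \<Gamma>"] by (simp add: weight_def prod_pos)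
qed

text \<open>All summands are nonnegative, and the configuration of \<open>d\<close> diagonal entries
  has positive weight because it carries the walk that stays put.\<close>

lemma vertex_coeff_pos:
  assumes "d \<ge> 1"
  shows "vertex_coeff k d > 0"
proof -
  let ?\<Gamma> = "\<lambda>_\<in>{()}. replicate d (replicate (k - 1) ())"
  \<comment> \<open>Over one vertex there is a single possible arc, so multisets of arcs are
    determined by their size.\<close>
  have eq: "M = N" if "size M = size N" for M N :: "(unit \<times> unit) multiset"
  proof -
    have "M = replicate_mset (size M) ((), ())" for M :: "(unit \<times> unit) multiset"
      by (induction M) auto
    then show ?thesis using that by metis
  qed
  have \<Gamma>: "?\<Gamma> \<in> conf {()} k d" by (auto simp: conf_def)
  have "cyc_arcs (replicate (d * (k - 1)) ()) = arcs {()} ?\<Gamma>"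
    by (rule eq) (use size_arcs[OF _ \<Gamma>] in simp)
  then have "weight {()} k ?\<Gamma> > 0" by (intro weight_pos) auto
  moreover have "tprod {()} (\<lambda>_. 1) \<Gamma> = 1" for \<Gamma>
    by (simp add: tprod_def map_replicate_const)
  moreover have "active {()} ?\<Gamma> = {()}" using assms by (auto simp: active_def)
  ultimately show ?thesis
    unfolding vertex_coeff_def full_sum_def
    using \<Gamma> finite_conf[of "{()}" k d] weight_nonneg by (intro sum_pos2[of _ ?\<Gamma>]) auto
qed

section \<open>Convexity of the edge contribution\<close>

definition loops :: "nat \<Rightarrow> (nat \<Rightarrow> nat list list) \<Rightarrow> nat \<Rightarrow> nat" where
  "loops k \<Gamma> i = count_list (\<Gamma> i) (replicate (k - 1) i)"

text \<open>Degrees enter through diagonal entries only, so each configuration gives a monomial in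
  \<open>D\<close> whose exponents count its diagonal entries; \<open>k \<ge> 2\<close> keeps
  diagonal index lists from spanning the edge.\<close>

lemma tprod_edge_tensor:
  assumes "k \<ge> 2"
  shows "tprod {..<k} (edge_tensor \<alpha> k D) \<Gamma> =
    tprod {..<k} (edge_tensor \<alpha> k (\<lambda>_. 1)) \<Gamma> * (\<Prod>i<k. D i ^ loops k \<Gamma> i)"
proof -
  have nr: "set (replicate k i) \<noteq> {..<k}" for i
  proof
    assume "set (replicate k i) = {..<k}"
    then have "card (set (replicate k i)) = card {..<k}" by (rule arg_cong)
    then show False using assms by simp
  qed
  have eq: "(i # \<gamma> = replicate k i) = (\<gamma> = replicate (k - 1) i)" for i :: nat and \<gamma>
    using assms by (cases k) auto
  have entry: "edge_tensor \<alpha> k D (i # \<gamma>) = edge_tensor \<alpha> k (\<lambda>_. 1) (i # \<gamma>) *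
      (if \<gamma> = replicate (k - 1) i then D i else 1)" for i \<gamma>
  proof (cases "i # \<gamma> = replicate k i")
    case True
    have "hd (replicate k i) = i" using assms by simp
    then show ?thesis using nr[of i] eq[of i \<gamma>] True unfolding edge_tensor_def True by simp
  next
    case False
    then show ?thesis using eq[of i \<gamma>] by (simp add: edge_tensor_def)
  qed
  have count: "(\<Prod>\<gamma>\<leftarrow>G. if \<gamma> = c then x else 1) = x ^ count_list G c" for G :: "nat list list" and c x
    by (induction G) auto
  have "(\<Prod>\<gamma>\<leftarrow>G. edge_tensor \<alpha> k D (i # \<gamma>)) =
    (\<Prod>\<gamma>\<leftarrow>G. edge_tensor \<alpha> k (\<lambda>_. 1) (i # \<gamma>)) * D i ^ count_list G (replicate (k - 1) i)" for i G
    unfolding count[symmetric] by (induction G) (auto simp: entry)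
  then show ?thesis by (simp add: tprod_def loops_def prod.distrib)
qed

lemma edge_tensor_nonneg: "0 \<le> \<alpha> \<Longrightarrow> \<alpha> \<le> 1 \<Longrightarrow> edge_tensor \<alpha> k (\<lambda>_. 1) l \<ge> 0"
  by (simp add: edge_tensor_def)

text \<open>If all entries at \<open>i\<close> were diagonal, the walk could not leave
  \<open>i\<close>, although all \<open>k \<ge> 2\<close> vertices are active.\<close>

lemma full_conf_loops:
  assumes k: "k \<ge> 2" and \<Gamma>: "\<Gamma> \<in> conf {..<k} k d" "active {..<k} \<Gamma> = {..<k}"
    and w: "weight {..<k} k \<Gamma> \<noteq> 0" and i: "i < k"
  shows "loops k \<Gamma> i + 1 \<le> length (\<Gamma> i)"
proof -
  have "\<not> set (\<Gamma> i) \<subseteq> {replicate (k - 1) i}"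
  proof
    assume sub: "set (\<Gamma> i) \<subseteq> {replicate (k - 1) i}"
    have "active {..<k} \<Gamma> \<subseteq> {i}"
    proof (rule active_subset_closed[OF _ _ \<Gamma>(1) w, of i])
      fix j \<gamma> assume "j \<in> {i}" "\<gamma> \<in> set (\<Gamma> j)"
      then have "\<gamma> = replicate (k - 1) i" using sub by auto
      then show "set \<gamma> \<subseteq> {i}" by (simp add: set_replicate_conv_if)
    qed (use k i \<Gamma>(2) in auto)
    then have "card {..<k} \<le> card {i}" unfolding \<Gamma>(2) by (intro card_mono) auto
    then show False using k by simp
  qed
  moreover have "count_list G c < length G" if "\<not> set G \<subseteq> {c}" for G and c :: "nat list"
    using that
  proof (induction G)
    case (Cons x G)
    then show ?case using count_le_length[of G c] by (cases "x = c") (auto simp: less_Suc_eq_le)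
  qed simp
  ultimately show ?thesis by (simp add: loops_def Suc_le_eq)
qed

text \<open>Each of the \<open>k\<close> vertices spends at least one entry on a non-diagonal
  choice, so at most \<open>d - k\<close> diagonal entries remain.\<close>

lemma full_conf_loops_sum:
  assumes k: "k \<ge> 2" and \<Gamma>: "\<Gamma> \<in> conf {..<k} k d" "active {..<k} \<Gamma> = {..<k}"
    and w: "weight {..<k} k \<Gamma> \<noteq> 0"
  shows "loops k \<Gamma> 0 + loops k \<Gamma> 1 + k \<le> d"
proof -
  have "loops k \<Gamma> 0 + loops k \<Gamma> 1 = (\<Sum>i\<in>{0, 1}. loops k \<Gamma> i)" by simp
  also have "\<dots> \<le> (\<Sum>i<k. loops k \<Gamma> i)" by (rule sum_mono2) (use k in auto)
  also have "\<dots> + k = (\<Sum>i<k. loops k \<Gamma> i + 1)" by (simp only: sum.distrib) simp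
  also have "\<dots> \<le> (\<Sum>i<k. length (\<Gamma> i))"
    by (rule sum_mono) (use full_conf_loops[OF assms] in auto)
  also have "\<dots> = d" using \<Gamma>(1) by (simp add: conf_def)
  finally show ?thesis by simp
qed

text \<open>Fewer than \<open>k\<close> entries cannot make \<open>k\<close> vertices
  active.\<close>

lemma edge_sum_eq_0:
  assumes "d < k"
  shows "edge_sum \<alpha> k d D = 0"
proof -
  have "{\<Gamma> \<in> conf {..<k} k d. active {..<k} \<Gamma> = {..<k}} = {}"
    using card_active_le[of "{..<k}" _ k d] assms by force
  then show ?thesis by (simp only: edge_sum_def full_sum_def sum.empty)
qed

text \<open>The second difference of \<open>x ^ a * y ^ b\<close> between 1 and 2 in both variables
  factors as \<open>(2 ^ a - 1) * (2 ^ b - 1)\<close>; it is nonnegative and vanishes unless both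
  exponents are positive.\<close>

lemma edge_sum_difference:
  assumes k: "k \<ge> 2"
  shows "edge_sum \<alpha> k d (D(0 := 2, 1 := 2)) - edge_sum \<alpha> k d (D(0 := 2, 1 := 1)) -
      edge_sum \<alpha> k d (D(0 := 1, 1 := 2)) + edge_sum \<alpha> k d (D(0 := 1, 1 := 1)) =
    (\<Sum>\<Gamma>\<in>{\<Gamma>\<in>conf {..<k} k d. active {..<k} \<Gamma> = {..<k}}.
      weight {..<k} k \<Gamma> * tprod {..<k} (edge_tensor \<alpha> k (\<lambda>_. 1)) \<Gamma> *
      ((2 ^ loops k \<Gamma> 0 - 1) * (2 ^ loops k \<Gamma> 1 - 1) * (\<Prod>i\<in>{2..<k}. D i ^ loops k \<Gamma> i)))"
proof -
  let ?C = "{\<Gamma>\<in>conf {..<k} k d. active {..<k} \<Gamma> = {..<k}}"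
  let ?c = "\<lambda>\<Gamma>. weight {..<k} k \<Gamma> * tprod {..<k} (edge_tensor \<alpha> k (\<lambda>_. 1)) \<Gamma>"
  have set: "{..<k} = insert 0 (insert 1 {2..<k})" using k by auto
  have "(\<Prod>i<k. (D(0 := x, 1 := y)) i ^ l i) = x ^ l 0 * (y ^ l 1 * (\<Prod>i\<in>{2..<k}. D i ^ l i))"
    for x y :: real and l :: "nat \<Rightarrow> nat"
    unfolding set by simp
  then have "edge_sum \<alpha> k d (D(0 := x, 1 := y)) =
      (\<Sum>\<Gamma>\<in>?C. ?c \<Gamma> * (x ^ loops k \<Gamma> 0 * (y ^ loops k \<Gamma> 1 * (\<Prod>i\<in>{2..<k}. D i ^ loops k \<Gamma> i))))" for x y
    unfolding edge_sum_def full_sum_def tprod_edge_tensor[OF k, of \<alpha> "D(0 := x, 1 := y)"] by (simp add: mult.assoc)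
  then show ?thesis
    by (simp add: sum_subtractf[symmetric] sum.distrib[symmetric] algebra_simps)
qed

text \<open>Diagonal entries at both 0 and 1 need order at least \<open>k + 2\<close>; below it,
  each term of nonzero weight has a factor 0.\<close>

lemma edge_sum_difference_eq_0:
  assumes k: "k \<ge> 2" and d: "d \<le> k + 1"
  shows "edge_sum \<alpha> k d (D(0 := 2, 1 := 2)) - edge_sum \<alpha> k d (D(0 := 2, 1 := 1)) -
      edge_sum \<alpha> k d (D(0 := 1, 1 := 2)) + edge_sum \<alpha> k d (D(0 := 1, 1 := 1)) = 0"
  unfolding edge_sum_difference[OF k]
proof (rule sum.neutral, rule ballI)
  fix \<Gamma> assume "\<Gamma> \<in> {\<Gamma>\<in>conf {..<k} k d. active {..<k} \<Gamma> = {..<k}}"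
  then consider "weight {..<k} k \<Gamma> = 0" | "loops k \<Gamma> 0 = 0" | "loops k \<Gamma> 1 = 0"
    using full_conf_loops_sum[OF k, of \<Gamma> d] d by fastforce
  then show "weight {..<k} k \<Gamma> * tprod {..<k} (edge_tensor \<alpha> k (\<lambda>_. 1)) \<Gamma> *
      ((2 ^ loops k \<Gamma> 0 - 1) * (2 ^ loops k \<Gamma> 1 - 1) * (\<Prod>i\<in>{2..<k}. D i ^ loops k \<Gamma> i)) = 0"
    by cases simp_all
qed

section \<open>An Eulerian circuit of the complete digraph\<close>

definition path_arcs :: "'v list \<Rightarrow> 'v \<Rightarrow> ('v \<times> 'v) multiset" where
  "path_arcs ws z = mset (zip ws (tl ws @ [z]))"

lemma path_arcs_simps [simp]:
  "path_arcs [] z = {#}"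
  "path_arcs [v] z = {#(v, z)#}"
  "path_arcs (v # w # ws) z = add_mset (v, w) (path_arcs (w # ws) z)"
  by (simp_all add: path_arcs_def)

lemma cyc_arcs_path_arcs: "cyc_arcs (v # ws) = path_arcs (v # ws) v"
  by (simp add: cyc_arcs_def path_arcs_def)

lemma path_arcs_append: "path_arcs (us @ v # ws) z = path_arcs us v + path_arcs (v # ws) z"
proof (induction us)
  case (Cons u us)
  then show ?case by (cases us) auto
qed simp

lemma path_arcs_replicate:
  "path_arcs (replicate r v @ v # ws) z = replicate_mset r (v, v) + path_arcs (v # ws) z"
proof (induction r)
  case (Suc r)
  then show ?case by (cases r) auto
qed simp

text \<open>The word 0, n, 1, n, ..., m - 1, n, alternating between the first \<open>m\<close>
  vertices and \<open>n\<close>.\<close>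

definition zigzag :: "nat \<Rightarrow> nat \<Rightarrow> nat list" where
  "zigzag n m = concat (map (\<lambda>i. [i, n]) [0..<m])"

lemma path_arcs_zigzag:
  "path_arcs (zigzag n (Suc m)) z =
    mset_set ((\<lambda>i. (i, n)) ` {..m}) + mset_set (Pair n ` {1..m}) + {#(n, z)#}"
proof (induction m arbitrary: z)
  case 0
  then show ?case by (simp add: zigzag_def)
next
  case (Suc m)
  have "zigzag n (Suc (Suc m)) = zigzag n (Suc m) @ [Suc m, n]" by (simp add: zigzag_def)
  then have "path_arcs (zigzag n (Suc (Suc m))) z =
      mset_set ((\<lambda>i. (i, n)) ` {..m}) + mset_set (Pair n ` {1..m}) + {#(n, Suc m)#} + {#(Suc m, n), (n, z)#}"
    by (simp add: path_arcs_append Suc)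
  moreover have "mset_set ((\<lambda>i. (i, n)) ` {..Suc m}) = add_mset (Suc m, n) (mset_set ((\<lambda>i. (i, n)) ` {..m}))"
    by (simp add: atMost_Suc) (subst mset_set.insert, auto)
  moreover have "mset_set (Pair n ` {1..Suc m}) = add_mset (n, Suc m) (mset_set (Pair n ` {1..m}))"
    by (simp add: atLeastAtMostSuc_conv) (subst mset_set.insert, auto)
  ultimately show ?case by simp
qed

text \<open>Read cyclically, an Eulerian circuit of the complete loopless digraph on
  \<open>n\<close> vertices. A new vertex is attached by a tour from 0 that passes through it after
  every old vertex and returns to 0 by the closing arc.\<close>

primrec circuit :: "nat \<Rightarrow> nat list" where
  "circuit 0 = []"
| "circuit (Suc n) = circuit n @ zigzag n n"

lemma hd_circuit: "n \<ge> 2 \<Longrightarrow> \<exists>ws. circuit n = 0 # 1 # ws"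
proof (induction n rule: nat_induct_at_least)
  case base
  show ?case by (simp add: numeral_2_eq_2 zigzag_def)
qed auto

text \<open>The old circuit and the new tour both start at 0, so concatenating them adds their
  arcs.\<close>

lemma cyc_arcs_circuit: "cyc_arcs (circuit n) = mset_set ({..<n} \<times> {..<n} - Id)"
proof (induction n)
  case 0
  then show ?case by (simp add: cyc_arcs_def)
next
  case (Suc n)
  let ?E = "\<lambda>n. {..<n} \<times> {..<n} - Id"
  show ?case
  proof (cases n)
    case 0
    have "?E (Suc 0) = {}" by auto
    then show ?thesis unfolding 0 by (simp only:) (simp add: zigzag_def cyc_arcs_def)
  next
    case (Suc m)
    have z: "zigzag n n = 0 # tl (zigzag n n)" using Suc by (simp add: zigzag_def upt_conv_Cons del: upt_Suc)
    have app: "cyc_arcs (ws @ zigzag n n) = cyc_arcs ws + path_arcs (zigzag n n) 0" if "ws = [] \<or> hd ws = 0" for ws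
    proof (cases ws)
      case Nil
      then show ?thesis using z cyc_arcs_path_arcs[of 0 "tl (zigzag n n)"] by (simp add: cyc_arcs_def)
    next
      case (Cons v us)
      then have "v = 0" using that by simp
      then show ?thesis unfolding Cons using z cyc_arcs_path_arcs[of 0 "us @ zigzag n n"] cyc_arcs_path_arcs[of 0 us]
        path_arcs_append[of "0 # us" 0 "tl (zigzag n n)" 0] by simp
    qed
    have "circuit n = [] \<or> hd (circuit n) = 0"
    proof (cases "n \<ge> 2")
      case True
      then show ?thesis using hd_circuit by fastforce
    next
      case False
      then have "n = 1" using Suc by simp
      then show ?thesis by (simp add: zigzag_def)
    qed
    then have "cyc_arcs (circuit (Suc n)) = mset_set (?E n) + path_arcs (zigzag n n) 0"
      using Suc.IH by (simp add: app)
    also have "path_arcs (zigzag n n) 0 = mset_set ((\<lambda>i. (i, n)) ` {..<n}) + (mset_set (Pair n ` {1..m}) + {#(n, 0)#})"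
      using path_arcs_zigzag[of n m 0] Suc by (simp add: lessThan_Suc_atMost)
    also have "mset_set (Pair n ` {1..m}) + {#(n, 0)#} = mset_set (Pair n ` {..<n})"
    proof -
      have "Pair n ` {..<n} = insert (n, 0) (Pair n ` {1..m})" using Suc by force
      then show ?thesis by (simp add: image_iff)
    qed
    also have "mset_set (?E n) + (mset_set ((\<lambda>i. (i, n)) ` {..<n}) + mset_set (Pair n ` {..<n})) = mset_set (?E (Suc n))"
    proof -
      let ?I = "(\<lambda>i. (i, n)) ` {..<n}" and ?O = "Pair n ` {..<n}"
      have "?E (Suc n) = ?E n \<union> (?I \<union> ?O)" by force
      moreover have "mset_set (?I \<union> ?O) = mset_set ?I + mset_set ?O"
        by (rule mset_set_Union) auto
      moreover have "mset_set (?E n \<union> (?I \<union> ?O)) = mset_set (?E n) + mset_set (?I \<union> ?O)"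
        by (rule mset_set_Union) auto
      ultimately show ?thesis by simp
    qed
    finally show ?thesis by (simp add: add.assoc)
  qed
qed

text \<open>Repeating a letter inserts loops at it; the circuit begins with 0 and 1, exactly where
  loops are wanted.\<close>

lemma ex_circuit_with_loops:
  assumes "n \<ge> 2"
  shows "\<exists>ws. cyc_arcs ws = replicate_mset r (0, 0) + replicate_mset r (1, 1) + mset_set ({..<n} \<times> {..<n::nat} - Id)"
proof -
  obtain ws where ws: "circuit n = 0 # 1 # ws" using hd_circuit[OF assms] by blast
  have "cyc_arcs (replicate r 0 @ 0 # replicate r 1 @ 1 # ws) = path_arcs (replicate r 0 @ 0 # replicate r 1 @ 1 # ws) (0::nat)"
    by (cases r) (simp_all add: cyc_arcs_path_arcs)
  also have "\<dots> = replicate_mset r (0, 0) + path_arcs ([0] @ replicate r 1 @ 1 # ws) 0"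
    by (simp add: path_arcs_replicate)
  also have "path_arcs ([0] @ replicate r 1 @ 1 # ws) 0 = add_mset (0, 1) (replicate_mset r (1, 1) + path_arcs (1 # ws) 0)"
    using path_arcs_replicate[of r 1 ws 0] by (cases r) auto
  also have "replicate_mset r (0, 0) + \<dots> = replicate_mset r (0, 0) + replicate_mset r (1, 1) + cyc_arcs (circuit n)"
    by (simp add: ws cyc_arcs_path_arcs)
  finally show ?thesis unfolding cyc_arcs_circuit by blast
qed

text \<open>Every summand is nonnegative, so one configuration suffices: each vertex chooses the
  entry listing all the others, and 0 and 1 choose one diagonal entry in addition. Its arcs form the
  complete digraph with \<open>k - 1\<close> loops at 0 and at 1, which is Eulerian.\<close>

lemma edge_sum_difference_pos:
  assumes k: "k \<ge> 2" and \<alpha>: "0 < \<alpha>" "\<alpha> < 1" and D: "\<And>i. D i > 0"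
  shows "edge_sum \<alpha> k (k + 2) (D(0 := 2, 1 := 2)) - edge_sum \<alpha> k (k + 2) (D(0 := 2, 1 := 1)) -
      edge_sum \<alpha> k (k + 2) (D(0 := 1, 1 := 2)) + edge_sum \<alpha> k (k + 2) (D(0 := 1, 1 := 1)) > 0"
  unfolding edge_sum_difference[OF k]
proof -
  let ?\<gamma> = "\<lambda>i. filter (\<lambda>j. j \<noteq> i) [0..<k]"
  let ?l = "\<lambda>i. if i < 2 then [replicate (k - 1) i] else []"
  define \<Gamma> where "\<Gamma> = (\<lambda>i\<in>{..<k}. ?l i @ [?\<gamma> i])"
  have set01: "{..<k} = insert 0 (insert 1 {2..<k})" using k by auto
  have len: "length (?\<gamma> i) = k - 1" if "i < k" for i
  proof -
    have "length (?\<gamma> i) = card (set (?\<gamma> i))" by (rule distinct_card[symmetric]) simp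
    also have "set (?\<gamma> i) = {..<k} - {i}" by auto
    finally show ?thesis using that by simp
  qed
  have ne: "?\<gamma> i \<noteq> replicate (k - 1) i" for i
  proof
    assume "?\<gamma> i = replicate (k - 1) i"
    then have "set (?\<gamma> i) = set (replicate (k - 1) i)" by (rule arg_cong)
    then show False using k by (auto simp: set_replicate_conv_if)
  qed
  have "(\<Sum>i<k. length (\<Gamma> i)) = k + 2"
  proof -
    have "(\<Sum>i<k. length (\<Gamma> i)) = (\<Sum>i<k. (if i < 2 then 1 else 0) + 1)"
      by (intro sum.cong) (auto simp: \<Gamma>_def)
    also have "\<dots> = k + 2" unfolding sum.distrib by (subst set01) simp
    finally show ?thesis .
  qed
  then have conf: "\<Gamma> \<in> conf {..<k} k (k + 2)"
    using len by (auto simp: conf_def \<Gamma>_def split: if_splits)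
  have act: "active {..<k} \<Gamma> = {..<k}" by (auto simp: active_def \<Gamma>_def)
  have "arcs {..<k} \<Gamma> = (\<Sum>i<k. heads_arcs i (?l i)) + (\<Sum>i<k. mset (map (Pair i) (?\<gamma> i)))"
    by (simp add: arcs_def \<Gamma>_def sum.distrib)
  also have "(\<Sum>i<k. heads_arcs i (?l i)) = replicate_mset (k - 1) (0, 0) + replicate_mset (k - 1) (1, 1)"
    unfolding set01 by simp
  also have "(\<Sum>i<k. mset (map (Pair i) (?\<gamma> i))) = mset_set ({..<k} \<times> {..<k} - Id)"
  proof (rule multiset_eqI, clarify)
    fix a b
    have "count (mset (map (Pair i) (?\<gamma> i))) (a, b) = (if i = a then if b < k \<and> b \<noteq> a then 1 else 0 else 0)" for i
    proof -
      have "distinct (map (Pair i) (?\<gamma> i))" by (simp add: distinct_map inj_on_def)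
      then have "mset (map (Pair i) (?\<gamma> i)) = mset_set (set (map (Pair i) (?\<gamma> i)))" by (simp only: mset_set_set)
      then show ?thesis by (auto simp: count_mset_set')
    qed
    then show "count (\<Sum>i<k. mset (map (Pair i) (?\<gamma> i))) (a, b) = count (mset_set ({..<k} \<times> {..<k} - Id)) (a, b)"
      by (simp add: count_sum count_mset_set')
  qed
  finally have arcs: "arcs {..<k} \<Gamma> = replicate_mset (k - 1) (0, 0) + replicate_mset (k - 1) (1, 1) + mset_set ({..<k} \<times> {..<k} - Id)" .
  obtain ws where ws: "cyc_arcs ws = arcs {..<k} \<Gamma>"
    using ex_circuit_with_loops[OF k, of "k - 1"] arcs by metis
  have "set ws \<subseteq> {..<k}"
  proof
    fix i assume "i \<in> set ws"
    then have "i \<in># image_mset fst (cyc_arcs ws)" by (simp add: image_fst_cyc_arcs)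
    then show "i \<in> {..<k}" by (auto simp: ws in_arcs_iff)
  qed
  then have wpos: "weight {..<k} k \<Gamma> > 0" using ws by (intro weight_pos) auto
  have tpos: "tprod {..<k} (edge_tensor \<alpha> k (\<lambda>_. 1)) \<Gamma> > 0"
    unfolding tprod_def
  proof (rule prod_pos)
    fix i assume i: "i \<in> {..<k}"
    have "set (i # ?\<gamma> i) = {..<k}" "length (i # ?\<gamma> i) = k" using i len[of i] k by auto
    then have "edge_tensor \<alpha> k (\<lambda>_. 1) (i # ?\<gamma> i) > 0"
      using \<alpha> by (simp only: edge_tensor_def) (simp add: add_nonneg_pos)
    moreover have "i # replicate (k - 1) i = replicate k i" using k by (cases k) auto
    then have "edge_tensor \<alpha> k (\<lambda>_. 1) (i # replicate (k - 1) i) > 0"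
      using \<alpha> by (simp add: edge_tensor_def add_pos_nonneg)
    ultimately show "(\<Prod>\<gamma>\<leftarrow>\<Gamma> i. edge_tensor \<alpha> k (\<lambda>_. 1) (i # \<gamma>)) > 0"
      using i by (simp add: \<Gamma>_def)
  qed
  \<comment> \<open>One diagonal entry each, so both factors of the second difference are
    \<open>2 ^ 1 - 1 = 1\<close>.\<close>
  have l01: "loops k \<Gamma> 0 = 1" "loops k \<Gamma> 1 = 1"
    using k ne[of 0] ne[of 1] by (auto simp: loops_def \<Gamma>_def)
  let ?h = "\<lambda>\<Gamma>. weight {..<k} k \<Gamma> * tprod {..<k} (edge_tensor \<alpha> k (\<lambda>_. 1)) \<Gamma> *
      ((2 ^ loops k \<Gamma> 0 - 1) * (2 ^ loops k \<Gamma> 1 - 1) * (\<Prod>i\<in>{2..<k}. D i ^ loops k \<Gamma> i))"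
  show "(\<Sum>\<Gamma>\<in>{\<Gamma>\<in>conf {..<k} k (k + 2). active {..<k} \<Gamma> = {..<k}}. ?h \<Gamma>) > 0"
  proof (rule sum_pos2[of _ \<Gamma>])
    show "?h \<Gamma> > 0" using wpos tpos l01 D by (simp add: prod_pos)
    have "tprod {..<k} (edge_tensor \<alpha> k (\<lambda>_. 1)) \<Gamma> \<ge> 0" for \<Gamma>
      unfolding tprod_def using edge_tensor_nonneg[of \<alpha> k] \<alpha>
      by (intro prod_nonneg ballI prod_list_nonneg) auto
    then show "?h \<Gamma> \<ge> 0" for \<Gamma>
      using weight_nonneg[of "{..<k}" k \<Gamma>] D by (intro mult_nonneg_nonneg prod_nonneg) (auto simp: less_imp_le)
  qed (use conf act finite_conf[of "{..<k}"] in auto)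
qed

text \<open>For degrees 1 and 2 the edge term is symmetric in the vertices, so only the number
  \<open>j\<close> of twos matters; an initial segment serves as representative.\<close>

definition edge_fun :: "real \<Rightarrow> nat \<Rightarrow> nat \<Rightarrow> nat \<Rightarrow> real" where
  "edge_fun \<alpha> k d j = edge_sum \<alpha> k d (\<lambda>i. if i < j then 2 else 1)"

lemma edge_sum_eq_edge_fun:
  assumes k: "k \<ge> 2" and D: "\<And>i. i < k \<Longrightarrow> D i = 1 \<or> D i = 2"
  shows "edge_sum \<alpha> k d D = edge_fun \<alpha> k d (card {i. i < k \<and> D i = 2})"
proof -
  let ?A = "{i. i < k \<and> D i = 2}" and ?B = "{i. i < k \<and> D i \<noteq> 2}"
  let ?j = "card ?A"
  have "?A \<union> ?B = {..<k}" by auto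
  moreover have "card (?A \<union> ?B) = card ?A + card ?B" by (rule card_Un_disjoint) auto
  ultimately have cards: "card ?A + card ?B = k" by simp
  obtain f where f: "bij_betw f {..<?j} ?A"
    using finite_same_card_bij[of "{..<?j}" ?A] by auto
  obtain h where h: "bij_betw h {?j..<k} ?B"
  proof -
    have "finite {?j..<k}" "finite ?B" "card {?j..<k} = card ?B" using cards by simp_all
    from finite_same_card_bij[OF this] show thesis using that by blast
  qed
  \<comment> \<open>\<open>\<sigma>\<close> sorts the vertices, those of degree 2 in front.\<close>
  define \<sigma> where "\<sigma> i = (if i < ?j then f i else h i)" for i
  have "bij_betw \<sigma> {..<?j} ?A" using f by (rule bij_betw_cong[THEN iffD1, rotated]) (auto simp: \<sigma>_def)
  moreover have "bij_betw \<sigma> {?j..<k} ?B" using h by (rule bij_betw_cong[THEN iffD1, rotated]) (auto simp: \<sigma>_def)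
  ultimately have "bij_betw \<sigma> ({..<?j} \<union> {?j..<k}) (?A \<union> ?B)" by (rule bij_betw_combine) auto
  moreover have "{..<?j} \<union> {?j..<k} = {..<k}" using cards by auto
  ultimately have \<sigma>: "bij_betw \<sigma> {..<k} {..<k}" using \<open>?A \<union> ?B = {..<k}\<close> by simp
  have D\<sigma>: "D (\<sigma> i) = (if i < ?j then 2 else 1)" if "i < k" for i
    using bij_betwE[OF f] bij_betwE[OF h] D[of "h i"] that by (cases "i < ?j") (auto simp: \<sigma>_def)
  have "full_sum {..<k} k d (edge_tensor \<alpha> k D) = full_sum {..<k} k d (\<lambda>l. edge_tensor \<alpha> k D (map \<sigma> l))"
    by (rule full_sum_bij[OF _ \<sigma>]) (use k in auto)
  also have "\<dots> = full_sum {..<k} k d (edge_tensor \<alpha> k (\<lambda>i. if i < ?j then 2 else 1))"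
  proof (rule full_sum_cong)
    fix l assume l: "set l \<subseteq> {..<k}" "length l = k"
    then have ne: "l \<noteq> []" using k by auto
    have inj: "inj_on \<sigma> {..<k}" using \<sigma> by (simp add: bij_betw_def)
    have "map \<sigma> l = replicate k (\<sigma> (hd l)) \<longleftrightarrow> l = replicate k (hd l)"
      by (rule map_eq_replicate_hd_iff[OF inj l(1) ne])
    moreover have "\<sigma> ` set l = {..<k} \<longleftrightarrow> set l = {..<k}"
      using inj_on_image_eq_iff[OF inj l(1) subset_refl] \<sigma> by (simp add: bij_betw_def)
    moreover have "D (\<sigma> (hd l)) = (if hd l < ?j then 2 else 1)"
      using D\<sigma> hd_in_set[OF ne] l(1) by blast
    ultimately show "edge_tensor \<alpha> k D (map \<sigma> l) = edge_tensor \<alpha> k (\<lambda>i. if i < ?j then 2 else 1) l"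
      using ne l(2) by (simp add: edge_tensor_def hd_map)
  qed (use k in auto)
  finally show ?thesis by (simp add: edge_sum_def edge_fun_def)
qed

text \<open>By symmetry the two mixed terms of the second difference agree. The values of
  \<open>D\<close> at 0 and 1 are overwritten, so \<open>j\<close> twos remain among the vertices
  from 2 on.\<close>

lemma edge_fun_difference:
  assumes "j + 2 \<le> k"
  defines "D \<equiv> (\<lambda>i. if i < j + 2 then 2 else 1 :: real)"
  shows "edge_fun \<alpha> k d (j + 2) - 2 * edge_fun \<alpha> k d (j + 1) + edge_fun \<alpha> k d j =
    edge_sum \<alpha> k d (D(0 := 2, 1 := 2)) - edge_sum \<alpha> k d (D(0 := 2, 1 := 1)) -
    edge_sum \<alpha> k d (D(0 := 1, 1 := 2)) + edge_sum \<alpha> k d (D(0 := 1, 1 := 1))"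
proof -
  have k: "k \<ge> 2" using assms by simp
  have eq: "edge_sum \<alpha> k d (D(0 := x, 1 := y)) = edge_fun \<alpha> k d (card {i. i < k \<and> (D(0 := x, 1 := y)) i = 2})"
    if "x = 1 \<or> x = 2" "y = 1 \<or> y = 2" for x y
    by (rule edge_sum_eq_edge_fun[OF k]) (use that in \<open>auto simp: D_def\<close>)
  have sets: "{i. i < k \<and> (D(0 := 2, 1 := 2)) i = 2} = {..<j + 2}"
    "{i. i < k \<and> (D(0 := 2, 1 := 1)) i = 2} = insert 0 {2..<j + 2}"
    "{i. i < k \<and> (D(0 := 1, 1 := 2)) i = 2} = insert 1 {2..<j + 2}"
    "{i. i < k \<and> (D(0 := 1, 1 := 1)) i = 2} = {2..<j + 2}"
    using assms(1) by (auto simp: D_def)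
  show ?thesis
    using eq[of 2 2] eq[of 2 1] eq[of 1 2] eq[of 1 1] unfolding sets by simp
qed

lemma edge_fun_affine:
  assumes "j + 2 \<le> k" and "d \<le> k + 1"
  shows "edge_fun \<alpha> k d (j + 2) - 2 * edge_fun \<alpha> k d (j + 1) + edge_fun \<alpha> k d j = 0"
  using assms by (simp only: edge_fun_difference) (rule edge_sum_difference_eq_0, auto)

lemma edge_fun_strictly_convex:
  assumes "j + 2 \<le> k" and "0 < \<alpha>" "\<alpha> < 1"
  shows "edge_fun \<alpha> k (k + 2) (j + 2) - 2 * edge_fun \<alpha> k (k + 2) (j + 1) + edge_fun \<alpha> k (k + 2) j > 0"
  using assms by (simp only: edge_fun_difference) (rule edge_sum_difference_pos, auto)

section \<open>Unicyclic hypergraphs\<close>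

lemma hypergraph_finite_edges: "hypergraph H \<Longrightarrow> finite (hedges H)"
  by (rule finite_subset[of _ "Pow (verts H)"]) (auto simp: hypergraph_def)

lemma hypergraph_finite_verts: "hypergraph H \<Longrightarrow> finite (verts H)"
  by (simp add: hypergraph_def)

lemma hypergraph_edge_subset: "hypergraph H \<Longrightarrow> e \<in> hedges H \<Longrightarrow> e \<subseteq> verts H"
  by (simp add: hypergraph_def)

lemma hypergraph_finite_edge: "hypergraph H \<Longrightarrow> e \<in> hedges H \<Longrightarrow> finite e"
  by (rule finite_subset[OF hypergraph_edge_subset hypergraph_finite_verts])

section \<open>Berge paths and the number of vertices of a unicyclic hypergraph\<close>

definition berge_path :: "'v set set \<Rightarrow> 'v \<Rightarrow> 'v \<Rightarrow> 'v list \<Rightarrow> 'v set list \<Rightarrow> bool" where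
  "berge_path F u v vs es \<longleftrightarrow> es \<noteq> [] \<and> length vs = Suc (length es) \<and> distinct vs \<and> distinct es \<and>
     set es \<subseteq> F \<and> vs ! 0 = u \<and> vs ! length es = v \<and>
     (\<forall>i<length es. vs ! i \<in> es ! i \<and> vs ! Suc i \<in> es ! i)"

lemma berge_path_single: "u \<noteq> v \<Longrightarrow> u \<in> f \<Longrightarrow> v \<in> f \<Longrightarrow> f \<in> F \<Longrightarrow> berge_path F u v [u, v] [f]"
  by (simp add: berge_path_def)

lemma berge_path_mono: "berge_path F u v vs es \<Longrightarrow> F \<subseteq> F' \<Longrightarrow> berge_path F' u v vs es"
  by (auto simp: berge_path_def)

lemma berge_path_vertices:
  assumes "berge_path F u v vs es"
  shows "set vs \<subseteq> \<Union>F"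
proof
  fix x assume "x \<in> set vs"
  then obtain i where i: "i < length vs" "vs ! i = x" by (auto simp: in_set_conv_nth)
  have "\<exists>j<length es. x \<in> es ! j"
  proof (cases i)
    case 0
    then show ?thesis using assms i by (auto simp: berge_path_def)
  next
    case (Suc j)
    then show ?thesis using assms i by (auto simp: berge_path_def)
  qed
  then show "x \<in> \<Union>F" using assms by (force simp: berge_path_def)
qed

lemma berge_path_snoc:
  assumes p: "berge_path F u w vs es" and "f \<notin> F" "w \<in> f" "v \<in> f" "v \<notin> \<Union>F"
  shows "berge_path (insert f F) u v (vs @ [v]) (es @ [f])"
  using assms berge_path_vertices[OF p]
  by (auto simp: berge_path_def nth_append less_Suc_eq)

lemma berge_path_Cons:
  assumes p: "berge_path F w v vs es" and "f \<notin> F" "w \<in> f" "u \<in> f" "u \<notin> \<Union>F"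
  shows "berge_path (insert f F) u v (u # vs) (f # es)"
  using assms berge_path_vertices[OF p]
  by (auto simp: berge_path_def nth_Cons split: nat.splits)

text \<open>The second claim records the two vertices at which the cycle passes through
  \<open>f\<close>; they tell cycles apart when \<open>f\<close> closes several paths.\<close>

lemma berge_path_close:
  assumes p: "berge_path F u v vs es" and f: "f \<notin> F" "u \<in> f" "v \<in> f"
    and H: "hypergraph H" "insert f F \<subseteq> hedges H"
  shows "is_cycle H vs (es @ [f])"
    and "(x, f) \<in> cycle_incidences vs (es @ [f]) \<longleftrightarrow> x = u \<or> x = v"
proof -
  have "set vs \<subseteq> \<Union>F" by (rule berge_path_vertices[OF p])
  also have "\<dots> \<subseteq> verts H" using H by (auto simp: hypergraph_def)
  finally have V: "set vs \<subseteq> verts H" .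
  have es: "es \<noteq> []" using p by (simp add: berge_path_def)
  have m: "Suc i mod Suc (length es) = (if i = length es then 0 else Suc i)" if "i \<le> length es" for i
    using that by auto
  show "is_cycle H vs (es @ [f])"
    using p f H(2) V es by (auto simp: is_cycle_def berge_path_def nth_append less_Suc_eq m Suc_le_eq)
  have ne: "es ! i \<noteq> f" if "i < length es" for i
  proof -
    have "es ! i \<in> F" using p nth_mem[OF that] by (auto simp: berge_path_def)
    then show ?thesis using f(1) by auto
  qed
  let ?n = "length es"
  have at: "i < Suc ?n \<and> (es @ [f]) ! i = f \<longleftrightarrow> i = ?n" for i
    using ne[of i] by (auto simp: nth_append less_Suc_eq)
  have "(x, f) \<in> cycle_incidences vs (es @ [f]) \<longleftrightarrow>
      (\<exists>i. (i < Suc ?n \<and> (es @ [f]) ! i = f) \<and> (x = vs ! i \<or> x = vs ! (Suc i mod Suc ?n)))"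
    by (auto simp: cycle_incidences_def)
  also have "\<dots> \<longleftrightarrow> x = vs ! ?n \<or> x = vs ! 0" unfolding at by simp
  also have "\<dots> \<longleftrightarrow> x = u \<or> x = v" using p by (auto simp: berge_path_def)
  finally show "(x, f) \<in> cycle_incidences vs (es @ [f]) \<longleftrightarrow> x = u \<or> x = v" .
qed

text \<open>Edge sets built by adding one edge at a time, each touching the part already built: the
  induction scheme that connectedness provides.\<close>

inductive grown :: "'v set set \<Rightarrow> 'v set set \<Rightarrow> bool" for E where
  base: "e \<in> E \<Longrightarrow> grown E {e}"
| step: "grown E F \<Longrightarrow> f \<in> E \<Longrightarrow> f \<notin> F \<Longrightarrow> f \<inter> \<Union>F \<noteq> {} \<Longrightarrow> grown E (insert f F)"

lemma grown_subset: "grown E F \<Longrightarrow> F \<subseteq> E \<and> F \<noteq> {} \<and> finite F"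
  by (induction rule: grown.induct) auto

text \<open>If only one of the two vertices lies in the old part and the other is reached by
  \<open>f\<close> alone, a path to a common vertex \<open>w\<close> is prolonged through
  \<open>f\<close>.\<close>

lemma grown_berge_path:
  assumes "grown E F"
  shows "u \<in> \<Union>F \<Longrightarrow> v \<in> \<Union>F \<Longrightarrow> u \<noteq> v \<Longrightarrow> \<exists>vs es. berge_path F u v vs es"
  using assms
proof (induction arbitrary: u v rule: grown.induct)
  case (base e)
  then show ?case using berge_path_single[of u v e "{e}"] by auto
next
  case (step F f)
  obtain w where w: "w \<in> f" "w \<in> \<Union>F" using step.hyps(4) by auto
  have to_w: "\<exists>vs es. berge_path F x w vs es" "\<exists>vs es. berge_path F w x vs es" if "x \<in> \<Union>F" "x \<noteq> w" for x
    using step.IH that w by auto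
  consider "u \<in> f" "v \<in> f" | "u \<in> \<Union>F" "v \<in> \<Union>F" | "u \<in> \<Union>F" "v \<in> f" "v \<notin> \<Union>F" "u \<notin> f"
    | "v \<in> \<Union>F" "u \<in> f" "u \<notin> \<Union>F" "v \<notin> f"
    using step.prems by auto
  then show ?case
  proof cases
    case 1
    then show ?thesis using berge_path_single[of u v f "insert f F"] step.prems by auto
  next
    case 2
    then show ?thesis using step.IH[of u v] step.prems berge_path_mono[of F u v _ _ "insert f F"] by blast
  next
    case 3
    then have "u \<noteq> w" using w by auto
    then show ?thesis using 3 to_w(1)[of u] berge_path_snoc[OF _ step.hyps(3) w(1) 3(2,3)] by blast
  next
    case 4
    then have "v \<noteq> w" using w by auto
    then show ?thesis using 4 to_w(2)[of v] berge_path_Cons[OF _ step.hyps(3) w(1) 4(2,3)] by blast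
  qed
qed

lemma connected_closed:
  assumes "connected_hg H" and "u \<in> verts H" "v \<in> verts H" and "u \<in> B"
    and "\<And>e. e \<in> hedges H \<Longrightarrow> e \<inter> B \<noteq> {} \<Longrightarrow> e \<subseteq> B"
  shows "v \<in> B"
proof -
  have "(u, v) \<in> (adjacency H)\<^sup>*" using assms by (auto simp: connected_hg_def)
  then show ?thesis
    by (induction rule: rtrancl_induct) (use assms(4,5) in \<open>auto simp: adjacency_def\<close>)
qed

text \<open>Connectedness of the line graph, obtained by applying connectedness of the hypergraph to
  the union of \<open>A\<close>.\<close>

lemma connected_edges_closed:
  assumes H: "hypergraph H" "connected_hg H" "{} \<notin> hedges H"
    and A: "A \<subseteq> hedges H" "A \<noteq> {}"
    and closed: "\<And>e f. e \<in> A \<Longrightarrow> f \<in> hedges H \<Longrightarrow> e \<inter> f \<noteq> {} \<Longrightarrow> f \<in> A"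
  shows "A = hedges H"
proof (rule ccontr)
  assume "A \<noteq> hedges H"
  then obtain f where f: "f \<in> hedges H" "f \<notin> A" using A by auto
  obtain e where e: "e \<in> A" using A by auto
  obtain u v where uv: "u \<in> e" "v \<in> f" using e f A H(3) by (metis ex_in_conv subsetD)
  have "v \<in> \<Union>A"
  proof (rule connected_closed[OF H(2)])
    show "u \<in> verts H" "v \<in> verts H"
      using hypergraph_edge_subset[OF H(1)] uv e f A(1) by blast+
    show "u \<in> \<Union>A" using uv e by blast
    fix x assume x: "x \<in> hedges H" "x \<inter> \<Union>A \<noteq> {}"
    then obtain a where "a \<in> A" "a \<inter> x \<noteq> {}" by blast
    then show "x \<subseteq> \<Union>A" using closed[OF _ x(1)] by blast
  qed
  then obtain a where "a \<in> A" "v \<in> a" by blast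
  then show False using closed[OF _ f(1), of a] f uv by blast
qed

text \<open>As long as edges are missing, connectedness provides one that meets the part already
  built.\<close>

lemma grown_hedges:
  assumes H: "hypergraph H" "connected_hg H" "{} \<notin> hedges H" and ne: "hedges H \<noteq> {}"
  shows "grown (hedges H) (hedges H)"
proof -
  let ?E = "hedges H"
  have fin: "finite ?E" by (rule hypergraph_finite_edges[OF H(1)])
  have "\<exists>F. grown ?E F \<and> card F = Suc n" if "Suc n \<le> card ?E" for n
    using that
  proof (induction n)
    case 0
    obtain e where "e \<in> ?E" using ne by auto
    then show ?case using grown.base[of e ?E] by (intro exI[of _ "{e}"]) auto
  next
    case (Suc n)
    then obtain F where F: "grown ?E F" "card F = Suc n" by auto
    have F': "F \<subseteq> ?E" "F \<noteq> {}" "finite F" using grown_subset[OF F(1)] by auto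
    have "\<exists>f\<in>?E - F. f \<inter> \<Union>F \<noteq> {}"
    proof (rule ccontr)
      assume no: "\<not> ?thesis"
      have "F = ?E" by (rule connected_edges_closed[OF H F'(1,2)]) (use no in auto)
      then show False using F Suc.prems by simp
    qed
    then obtain f where "f \<in> ?E" "f \<notin> F" "f \<inter> \<Union>F \<noteq> {}" by auto
    then show ?case using grown.step[OF F(1)] F F' by (intro exI[of _ "insert f F"]) auto
  qed
  moreover have "card ?E \<noteq> 0" using ne fin by simp
  ultimately obtain F where F: "grown ?E F" "card F = card ?E"
    by (metis not0_implies_Suc order_refl)
  then have "F = ?E" using grown_subset[OF F(1)] fin by (simp add: card_subset_eq)
  with F show ?thesis by simp
qed

text \<open>\<open>p\<close> is the cyclic predecessor of \<open>i\<close> and \<open>n\<close> its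
  successor; for a cycle of two edges they coincide, hence the condition in the last
  conjunct.\<close>

lemma cycle_neighbours:
  assumes c: "is_cycle H vs es" and i: "i < length es"
  shows "\<exists>p n. p < length es \<and> n < length es \<and> p \<noteq> i \<and> n \<noteq> i \<and> vs ! i \<in> es ! p \<and> vs ! i \<in> es ! i \<and>
    vs ! n \<in> es ! i \<and> vs ! n \<in> es ! n \<and> vs ! n \<noteq> vs ! i \<and> n = (i + 1) mod length es \<and>
    (length es \<ge> 3 \<longrightarrow> p \<noteq> n)"
proof -
  let ?l = "length es"
  define p where "p = (if i = 0 then ?l - 1 else i - 1)"
  define n where "n = (if Suc i = ?l then 0 else Suc i)"
  have l: "2 \<le> ?l" "length vs = ?l" "distinct vs"
    and in_es: "\<And>i. i < ?l \<Longrightarrow> vs ! i \<in> es ! i \<and> vs ! ((i + 1) mod ?l) \<in> es ! i"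
    using c by (auto simp: is_cycle_def)
  have "n = (i + 1) mod ?l" using i by (simp add: n_def)
  have "(p + 1) mod ?l = i" using i l(1) by (auto simp: p_def)
  have b: "p < ?l" "n < ?l" "p \<noteq> i" "n \<noteq> i" "?l \<ge> 3 \<longrightarrow> p \<noteq> n"
    using i l(1) by (auto simp: p_def n_def)
  moreover have "vs ! n \<noteq> vs ! i" using b(2,4) i l(2,3) by (simp add: nth_eq_iff_index_eq)
  moreover have "vs ! i \<in> es ! p" using in_es[OF b(1)] unfolding \<open>(p + 1) mod ?l = i\<close> by simp
  moreover have "vs ! n \<in> es ! i" using in_es[OF i] unfolding \<open>n = (i + 1) mod ?l\<close> by simp
  moreover have "vs ! i \<in> es ! i" "vs ! n \<in> es ! n" using in_es[OF i] in_es[OF b(2)] by auto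
  ultimately show ?thesis using \<open>n = (i + 1) mod ?l\<close> by blast
qed

definition has_cycle_in :: "'v hypergraph \<Rightarrow> 'v set set \<Rightarrow> bool" where
  "has_cycle_in H F \<longleftrightarrow> (\<exists>vs es. is_cycle H vs es \<and> set es \<subseteq> F)"

text \<open>The deficiency \<open>1 + |F|(k - 1) - |\<Union>F|\<close> counts the independent cycles within \<open>F\<close>.\<close>

lemma grown_card:
  assumes H: "hypergraph H" "uniform k H" and k: "k \<ge> 2"
    and unique: "\<And>C C'. C \<in> cycles H \<Longrightarrow> C' \<in> cycles H \<Longrightarrow> C = C'"
    and "grown (hedges H) F"
  shows "card (\<Union>F) + (if has_cycle_in H F then 1 else 0) = card F * (k - 1) + 1"
  using assms(5)
proof (induction rule: grown.induct)
  case (base e)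
  have "\<not> has_cycle_in H {e}"
  proof
    assume "has_cycle_in H {e}"
    then obtain vs es where c: "is_cycle H vs es" "set es \<subseteq> {e}" by (auto simp: has_cycle_in_def)
    then have "length es = card (set es)" by (simp add: is_cycle_def distinct_card)
    also have "\<dots> \<le> card {e}" by (rule card_mono) (use c in auto)
    finally show False using c by (simp add: is_cycle_def)
  qed
  then show ?case using base H k by (simp add: uniform_def)
next
  case (step F f)
  let ?A = "f \<inter> \<Union>F"
  have F: "F \<subseteq> hedges H" "finite F" using grown_subset[OF step.hyps(1)] by auto
  have fin: "finite f" "finite (\<Union>F)"
    using hypergraph_finite_edge[OF H(1)] step.hyps(2) F by auto
  have cf: "card f = k" using H(2) step.hyps(2) by (simp add: uniform_def)
  have un: "card (\<Union>(insert f F)) + card ?A = card (\<Union>F) + k"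
    using card_Un_Int[of f "\<Union>F"] fin cf by simp
  have new: "\<exists>C\<in>cycles H. \<forall>x. (x, f) \<in> C \<longleftrightarrow> x = u \<or> x = v"
    and newc: "has_cycle_in H (insert f F)"
    if uv: "u \<in> ?A" "v \<in> ?A" "u \<noteq> v" for u v
  proof -
    obtain vs es where p: "berge_path F u v vs es"
      using grown_berge_path[OF step.hyps(1), of u v] uv by auto
    have f: "u \<in> f" "v \<in> f" "insert f F \<subseteq> hedges H" using uv step.hyps(2) F(1) by auto
    note c = berge_path_close[OF p step.hyps(3) f(1,2) H(1) f(3)]
    show "\<exists>C\<in>cycles H. \<forall>x. (x, f) \<in> C \<longleftrightarrow> x = u \<or> x = v"
      using c by (intro bexI[of _ "cycle_incidences vs (es @ [f])"]) (auto simp: cycles_def)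
    show "has_cycle_in H (insert f F)"
      unfolding has_cycle_in_def
      by (rule exI[of _ vs], rule exI[of _ "es @ [f]"]) (use c(1) p in \<open>auto simp: berge_path_def\<close>)
  qed
  \<comment> \<open>A cycle through \<open>f\<close> has two different vertices on \<open>f\<close>
    that are shared with other edges of the cycle, so an intersection of size 1 admits no new
    cycle.\<close>
  have old: "has_cycle_in H F" if c: "has_cycle_in H (insert f F)" and A: "card ?A = 1"
  proof -
    obtain vs es where c: "is_cycle H vs es" "set es \<subseteq> insert f F" using c by (auto simp: has_cycle_in_def)
    have "f \<notin> set es"
    proof
      assume "f \<in> set es"
      then obtain i where i: "i < length es" "es ! i = f" by (auto simp: in_set_conv_nth)
      obtain p n where pn: "p < length es" "n < length es" "p \<noteq> i" "n \<noteq> i"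
        "vs ! i \<in> es ! p" "vs ! i \<in> es ! i" "vs ! n \<in> es ! i" "vs ! n \<in> es ! n" "vs ! n \<noteq> vs ! i"
        using cycle_neighbours[OF c(1) i(1)] by blast
      have "distinct es" using c by (simp add: is_cycle_def)
      then have "es ! n \<noteq> f" "es ! p \<noteq> f" using i pn(1-4) by (auto simp: nth_eq_iff_index_eq)
      then have "es ! n \<in> F" "es ! p \<in> F" using c(2) nth_mem[OF pn(1)] nth_mem[OF pn(2)] by auto
      then have "{vs ! i, vs ! n} \<subseteq> ?A" using pn i by auto
      then have "card {vs ! i, vs ! n} \<le> card ?A" using fin by (intro card_mono) auto
      then show False using A pn(9) by simp
    qed
    then show ?thesis using c by (auto simp: has_cycle_in_def)
  qed
  have mono: "has_cycle_in H (insert f F)" if "has_cycle_in H F"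
    using that by (auto simp: has_cycle_in_def)
  have grow: "card (insert f F) * (k - 1) = card F * (k - 1) + (k - 1)"
    using step.hyps(3) F(2) by simp
  have "card ?A \<noteq> 0" using step.hyps(4) fin by auto
  \<comment> \<open>One shared vertex creates no cycle, two create one, and three would create two
    cycles that pass through \<open>f\<close> at different vertices.\<close>
  then consider "card ?A = 1" | "card ?A = 2" | "card ?A \<ge> 3" by linarith
  then show ?case
  proof cases
    case 1
    then have "has_cycle_in H (insert f F) = has_cycle_in H F" using old mono by auto
    then show ?thesis using step.IH un 1 grow k
      by (cases "has_cycle_in H F"; simp only: if_True if_False; linarith)
  next
    case 2
    then obtain u v where uv: "?A = {u, v}" "u \<noteq> v" by (auto simp: card_2_iff)
    then have uvA: "u \<in> ?A" "v \<in> ?A" by auto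
    obtain C where C: "C \<in> cycles H" "(u, f) \<in> C" using new[OF uvA uv(2)] by auto
    \<comment> \<open>An older cycle would have to coincide with the new one, which uses
      \<open>f\<close>.\<close>
    have "\<not> has_cycle_in H F"
    proof
      assume "has_cycle_in H F"
      then obtain vs es where c: "is_cycle H vs es" "set es \<subseteq> F" by (auto simp: has_cycle_in_def)
      then have "cycle_incidences vs es \<in> cycles H" by (auto simp: cycles_def)
      then have "cycle_incidences vs es = C" by (rule unique[OF _ C(1)])
      then have "f \<in> set es" using C by (auto simp: cycle_incidences_def)
      then show False using c step.hyps(3) by auto
    qed
    then show ?thesis using step.IH un 2 grow k newc[OF uvA uv(2)]
      by simp
  next
    case 3
    then obtain B where B: "B \<subseteq> ?A" "card B = 3" by (meson obtain_subset_with_card_n)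
    then obtain u v w where "B = {u, v, w}" "u \<noteq> v" "v \<noteq> w" "u \<noteq> w"
      by (auto simp: card_3_iff)
    with B have uvw: "u \<in> ?A" "v \<in> ?A" "w \<in> ?A" "u \<noteq> v" "v \<noteq> w" "u \<noteq> w" by auto
    obtain C where "C \<in> cycles H" "\<forall>x. (x, f) \<in> C \<longleftrightarrow> x = u \<or> x = v" using new uvw by metis
    moreover obtain C' where "C' \<in> cycles H" "\<forall>x. (x, f) \<in> C' \<longleftrightarrow> x = v \<or> x = w" using new uvw by metis
    ultimately show ?thesis using unique uvw by blast
  qed
qed

text \<open>The whole edge set can be grown and contains the cycle, so its deficiency is 1. Hence
  all competitors have the same number of vertices.\<close>

lemma unicyclic_verts:
  assumes H: "hypergraph H" "uniform k H" "unicyclic H" and k: "k \<ge> 2"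
  shows "verts H = \<Union>(hedges H)" and "card (verts H) = card (hedges H) * (k - 1)"
proof -
  have con: "connected_hg H" using H by (simp add: unicyclic_def)
  obtain C where C: "cycles H = {C}" using H(3) by (auto simp: unicyclic_def is_singleton_def)
  then obtain vs es where c: "is_cycle H vs es" by (auto simp: cycles_def)
  then have "es \<noteq> []" "set es \<subseteq> hedges H" by (auto simp: is_cycle_def)
  then have ne: "hedges H \<noteq> {}" by auto
  have ne': "{} \<notin> hedges H" using H(2) k by (auto simp: uniform_def)
  show V: "verts H = \<Union>(hedges H)"
  proof (intro equalityI subsetI)
    fix v assume v: "v \<in> verts H"
    obtain e u where e: "e \<in> hedges H" "u \<in> e" using ne ne' by (metis ex_in_conv)
    show "v \<in> \<Union>(hedges H)"
    proof (rule connected_closed[OF con _ v])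
      show "u \<in> verts H" using hypergraph_edge_subset[OF H(1)] e by blast
      show "u \<in> \<Union>(hedges H)" using e by blast
    qed blast
  qed (use H(1) in \<open>auto simp: hypergraph_def\<close>)
  have "has_cycle_in H (hedges H)" using c by (auto simp: has_cycle_in_def is_cycle_def)
  moreover have "card (\<Union>(hedges H)) + (if has_cycle_in H (hedges H) then 1 else 0) = card (hedges H) * (k - 1) + 1"
    by (rule grown_card[OF H(1,2) k _ grown_hedges[OF H(1) con ne' ne]]) (simp add: C)
  ultimately show "card (verts H) = card (hedges H) * (k - 1)" by (simp add: V)
qed

section \<open>Degrees and shared vertices\<close>

lemma sum_degree:
  assumes "hypergraph H" "uniform k H"
  shows "(\<Sum>v\<in>verts H. degree H v) = k * card (hedges H)"
proof -
  have fin: "finite (verts H)" "finite (hedges H)"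
    using hypergraph_finite_edges[OF assms(1)] hypergraph_finite_verts[OF assms(1)] by auto
  have "(\<Sum>v\<in>verts H. degree H v) = (\<Sum>e\<in>hedges H. card {v\<in>verts H. v \<in> e})"
    unfolding degree_def by (rule sum_multicount_gen) (use fin in auto)
  also have "\<dots> = (\<Sum>e\<in>hedges H. k)"
  proof (rule sum.cong[OF refl])
    fix e assume e: "e \<in> hedges H"
    then have "{v\<in>verts H. v \<in> e} = e" using assms(1) by (auto simp: hypergraph_def)
    then show "card {v\<in>verts H. v \<in> e} = k" using e assms(2) by (simp add: uniform_def)
  qed
  finally show ?thesis by simp
qed

lemma degree_pos:
  assumes "hypergraph H" "verts H = \<Union>(hedges H)" "v \<in> verts H"
  shows "degree H v \<ge> 1"
  using assms hypergraph_finite_edges[OF assms(1)] by (auto simp: degree_def Suc_le_eq card_gt_0_iff)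

lemma degree_le_2_D:
  assumes "hypergraph H" "degree H v \<le> 2" "a \<in> hedges H" "b \<in> hedges H" "c \<in> hedges H"
    "v \<in> a" "v \<in> b" "v \<in> c"
  shows "a = b \<or> a = c \<or> b = c"
proof (rule ccontr)
  assume "\<not> ?thesis"
  then have "card {a, b, c} = 3" by auto
  moreover have "card {a, b, c} \<le> degree H v"
    unfolding degree_def using assms hypergraph_finite_edges[OF assms(1)] by (intro card_mono) auto
  ultimately show False using assms(2) by simp
qed

definition joints :: "'v hypergraph \<Rightarrow> 'v set \<Rightarrow> nat" where
  "joints H e = card {v\<in>e. degree H v = 2}"

text \<open>With degrees at most 2, no vertex of \<open>e\<close> lies on two further edges, so the
  nonempty sets \<open>e \<inter> f\<close> partition the vertices of degree 2 on
  \<open>e\<close>.\<close>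

lemma joints_eq_sum:
  assumes H: "hypergraph H" and deg: "\<And>v. v \<in> verts H \<Longrightarrow> degree H v \<le> 2" and e: "e \<in> hedges H"
  shows "joints H e = (\<Sum>f\<in>hedges H - {e}. card (e \<inter> f))"
proof -
  have fin: "finite (hedges H)" by (rule hypergraph_finite_edges[OF H])
  have eV: "e \<subseteq> verts H" and fe: "finite e" using hypergraph_edge_subset[OF H e] hypergraph_finite_edge[OF H e] by auto
  have "degree H v = 2 \<longleftrightarrow> (\<exists>f\<in>hedges H - {e}. v \<in> f)" if "v \<in> e" for v
  proof
    assume "degree H v = 2"
    then obtain a b where "{f\<in>hedges H. v \<in> f} = {a, b}" "a \<noteq> b" by (auto simp: degree_def card_2_iff)
    then show "\<exists>f\<in>hedges H - {e}. v \<in> f" by blast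
  next
    assume "\<exists>f\<in>hedges H - {e}. v \<in> f"
    then obtain f where f: "f \<in> hedges H" "f \<noteq> e" "v \<in> f" by auto
    then have "card {e, f} \<le> degree H v"
      unfolding degree_def using fin e that by (intro card_mono) auto
    then show "degree H v = 2" using f deg[of v] eV that by auto
  qed
  then have "{v\<in>e. degree H v = 2} = (\<Union>f\<in>hedges H - {e}. e \<inter> f)" by auto
  then have "joints H e = card (\<Union>f\<in>hedges H - {e}. e \<inter> f)" by (simp add: joints_def)
  also have "\<dots> = (\<Sum>f\<in>hedges H - {e}. card (e \<inter> f))"
  proof (rule card_UN_disjoint)
    show "\<forall>i\<in>hedges H - {e}. \<forall>j\<in>hedges H - {e}. i \<noteq> j \<longrightarrow> e \<inter> i \<inter> (e \<inter> j) = {}"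
    proof (intro ballI impI, rule ccontr)
      fix a b assume ab: "a \<in> hedges H - {e}" "b \<in> hedges H - {e}" "a \<noteq> b" "e \<inter> a \<inter> (e \<inter> b) \<noteq> {}"
      then obtain v where "v \<in> e" "v \<in> a" "v \<in> b" by auto
      then show False using degree_le_2_D[OF H deg[of v] e, of a b] ab eV by auto
    qed
  qed (use fin fe in auto)
  finally show ?thesis .
qed

text \<open>Linearity makes each intersection contribute 0 or 1.\<close>

lemma joints_eq_card:
  assumes H: "hypergraph H" "linear_hg H" and deg: "\<And>v. v \<in> verts H \<Longrightarrow> degree H v \<le> 2" and e: "e \<in> hedges H"
  shows "joints H e = card {f\<in>hedges H. f \<noteq> e \<and> e \<inter> f \<noteq> {}}"
proof -
  have fe: "finite e" using hypergraph_finite_edge[OF H(1) e] by auto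
  have "joints H e = (\<Sum>f\<in>hedges H - {e}. card (e \<inter> f))"
    by (rule joints_eq_sum[OF H(1) deg e])
  also have "\<dots> = (\<Sum>f\<in>hedges H - {e}. if e \<inter> f \<noteq> {} then 1 else 0)"
  proof (rule sum.cong[OF refl])
    fix f assume "f \<in> hedges H - {e}"
    then have "card (e \<inter> f) \<le> 1" using H(2) e by (auto simp: linear_hg_def)
    moreover have "card (e \<inter> f) = 0 \<longleftrightarrow> e \<inter> f = {}" using fe by simp
    ultimately show "card (e \<inter> f) = (if e \<inter> f \<noteq> {} then 1 else 0)" by (auto simp del: card_0_eq)
  qed
  also have "\<dots> = card {f\<in>hedges H. f \<noteq> e \<and> e \<inter> f \<noteq> {}}"
    using hypergraph_finite_edges[OF H(1)] by (simp add: sum.If_cases) (rule arg_cong[of _ _ card], auto)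
  finally show ?thesis .
qed

text \<open>The degrees are 1 or 2, and their sum exceeds the number of vertices by the number of
  edges. So there are as many vertices of degree 2 as edges, each counted on two edges.\<close>

lemma sum_joints:
  assumes H: "hypergraph H" "uniform k H" "verts H = \<Union>(hedges H)"
    and card: "card (verts H) = card (hedges H) * (k - 1)" and k: "k \<ge> 1"
    and deg: "\<And>v. v \<in> verts H \<Longrightarrow> degree H v \<le> 2"
  shows "(\<Sum>e\<in>hedges H. joints H e) = 2 * card (hedges H)"
proof -
  let ?B = "{v\<in>verts H. degree H v = 2}"
  have fin: "finite (verts H)" "finite (hedges H)"
    using hypergraph_finite_edges[OF H(1)] hypergraph_finite_verts[OF H(1)] by auto
  have "(\<Sum>v\<in>verts H. degree H v) = (\<Sum>v\<in>verts H. 1 + (if degree H v = 2 then 1 else 0))"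
  proof (rule sum.cong[OF refl])
    fix v assume "v \<in> verts H"
    then show "degree H v = 1 + (if degree H v = 2 then 1 else 0)"
      using degree_pos[OF H(1,3), of v] deg[of v] by simp
  qed
  also have "\<dots> = card (verts H) + card ?B"
    unfolding sum.distrib using fin by (simp add: sum.If_cases Int_def)
  finally have "k * card (hedges H) = card (hedges H) * (k - 1) + card ?B"
    using sum_degree[OF H(1,2)] card by simp
  then have B: "card ?B = card (hedges H)" using k by (cases k) (auto simp: algebra_simps)
  have "(\<Sum>e\<in>hedges H. joints H e) = (\<Sum>e\<in>hedges H. card {v\<in>?B. v \<in> e})"
    unfolding joints_def using H(1) by (intro sum.cong refl arg_cong[of _ _ card]) (auto simp: hypergraph_def)
  also have "\<dots> = (\<Sum>v\<in>?B. card {e\<in>hedges H. v \<in> e})"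
    by (rule sum_multicount_gen) (use fin in auto)
  also have "\<dots> = (\<Sum>v\<in>?B. 2)" by (intro sum.cong refl) (auto simp: degree_def)
  finally show ?thesis using B by simp
qed

section \<open>Recovering a hypergraph from its edge intersections\<close>

context
  fixes H :: "'v hypergraph" and e :: "'i \<Rightarrow> 'v set" and I k
  assumes H: "hypergraph H" "uniform k H" "verts H = \<Union>(hedges H)"
    and deg: "\<And>v. v \<in> verts H \<Longrightarrow> degree H v \<le> 2"
    and e: "inj_on e I" "hedges H = e ` I"
begin

abbreviation incident :: "'v \<Rightarrow> 'i set" where
  "incident v \<equiv> {i\<in>I. v \<in> e i}"

lemma card_incident: "card (incident v) = degree H v"
proof -
  have "{f\<in>hedges H. v \<in> f} = e ` incident v" using e by auto
  moreover have "inj_on e (incident v)" by (rule inj_on_subset[OF e(1)]) auto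
  ultimately show ?thesis by (simp add: degree_def card_image)
qed

lemma joints_index:
  assumes "i \<in> I"
  shows "joints H (e i) = (\<Sum>j\<in>I - {i}. card (e i \<inter> e j))"
proof -
  have "hedges H - {e i} = e ` (I - {i})" using e assms by (auto simp: inj_on_def)
  moreover have "inj_on e (I - {i})" by (rule inj_on_subset[OF e(1)]) auto
  ultimately show ?thesis using joints_eq_sum[OF H(1) deg] e assms by (simp add: sum.reindex)
qed

lemma incident_empty: "{v\<in>verts H. incident v = {}} = {}"
  using H(3) e by auto

lemma incident_single:
  assumes "i \<in> I"
  shows "card {v\<in>verts H. incident v = {i}} + (\<Sum>j\<in>I - {i}. card (e i \<inter> e j)) = k"
proof -
  have ei: "e i \<in> hedges H" using e assms by simp
  have eV: "e i \<subseteq> verts H" and fe: "finite (e i)" using hypergraph_edge_subset[OF H(1) ei] hypergraph_finite_edge[OF H(1) ei] by auto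
  have "incident v = {i} \<longleftrightarrow> degree H v \<noteq> 2" if "v \<in> e i" for v
  proof
    assume "incident v = {i}"
    then show "degree H v \<noteq> 2" using card_incident[of v] by simp
  next
    assume "degree H v \<noteq> 2"
    then have "card (incident v) = 1"
      using card_incident[of v] deg[of v] degree_pos[OF H(1,3), of v] eV that by auto
    then obtain x where "incident v = {x}" by (auto simp: card_1_singleton_iff)
    moreover have "i \<in> incident v" using assms that by simp
    ultimately show "incident v = {i}" by simp
  qed
  moreover have "v \<in> e i" if "incident v = {i}" for v using that by auto
  ultimately have "{v\<in>verts H. incident v = {i}} = e i - {v\<in>e i. degree H v = 2}" using eV by blast
  moreover have "card (e i - {v\<in>e i. degree H v = 2}) + card {v\<in>e i. degree H v = 2} = card (e i)"
    using fe card_mono[of "e i" "{v\<in>e i. degree H v = 2}"] by (subst card_Diff_subset) auto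
  ultimately show ?thesis
    using H(2) ei joints_index[OF assms] by (simp add: joints_def uniform_def)
qed

lemma incident_pair:
  assumes "i \<in> I" "j \<in> I" "i \<noteq> j"
  shows "{v\<in>verts H. incident v = {i, j}} = e i \<inter> e j"
proof (intro equalityI subsetI)
  fix v assume v: "v \<in> e i \<inter> e j"
  then have V: "v \<in> verts H" using H(3) e assms by auto
  have "finite (e ` I)" using hypergraph_finite_edges[OF H(1)] e(2) by simp
  then have "finite I" using e(1) by (rule finite_imageD)
  then have fin: "finite (incident v)" by simp
  have "{i, j} \<subseteq> incident v" using v assms by auto
  moreover have "card (incident v) \<le> card {i, j}" using card_incident[of v] deg[OF V] assms by simp
  ultimately have "{i, j} = incident v" using fin by (simp add: card_seteq)
  then show "v \<in> {v\<in>verts H. incident v = {i, j}}" using V by simp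
qed auto

lemma incident_large: "card A \<ge> 3 \<Longrightarrow> {v\<in>verts H. incident v = A} = {}"
  using card_incident deg by fastforce

end

text \<open>Vertices are classified by the set of edges containing them. Nonempty classes are
  private to one edge or the intersection of two, so uniformity and the intersection sizes fix all
  class sizes, and any bijection respecting the classes is an isomorphism.\<close>

lemma isomorphic_if_intersections:
  assumes H: "hypergraph H" "uniform k H" "verts H = \<Union>(hedges H)" "\<And>v. v \<in> verts H \<Longrightarrow> degree H v \<le> 2"
    and H': "hypergraph H'" "uniform k H'" "verts H' = \<Union>(hedges H')" "\<And>v. v \<in> verts H' \<Longrightarrow> degree H' v \<le> 2"
    and e: "inj_on e I" "hedges H = e ` I" and e': "inj_on e' I" "hedges H' = e' ` I"
    and int: "\<And>i j. i \<in> I \<Longrightarrow> j \<in> I \<Longrightarrow> i \<noteq> j \<Longrightarrow> card (e i \<inter> e j) = card (e' i \<inter> e' j)"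
  shows "isomorphic H H'"
proof -
  define \<tau> where "\<tau> v = {i\<in>I. v \<in> e i}" for v
  define \<tau>' where "\<tau>' v = {i\<in>I. v \<in> e' i}" for v
  have "finite (e ` I)" using hypergraph_finite_edges[OF H(1)] e(2) by simp
  then have finI: "finite I" using e(1) by (rule finite_imageD)
  have fin: "finite (verts H)" "finite (verts H')" using H(1) H'(1) by (auto simp: hypergraph_def)
  have cards: "card {v\<in>verts H. \<tau> v = A} = card {v\<in>verts H'. \<tau>' v = A}" if A: "A \<subseteq> I" for A
  proof -
    have "finite A" using A finI by (rule finite_subset)
    consider "A = {}" | i where "A = {i}" | i j where "A = {i, j}" "i \<noteq> j" | "card A \<ge> 3"
    proof -
      have "card A = 0 \<or> card A = 1 \<or> card A = 2 \<or> card A \<ge> 3" by linarith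
      then show thesis
        using that \<open>finite A\<close> by (auto simp: card_1_singleton_iff card_2_iff)
    qed
    then show ?thesis
    proof cases
      case 1
      show ?thesis
        unfolding \<tau>_def \<tau>'_def 1
        by (simp only: incident_empty[OF H e] incident_empty[OF H' e'] card.empty)
    next
      case 2
      then have i: "i \<in> I" using A by auto
      have "(\<Sum>j\<in>I - {i}. card (e i \<inter> e j)) = (\<Sum>j\<in>I - {i}. card (e' i \<inter> e' j))"
        by (rule sum.cong) (use int i in auto)
      then show ?thesis
        unfolding \<tau>_def \<tau>'_def 2 using incident_single[OF H e i] incident_single[OF H' e' i] by linarith
    next
      case 3
      then have ij: "i \<in> I" "j \<in> I" using A by auto
      show ?thesis
        unfolding \<tau>_def \<tau>'_def 3(1)
        by (simp only: incident_pair[OF H e ij 3(2)] incident_pair[OF H' e' ij 3(2)] int[OF ij 3(2)])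
    next
      case 4
      show ?thesis
        unfolding \<tau>_def \<tau>'_def
        by (simp only: incident_large[OF H e 4] incident_large[OF H' e' 4]) simp
    qed
  qed
  have "\<forall>A. \<exists>h. A \<subseteq> I \<longrightarrow> bij_betw h {v\<in>verts H. \<tau> v = A} {v\<in>verts H'. \<tau>' v = A}"
    using finite_same_card_bij[OF _ _ cards] fin by simp
  then obtain h where h: "\<And>A. A \<subseteq> I \<Longrightarrow> bij_betw (h A) {v\<in>verts H. \<tau> v = A} {v\<in>verts H'. \<tau>' v = A}"
    by metis
  define f where "f v = h (\<tau> v) v" for v
  have sub: "\<tau> v \<subseteq> I" "\<tau>' w \<subseteq> I" for v w by (auto simp: \<tau>_def \<tau>'_def)
  have f: "f v \<in> verts H'" "\<tau>' (f v) = \<tau> v" if "v \<in> verts H" for v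
    using bij_betwE[OF h[OF sub(1)[of v]]] that by (auto simp: f_def)
  have inj: "inj_on f (verts H)"
  proof (rule inj_onI)
    fix u v assume uv: "u \<in> verts H" "v \<in> verts H" "f u = f v"
    then have "\<tau> u = \<tau> v" using f by metis
    then show "u = v"
      using uv bij_betw_imp_inj_on[OF h[OF sub(1)[of v]]] by (auto simp: f_def inj_on_def)
  qed
  have surj: "\<exists>v\<in>verts H. f v = w \<and> \<tau> v = \<tau>' w" if "w \<in> verts H'" for w
  proof -
    have "w \<in> h (\<tau>' w) ` {v\<in>verts H. \<tau> v = \<tau>' w}"
      using bij_betw_imp_surj_on[OF h[OF sub(2)[of w]]] that by simp
    then obtain v where "v \<in> verts H" "\<tau> v = \<tau>' w" "w = h (\<tau>' w) v" by blast
    then have "f v = w" by (simp add: f_def)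
    with \<open>v \<in> verts H\<close> \<open>\<tau> v = \<tau>' w\<close> show ?thesis by blast
  qed
  have "f ` e i = e' i" if i: "i \<in> I" for i
  proof (intro equalityI subsetI)
    fix w assume "w \<in> f ` e i"
    then obtain v where v: "v \<in> e i" "w = f v" by auto
    then have "v \<in> verts H" "i \<in> \<tau> v" using i H(3) e by (auto simp: \<tau>_def)
    then have "i \<in> \<tau>' w" using f v by simp
    then show "w \<in> e' i" by (simp add: \<tau>'_def)
  next
    fix w assume w: "w \<in> e' i"
    then have "w \<in> verts H'" "i \<in> \<tau>' w" using i H'(3) e' by (auto simp: \<tau>'_def)
    then obtain v where "v \<in> verts H" "f v = w" "i \<in> \<tau> v" using surj by metis
    then show "w \<in> f ` e i" by (auto simp: \<tau>_def)
  qed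
  then have "hedges H' = (\<lambda>x. f ` x) ` hedges H" using e e' by (simp add: image_image)
  moreover have "bij_betw f (verts H) (verts H')"
    unfolding bij_betw_def using inj surj f by blast
  ultimately show ?thesis by (auto simp: isomorphic_def)
qed

section \<open>Cycles with a pendent path\<close>

text \<open>The path 0, 1, 2, ... with an additional link between 0 and \<open>g - 1\<close>; for
  \<open>g = m\<close> it is a cycle on the indices below \<open>m\<close>.\<close>

definition link :: "nat \<Rightarrow> nat \<Rightarrow> nat \<Rightarrow> bool" where
  "link g i j \<longleftrightarrow> j = i + 1 \<or> i = j + 1 \<or> (i = 0 \<and> j = g - 1) \<or> (j = 0 \<and> i = g - 1)"

text \<open>The edges \<open>e 0, \<dots>, e (g - 1)\<close> form the cycle and \<open>e g, \<dots>, e (m - 1)\<close> a path hanging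
  off the edge \<open>e (g - 1)\<close>.\<close>

definition lollipop :: "nat \<Rightarrow> nat \<Rightarrow> nat \<Rightarrow> 'v hypergraph \<Rightarrow> (nat \<Rightarrow> 'v set) \<Rightarrow> bool" where
  "lollipop k m g H e \<longleftrightarrow> 2 \<le> k \<and> 3 \<le> g \<and> g \<le> m \<and> hypergraph H \<and> uniform k H \<and>
     verts H = \<Union>(hedges H) \<and> (\<forall>v\<in>verts H. degree H v \<le> 2) \<and>
     inj_on e {..<m} \<and> hedges H = e ` {..<m} \<and>
     (\<forall>i<m. \<forall>j<m. i \<noteq> j \<longrightarrow> card (e i \<inter> e j) = (if link g i j then 1 else 0))"

lemma lollipop_isomorphic:
  assumes "lollipop k m g H e" and "lollipop k m g H' e'"
  shows "isomorphic H H'"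
  using assms unfolding lollipop_def
  by (intro isomorphic_if_intersections[of H k H' e "{..<m}" e']) auto

lemma linear_common_vertex:
  assumes "hypergraph H" "linear_hg H" "x \<in> hedges H" "y \<in> hedges H" "x \<noteq> y"
    and "u \<in> x" "u \<in> y" "u' \<in> x" "u' \<in> y"
  shows "u = u'"
proof (rule ccontr)
  assume "u \<noteq> u'"
  have "card {u, u'} \<le> card (x \<inter> y)"
    using assms hypergraph_finite_edge[OF assms(1,3)] by (intro card_mono) auto
  moreover have "card (x \<inter> y) \<le> 1" using assms unfolding linear_hg_def by blast
  ultimately show False using \<open>u \<noteq> u'\<close> by simp
qed

context
  fixes k m g :: nat and H :: "'v hypergraph" and e
  assumes L: "lollipop k m g H e"
begin

lemma lollipop_D:
  shows "2 \<le> k" "3 \<le> g" "g \<le> m" "hypergraph H" "uniform k H" "verts H = \<Union>(hedges H)"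
    "inj_on e {..<m}" "hedges H = e ` {..<m}"
    "\<And>v. v \<in> verts H \<Longrightarrow> degree H v \<le> 2"
    "\<And>i j. i < m \<Longrightarrow> j < m \<Longrightarrow> i \<noteq> j \<Longrightarrow> card (e i \<inter> e j) = (if link g i j then 1 else 0)"
  using L by (auto simp: lollipop_def)

lemma lollipop_edge: "i < m \<Longrightarrow> e i \<in> hedges H"
  using lollipop_D(8) by auto

lemma lollipop_eq_iff: "i < m \<Longrightarrow> j < m \<Longrightarrow> e i = e j \<longleftrightarrow> i = j"
  using lollipop_D(7) by (auto simp: inj_on_def)

lemma lollipop_meet:
  assumes "i < m" "j < m" "i \<noteq> j"
  shows "e i \<inter> e j \<noteq> {} \<longleftrightarrow> link g i j"
  using lollipop_D(10)[OF assms] hypergraph_finite_edge[OF lollipop_D(4) lollipop_edge[OF assms(1)]]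
  by (auto split: if_splits)

lemma lollipop_three:
  assumes "a < m" "b < m" "c < m" "v \<in> e a" "v \<in> e b" "v \<in> e c"
  shows "a = b \<or> a = c \<or> b = c"
proof -
  have "v \<in> verts H" using assms lollipop_D(6) lollipop_edge by blast
  then have "e a = e b \<or> e a = e c \<or> e b = e c"
    using assms lollipop_edge by (intro degree_le_2_D[OF lollipop_D(4) lollipop_D(9)]) auto
  then show ?thesis using assms by (simp add: lollipop_eq_iff)
qed

lemma lollipop_linear: "linear_hg H"
  unfolding linear_hg_def lollipop_D(8)
proof (intro ballI impI)
  fix x y assume "x \<in> e ` {..<m}" "y \<in> e ` {..<m}" "x \<noteq> y"
  then obtain i j where "i < m" "j < m" "x = e i" "y = e j" "i \<noteq> j" by auto
  then show "card (x \<inter> y) \<le> 1" using lollipop_D(10)[of i j] by simp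
qed

lemma lollipop_joints:
  assumes "i < m"
  shows "joints H (e i) = card {j. j < m \<and> j \<noteq> i \<and> link g i j}"
proof -
  have "joints H (e i) = (\<Sum>j\<in>{..<m} - {i}. card (e i \<inter> e j))"
    using assms by (intro joints_index[OF lollipop_D(4-6) lollipop_D(9) lollipop_D(7,8)]) auto
  also have "\<dots> = (\<Sum>j\<in>{..<m} - {i}. if link g i j then 1 else 0)"
    using assms lollipop_D(10) by (intro sum.cong) auto
  also have "\<dots> = card {j. j < m \<and> j \<noteq> i \<and> link g i j}"
    by (simp add: sum.If_cases) (rule arg_cong[of _ _ card], auto)
  finally show ?thesis .
qed

text \<open>Index 0 is linked to 1 and \<open>g - 1\<close>, any other inner index to its two
  neighbours and possibly to 0.\<close>

lemma lollipop_joints_inner: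
  assumes "i < m - 1"
  shows "joints H (e i) = 2 \<or> joints H (e i) = 3"
proof -
  let ?N = "{j. j < m \<and> j \<noteq> i \<and> link g i j}"
  note gm = lollipop_D(2,3)
  have "2 \<le> card ?N \<and> card ?N \<le> 3"
  proof (cases "i = 0")
    case True
    then have "?N = {1, g - 1}" using gm by (auto simp: link_def)
    then show ?thesis using gm by auto
  next
    case False
    have "{i - 1, i + 1} \<subseteq> ?N" using False assms by (auto simp: link_def)
    then have "card {i - 1, i + 1} \<le> card ?N" by (intro card_mono) auto
    moreover have "?N \<subseteq> {i - 1, i + 1, 0}" using False by (auto simp: link_def)
    then have "card ?N \<le> card {i - 1, i + 1, 0}" by (intro card_mono) auto
    ultimately show ?thesis using False by (auto simp: card_insert_if split: if_splits)
  qed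
  then show ?thesis using lollipop_joints[of i] assms by auto
qed

text \<open>The last index is linked to \<open>m - 2\<close>, and also to 0 when
  \<open>g = m\<close>, in which case there is no leaf.\<close>

lemma lollipop_joints_last: "joints H (e (m - 1)) = 1 \<or> joints H (e (m - 1)) = 2"
proof -
  let ?N = "{j. j < m \<and> j \<noteq> m - 1 \<and> link g (m - 1) j}"
  note gm = lollipop_D(2,3)
  have "{m - 2} \<subseteq> ?N" using gm by (auto simp: link_def)
  then have "card {m - 2} \<le> card ?N" by (intro card_mono) auto
  moreover have "?N \<subseteq> {m - 2, 0}" using gm by (auto simp: link_def)
  then have "card ?N \<le> card {m - 2, 0}" by (intro card_mono) auto
  ultimately have "1 \<le> card ?N \<and> card ?N \<le> 2" using gm by (auto simp: card_insert_if split: if_splits)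
  then show ?thesis using lollipop_joints[of "m - 1"] gm by auto
qed

lemma lollipop_connected: "connected_hg H"
proof -
  note gm = lollipop_D(2,3)
  have "card (e 0) = k" using lollipop_D(5) lollipop_edge[of 0] gm by (auto simp: uniform_def)
  then obtain r where r: "r \<in> e 0" using lollipop_D(1) by fastforce
  have adj: "(u, v) \<in> adjacency H" if "i < m" "u \<in> e i" "v \<in> e i" for i u v
    using lollipop_edge[OF that(1)] that by (auto simp: adjacency_def)
  have reach: "i < m \<Longrightarrow> v \<in> e i \<Longrightarrow> (r, v) \<in> (adjacency H)\<^sup>*" for i v
  proof (induction i arbitrary: v)
    case 0
    then show ?case using adj[of 0 r v] r by auto
  next
    case (Suc i)
    have "e i \<inter> e (Suc i) \<noteq> {}" using lollipop_meet[of i "Suc i"] Suc.prems by (auto simp: link_def)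
    then obtain w where w: "w \<in> e i" "w \<in> e (Suc i)" by auto
    then show ?case using Suc.IH[of w] Suc.prems adj[of "Suc i" w v] by (meson Suc_lessD rtrancl.rtrancl_into_rtrancl)
  qed
  have "sym ((adjacency H)\<^sup>*)" by (rule sym_rtrancl) (auto simp: sym_def adjacency_def)
  moreover have "(r, v) \<in> (adjacency H)\<^sup>*" if "v \<in> verts H" for v
    using that reach lollipop_D(6,8) by auto
  ultimately show ?thesis unfolding connected_hg_def by (meson symD rtrancl_trans)
qed

text \<open>The cycle passes through the common vertices \<open>w i\<close> of cyclically
  consecutive edges; they are distinct because no vertex lies on three edges.\<close>

lemma lollipop_ex_cycle: "\<exists>vs. is_cycle H vs (map e [0..<g])"
proof -
  note gm = lollipop_D(2,3)
  define pred where "pred i = (if i = 0 then g - 1 else i - 1)" for i :: nat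
  have pred: "pred i < g" "pred i \<noteq> i" "link g (pred i) i" "pred ((i + 1) mod g) = i" if "i < g" for i
    using that gm by (auto simp: pred_def link_def mod_Suc)
  have "\<exists>v. v \<in> e (pred i) \<inter> e i" if "i < g" for i
    using lollipop_meet[of "pred i" i] pred[OF that] that gm by auto
  then obtain w where w: "\<And>i. i < g \<Longrightarrow> w i \<in> e (pred i) \<inter> e i" by metis
  have neq: "w i \<noteq> w j" if ij: "i < j" "j < g" for i j
  proof
    assume eq: "w i = w j"
    have "w j \<in> e i" "w j \<in> e (pred i)" "w j \<in> e j" "w j \<in> e (pred j)"
      using w[of i] w[of j] ij eq by auto
    then have "i = j \<or> i = pred j \<or> j = pred j" "pred i = i \<or> pred i = j \<or> i = j"
      using lollipop_three[of i j "pred j"] lollipop_three[of "pred i" i j] ij gm pred[of i] pred[of j] by auto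
    then show False using ij gm by (auto simp: pred_def split: if_splits)
  qed
  have "inj_on w {..<g}" using neq by (intro linorder_inj_onI) auto
  moreover have "inj_on e {..<g}" using lollipop_D(7) gm by (auto intro: inj_on_subset)
  moreover have "w i \<in> verts H" if "i < g" for i
    using w[OF that] lollipop_edge[of i] that gm lollipop_D(6) by auto
  moreover have "w ((i + 1) mod g) \<in> e i" if "i < g" for i
  proof -
    have "(i + 1) mod g < g" using gm by simp
    from w[OF this] show ?thesis unfolding pred(4)[OF that] by simp
  qed
  ultimately have "is_cycle H (map w [0..<g]) (map e [0..<g])"
    unfolding is_cycle_def using gm w lollipop_edge
    by (auto simp: distinct_map atLeast0LessThan)
  then show ?thesis by blast
qed

text \<open>Every index used by a cycle is linked to two other used indices, which rules out the
  tail. As two edges share at most one vertex, the incidences do not depend on the walk, so the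
  cycle is unique.\<close>

lemma lollipop_cycle_edges:
  assumes c: "is_cycle H vs es"
  shows "set es = e ` {..<g}" and "length es = g"
    and "cycle_incidences vs es = {(v, x). x \<in> e ` {..<g} \<and> v \<in> x \<and> (\<exists>y\<in>e ` {..<g}. y \<noteq> x \<and> v \<in> y)}"
proof -
  note gm = lollipop_D(2,3)
  let ?l = "length es"
  have dist: "distinct es" "distinct vs" and l2: "2 \<le> ?l" and sub: "set es \<subseteq> hedges H"
    and in_es: "\<And>i. i < ?l \<Longrightarrow> vs ! i \<in> es ! i \<and> vs ! ((i + 1) mod ?l) \<in> es ! i"
    using c by (auto simp: is_cycle_def)
  define ix where "ix p = (THE i. i < m \<and> es ! p = e i)" for p
  have ix: "ix p < m" "es ! p = e (ix p)" if "p < ?l" for p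
  proof -
    have "es ! p \<in> e ` {..<m}" using that sub nth_mem[of p es] lollipop_D(8) by auto
    then have "\<exists>!i. i < m \<and> es ! p = e i" using lollipop_eq_iff by auto
    from theI'[OF this] show "ix p < m" "es ! p = e (ix p)" by (auto simp: ix_def)
  qed
  have ix_eq: "ix p = ix q \<longleftrightarrow> p = q" if "p < ?l" "q < ?l" for p q
    using ix[OF that(1)] ix[OF that(2)] dist(1) that by (metis nth_eq_iff_index_eq)
  \<comment> \<open>Two edges of a linear hypergraph cannot form a cycle.\<close>
  have l3: "3 \<le> ?l"
  proof (rule ccontr)
    assume "\<not> 3 \<le> ?l"
    then have "?l = 2" using l2 by simp
    moreover from this have "es ! 0 \<noteq> es ! 1" using dist(1) by (simp add: nth_eq_iff_index_eq)
    moreover have "es ! 0 \<in> hedges H" "es ! 1 \<in> hedges H"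
      using \<open>?l = 2\<close> sub nth_mem[of 0 es] nth_mem[of 1 es] by auto
    ultimately have "vs ! 0 = vs ! 1"
      using in_es[of 0] in_es[of 1]
      by (intro linear_common_vertex[OF lollipop_D(4) lollipop_linear, of "es ! 0" "es ! 1"]) auto
    then show False using dist(2) c \<open>?l = 2\<close> by (simp add: nth_eq_iff_index_eq is_cycle_def)
  qed
  let ?I = "ix ` {..<?l}"
  have two: "\<exists>a b. a \<in> ?I \<and> b \<in> ?I \<and> a \<noteq> b \<and> a \<noteq> i \<and> b \<noteq> i \<and> link g i a \<and> link g i b" if i: "i \<in> ?I" for i
  proof -
    obtain s where s: "s < ?l" "i = ix s" using i by auto
    obtain p n where pn: "p < ?l" "n < ?l" "p \<noteq> s" "n \<noteq> s" "p \<noteq> n"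
      "vs ! s \<in> es ! p" "vs ! s \<in> es ! s" "vs ! n \<in> es ! s" "vs ! n \<in> es ! n"
      using cycle_neighbours[OF c s(1)] l3 by blast
    have "link g i (ix p)" using lollipop_meet[of i "ix p"] pn s ix ix_eq by (metis disjoint_iff)
    moreover have "link g i (ix n)" using lollipop_meet[of i "ix n"] pn s ix ix_eq by (metis disjoint_iff)
    ultimately show ?thesis using pn s ix_eq by (intro exI[of _ "ix p"] exI[of _ "ix n"]) auto
  qed
  \<comment> \<open>The largest used index needs two smaller linked indices. Only the link between 0
    and \<open>g - 1\<close> can supply the second one, so \<open>M = g - 1\<close> and 0 is
    used.\<close>
  define M where "M = Max ?I"
  have ne: "?I \<noteq> {}" using l2 by force
  have M: "M \<in> ?I" "\<And>i. i \<in> ?I \<Longrightarrow> i \<le> M" using ne by (auto simp: M_def)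
  obtain a b where ab: "a \<in> ?I" "b \<in> ?I" "a \<noteq> b" "a \<noteq> M" "b \<noteq> M" "link g M a" "link g M b"
    using two[OF M(1)] by blast
  have "a < M" "b < M" using ab(4,5) M(2)[OF ab(1)] M(2)[OF ab(2)] by simp_all
  then have Mg: "M = g - 1" and zero: "0 \<in> ?I" using ab by (auto simp: link_def)
  have Ig: "?I \<subseteq> {..<g}" using M(2) Mg gm by fastforce
  \<comment> \<open>An index below \<open>g - 1\<close> has exactly two links, one of them to its
    successor, and both are used.\<close>
  have all: "i < g \<Longrightarrow> i \<in> ?I" for i
  proof (induction i)
    case (Suc i)
    then obtain a b where "a \<in> ?I" "b \<in> ?I" "a \<noteq> b" "link g i a" "link g i b" using two[of i] by auto
    then have "a = Suc i \<or> b = Suc i" using Suc.prems gm by (auto simp: link_def)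
    then show ?case using \<open>a \<in> ?I\<close> \<open>b \<in> ?I\<close> by metis
  qed (use zero in simp)
  have I: "?I = {..<g}" using Ig all by auto
  have "set es = (!) es ` {..<?l}" by (auto simp: set_conv_nth)
  also have "\<dots> = e ` ?I" using ix by (auto simp: image_iff)
  finally show es: "set es = e ` {..<g}" by (simp only: I)
  have "card (e ` {..<g}) = g"
    using lollipop_D(7) gm by (subst card_image) (auto intro: inj_on_subset)
  then show "length es = g" using es dist(1) by (metis distinct_card)
  show "cycle_incidences vs es = {(v, x). x \<in> e ` {..<g} \<and> v \<in> x \<and> (\<exists>y\<in>e ` {..<g}. y \<noteq> x \<and> v \<in> y)}"
  proof (intro equalityI subsetI)
    fix z assume "z \<in> cycle_incidences vs es"
    then obtain s where s: "s < ?l" and z: "z = (vs ! s, es ! s) \<or> z = (vs ! ((s + 1) mod ?l), es ! s)"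
      by (auto simp: cycle_incidences_def)
    obtain p n where pn: "p < ?l" "n < ?l" "p \<noteq> s" "n \<noteq> s"
      "vs ! s \<in> es ! p" "vs ! s \<in> es ! s" "vs ! n \<in> es ! s" "vs ! n \<in> es ! n" "n = (s + 1) mod ?l"
      using cycle_neighbours[OF c s] by blast
    have "es ! p \<noteq> es ! s" "es ! n \<noteq> es ! s" using dist(1) pn s by (auto simp: nth_eq_iff_index_eq)
    then show "z \<in> {(v, x). x \<in> e ` {..<g} \<and> v \<in> x \<and> (\<exists>y\<in>e ` {..<g}. y \<noteq> x \<and> v \<in> y)}"
    proof -
      have "es ! p \<in> e ` {..<g}" "es ! n \<in> e ` {..<g}" "es ! s \<in> e ` {..<g}"
        using nth_mem[OF pn(1)] nth_mem[OF pn(2)] nth_mem[OF s] unfolding es by auto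
      moreover have "z = (vs ! s, es ! s) \<or> z = (vs ! n, es ! s)" using z unfolding pn(9) .
      ultimately show ?thesis using pn(5-8) \<open>es ! p \<noteq> es ! s\<close> \<open>es ! n \<noteq> es ! s\<close> by blast
    qed
  next
    fix z assume "z \<in> {(v, x). x \<in> e ` {..<g} \<and> v \<in> x \<and> (\<exists>y\<in>e ` {..<g}. y \<noteq> x \<and> v \<in> y)}"
    then obtain v x y where z: "z = (v, x)" "x \<in> set es" "v \<in> x" "y \<in> set es" "y \<noteq> x" "v \<in> y"
      using es by auto
    then obtain s t where st: "s < ?l" "es ! s = x" "t < ?l" "es ! t = y" by (auto simp: in_set_conv_nth)
    then have "s \<noteq> t" using z by auto
    obtain p n where pn: "p < ?l" "n < ?l" "p \<noteq> s" "n \<noteq> s" "p \<noteq> n"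
      "vs ! s \<in> es ! p" "vs ! s \<in> es ! s" "vs ! n \<in> es ! s" "vs ! n \<in> es ! n" "n = (s + 1) mod ?l"
      using cycle_neighbours[OF c st(1)] l3 by blast
    have linked: "link g (ix s) (ix q)" if "q < ?l" "q \<noteq> s" "u \<in> es ! s" "u \<in> es ! q" for q u
      using lollipop_meet[of "ix s" "ix q"] that st(1) ix ix_eq by (metis disjoint_iff)
    have "ix s < g" "ix p < g" "ix n < g" "ix t < g" using I pn st by auto
    moreover have "link g (ix s) (ix p)" "link g (ix s) (ix n)" "link g (ix s) (ix t)"
      using linked pn st z \<open>s \<noteq> t\<close> by blast+
    moreover have "ix p \<noteq> ix n" using pn ix_eq by auto
    \<comment> \<open>Within the cycle an index has only two links, so the other edge through
      \<open>v\<close> is the predecessor or the successor.\<close>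
    ultimately have "ix t = ix p \<or> ix t = ix n" using gm by (auto simp: link_def)
    then have "t = p \<or> t = n" using ix_eq pn st by auto
    moreover have same: "u = u'" if "q < ?l" "q \<noteq> s" "u \<in> es ! s" "u \<in> es ! q" "u' \<in> es ! s" "u' \<in> es ! q" for q u u'
    proof (rule linear_common_vertex[OF lollipop_D(4) lollipop_linear, of "es ! s" "es ! q"])
      show "es ! s \<in> hedges H" "es ! q \<in> hedges H"
        using sub that(1) st(1) nth_mem[of s es] nth_mem[of q es] by auto
      show "es ! s \<noteq> es ! q" using that(1,2) st(1) dist(1) by (simp add: nth_eq_iff_index_eq)
    qed (use that in auto)
    ultimately have "v = vs ! s \<or> v = vs ! n" using pn st z by metis
    then show "z \<in> cycle_incidences vs es"
      using z(1) st(1,2) pn(10) by (auto simp: cycle_incidences_def)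
  qed
qed

lemma lollipop_linear_unicyclic: "H \<in> linear_unicyclic k m g"
proof -
  obtain vs where vs: "is_cycle H vs (map e [0..<g])" using lollipop_ex_cycle by blast
  define C where "C = {(v, x). x \<in> e ` {..<g} \<and> v \<in> x \<and> (\<exists>y\<in>e ` {..<g}. y \<noteq> x \<and> v \<in> y)}"
  have C: "cycle_incidences vs es = C" if "is_cycle H vs es" for vs es
    unfolding C_def by (rule lollipop_cycle_edges(3)[OF that])
  have "cycles H = {C}"
  proof
    show "cycles H \<subseteq> {C}" using C by (auto simp: cycles_def)
    show "{C} \<subseteq> cycles H" using vs C[OF vs] unfolding cycles_def by blast
  qed
  then have "unicyclic H" using lollipop_connected by (simp add: unicyclic_def is_singleton_def)
  moreover have "girth H = g"
    unfolding girth_def by (rule Least_equality) (use vs lollipop_cycle_edges(2) in auto)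
  moreover have "card (hedges H) = m" using lollipop_D(7,8) by (simp add: card_image)
  ultimately show ?thesis
    using lollipop_D(4,5) lollipop_linear by (simp add: linear_unicyclic_def)
qed

end

text \<open>A longest path from \<open>x0\<close> ends at a vertex \<open>z\<close> all of whose
  neighbours lie on the path; having degree at least 2, \<open>z\<close> has a chord back to some
  \<open>fs ! q\<close>. Path and chord already account for a degree sum of twice the number of path
  vertices. The total leaves no more, as vertices off the path have degree at least 2. So path
  vertices have no further neighbours, and by connectedness there are no other vertices.\<close>

lemma lollipop_graph:
  fixes adj :: "'a \<Rightarrow> 'a \<Rightarrow> bool"
  assumes fin: "finite E" and sym: "\<And>x y. adj x y \<Longrightarrow> adj y x" and irr: "\<And>x. \<not> adj x x"
  defines "N \<equiv> \<lambda>x. {y\<in>E. adj x y}"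
  assumes con: "\<And>A. A \<subseteq> E \<Longrightarrow> A \<noteq> {} \<Longrightarrow> (\<And>x. x \<in> A \<Longrightarrow> N x \<subseteq> A) \<Longrightarrow> A = E"
    and x0: "x0 \<in> E" "card (N x0) \<ge> 1" and two: "\<And>x. x \<in> E \<Longrightarrow> x \<noteq> x0 \<Longrightarrow> card (N x) \<ge> 2"
    and total: "(\<Sum>x\<in>E. card (N x)) = 2 * card E"
  shows "\<exists>fs q. distinct fs \<and> set fs = E \<and> q + 2 < length fs \<and>
    (\<forall>i<length fs. \<forall>j<length fs. adj (fs ! i) (fs ! j) \<longleftrightarrow>
      j = i + 1 \<or> i = j + 1 \<or> (i = q \<and> j = length fs - 1) \<or> (j = q \<and> i = length fs - 1))"
proof -
  define P where "P fs \<longleftrightarrow> distinct fs \<and> set fs \<subseteq> E \<and> fs \<noteq> [] \<and> fs ! 0 = x0 \<and>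
    (\<forall>i. Suc i < length fs \<longrightarrow> adj (fs ! i) (fs ! Suc i))" for fs
  have finN: "finite (N x)" for x using fin by (simp add: N_def)
  have "P [x0]" using x0 by (simp add: P_def)
  moreover have "\<forall>fs. P fs \<longrightarrow> length fs < Suc (card E)"
    using fin by (auto simp: P_def less_Suc_eq_le) (metis card_mono distinct_card)
  ultimately obtain fs where fs: "P fs" and max: "\<And>gs. P gs \<Longrightarrow> length gs \<le> length fs"
    using ex_has_greatest_nat[of P "[x0]" length "Suc (card E)"] by auto
  have D: "distinct fs" "set fs \<subseteq> E" "fs \<noteq> []" "fs ! 0 = x0"
    "\<And>i. Suc i < length fs \<Longrightarrow> adj (fs ! i) (fs ! Suc i)" using fs by (auto simp: P_def)
  obtain y where y: "y \<in> N x0" using x0(2) by fastforce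
  have "P [x0, y]" using y x0 irr by (auto simp: P_def N_def nth_Cons split: nat.splits)
  then have len: "2 \<le> length fs" using max by fastforce
  define p where "p = length fs - 1"
  have p: "length fs = Suc p" "1 \<le> p" using len by (auto simp: p_def)
  define z where "z = fs ! p"
  have zE: "z \<in> E" using D(2) p nth_mem[of p fs] by (auto simp: z_def)
  have Nz: "N z \<subseteq> set fs"
  proof
    fix w assume w: "w \<in> N z"
    show "w \<in> set fs"
    proof (rule ccontr)
      assume "w \<notin> set fs"
      then have "P (fs @ [w])"
        using D w p by (auto simp: P_def nth_append N_def z_def less_Suc_eq)
      then show False using max by fastforce
    qed
  qed
  have "z \<noteq> x0" using D(1,4) p nth_eq_iff_index_eq[of fs p 0] by (auto simp: z_def)
  then have "2 \<le> card (N z)" using two zE by simp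
  \<comment> \<open>Besides its predecessor on the path, \<open>z\<close> has a second neighbour,
    which closes the cycle.\<close>
  then have "\<not> N z \<subseteq> {fs ! (p - 1)}" using card_mono[of "{fs ! (p - 1)}" "N z"] by auto
  then obtain w where w: "w \<in> N z" "w \<noteq> fs ! (p - 1)" by auto
  have "w \<in> set fs" using w(1) Nz by blast
  then obtain q where q: "q < length fs" "fs ! q = w" by (auto simp: in_set_conv_nth)
  have "q \<noteq> p" using w(1) q irr[of z] by (auto simp: N_def z_def)
  moreover have "q \<noteq> p - 1" using q w by auto
  ultimately have qp: "q + 2 \<le> p" using q p by linarith
  define lk where "lk i j \<longleftrightarrow> j = i + 1 \<or> i = j + 1 \<or> (i = q \<and> j = p) \<or> (j = q \<and> i = p)" for i j
  define K where "K i = {j. j < Suc p \<and> lk i j}" for i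
  have adjK: "adj (fs ! i) (fs ! j)" if "i < Suc p" "j < Suc p" "lk i j" for i j
    using that D(5)[of i] D(5)[of j] sym w q p by (auto simp: lk_def N_def z_def)
  have inj: "inj_on ((!) fs) {..p}" using D(1) p by (auto simp: inj_on_def nth_eq_iff_index_eq)
  have KN: "(!) fs ` K i \<subseteq> N (fs ! i)" if "i < Suc p" for i
    using adjK that D(2) p nth_mem[of _ fs] by (fastforce simp: K_def N_def)
  have cK: "card ((!) fs ` K i) = card (K i)" for i
    by (rule card_image, rule inj_on_subset[OF inj]) (auto simp: K_def)
  have KleN: "card (K i) \<le> card (N (fs ! i))" if "i < Suc p" for i
    using card_mono[OF finN KN[OF that]] cK by simp
  \<comment> \<open>Ordered pairs are counted: \<open>p\<close> forward, \<open>p\<close> backward,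
    and both directions of the chord.\<close>
  have sumK: "2 * Suc p \<le> (\<Sum>i<Suc p. card (K i))"
  proof -
    let ?A = "(\<lambda>i. (i, Suc i)) ` {..<p}" and ?B = "(\<lambda>i. (Suc i, i)) ` {..<p}" and ?C = "{(q, p), (p, q)}"
    have "card (?A \<union> ?B \<union> ?C) = card ?A + card ?B + card ?C"
      using qp by (subst card_Un_disjoint; (subst card_Un_disjoint)?) auto
    also have "\<dots> = 2 * Suc p" using qp by (simp add: card_image inj_on_def)
    finally have "2 * Suc p = card (?A \<union> ?B \<union> ?C)" by simp
    also have "\<dots> \<le> card (Sigma {..<Suc p} K)"
      using qp by (intro card_mono finite_SigmaI) (auto simp: K_def lk_def)
    also have "\<dots> = (\<Sum>i<Suc p. card (K i))" by (rule card_SigmaI) (auto simp: K_def)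
    finally show ?thesis .
  qed
  have set_fs: "set fs = (!) fs ` {..<Suc p}" using p by (auto simp: set_conv_nth)
  have card_fs: "card (set fs) = Suc p" using D(1) p by (simp add: distinct_card)
  have "(\<Sum>x\<in>E. card (N x)) = (\<Sum>x\<in>E - set fs. card (N x)) + (\<Sum>x\<in>set fs. card (N x))"
    using fin D(2) by (rule sum.subset_diff[rotated])
  moreover have "(\<Sum>x\<in>E - set fs. 2) \<le> (\<Sum>x\<in>E - set fs. card (N x))"
    by (rule sum_mono) (use two D(3,4) in \<open>metis DiffD1 DiffD2 length_greater_0_conv nth_mem\<close>)
  moreover have "(\<Sum>x\<in>E - set fs. 2::nat) = 2 * (card E - Suc p)"
    using card_fs D(2) fin by (simp add: card_Diff_subset)
  moreover obtain r where "card E = Suc p + r"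
    using card_mono[OF fin D(2)] card_fs le_Suc_ex by metis
  ultimately have "(\<Sum>x\<in>set fs. card (N x)) \<le> 2 * Suc p" using total by simp
  moreover have "(\<Sum>x\<in>set fs. card (N x)) = (\<Sum>i<Suc p. card (N (fs ! i)))"
    unfolding set_fs using inj by (subst sum.reindex) (auto simp: lessThan_Suc_atMost)
  moreover have "(\<Sum>i<Suc p. card (K i)) \<le> (\<Sum>i<Suc p. card (N (fs ! i)))"
    by (rule sum_mono) (use KleN in auto)
  ultimately have "(\<Sum>i<Suc p. card (K i)) = (\<Sum>i<Suc p. card (N (fs ! i)))" using sumK by linarith
  \<comment> \<open>Equal sums of termwise ordered numbers agree term by term.\<close>
  then have "card (K i) = card (N (fs ! i))" if "i < Suc p" for i
    using sum_mono_inv[of "\<lambda>i. card (K i)" "{..<Suc p}" "\<lambda>i. card (N (fs ! i))" i] KleN that by auto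
  then have NK: "N (fs ! i) = (!) fs ` K i" if "i < Suc p" for i
    using card_subset_eq[OF finN KN[OF that]] cK that by simp
  have all: "set fs = E"
  proof (rule con[OF D(2)])
    show "set fs \<noteq> {}" using D(3) by simp
    fix x assume "x \<in> set fs"
    then obtain i where "i < Suc p" "x = fs ! i" using p by (auto simp: in_set_conv_nth)
    then show "N x \<subseteq> set fs" using NK p by (auto simp: K_def)
  qed
  have "adj (fs ! i) (fs ! j) \<longleftrightarrow> lk i j" if ij: "i < Suc p" "j < Suc p" for i j
  proof
    assume "adj (fs ! i) (fs ! j)"
    moreover have "fs ! j \<in> set fs" using ij p by simp
    ultimately have "fs ! j \<in> N (fs ! i)" using D(2) by (auto simp: N_def)
    then have "fs ! j \<in> (!) fs ` K i" unfolding NK[OF ij(1)] .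
    then obtain j' where "j' \<in> K i" "fs ! j = fs ! j'" by auto
    then show "lk i j" using D(1) p ij by (auto simp: K_def nth_eq_iff_index_eq)
  qed (use adjK ij in auto)
  then show ?thesis
    using D(1) all qp p by (intro exI[of _ fs] exI[of _ q]) (auto simp: lk_def)
qed

text \<open>The line graph meets the conditions of \<open>lollipop_graph\<close>: its degrees are
  the numbers of joints, their average is 2, and at most one of its vertices is a leaf.\<close>

lemma ex_lollipop:
  assumes H: "H \<in> linear_unicyclic k m g" and k: "k \<ge> 2" and m: "m \<ge> 2"
    and deg: "\<And>v. v \<in> verts H \<Longrightarrow> degree H v \<le> 2"
    and leaves: "card {x\<in>hedges H. joints H x = 1} \<le> 1"
  shows "\<exists>e. lollipop k m g H e"
proof -
  let ?E = "hedges H"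
  have hyp: "hypergraph H" and uni: "uniform k H" and lin: "linear_hg H" and uc: "unicyclic H"
    and cE: "card ?E = m" and girth: "girth H = g"
    using H by (auto simp: linear_unicyclic_def)
  note V = unicyclic_verts[OF hyp uni uc k]
  have con: "connected_hg H" using uc by (simp add: unicyclic_def)
  have ne: "{} \<notin> ?E" using uni k by (auto simp: uniform_def)
  have finE: "finite ?E" by (rule hypergraph_finite_edges[OF hyp])
  define adj where "adj x y \<longleftrightarrow> x \<noteq> y \<and> x \<inter> y \<noteq> {}" for x y :: "'a set"
  define N where "N x = {y\<in>?E. adj x y}" for x
  have card_N: "card (N x) = joints H x" if "x \<in> ?E" for x
  proof -
    have "N x = {f\<in>?E. f \<noteq> x \<and> x \<inter> f \<noteq> {}}" by (auto simp: N_def adj_def)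
    then show ?thesis using joints_eq_card[OF hyp lin deg that] by simp
  qed
  have total: "(\<Sum>x\<in>?E. card (N x)) = 2 * card ?E"
    using sum_joints[OF hyp uni V(1) V(2) _ deg] k card_N by simp
  have closed: "A = ?E" if A: "A \<subseteq> ?E" "A \<noteq> {}" "\<And>x. x \<in> A \<Longrightarrow> N x \<subseteq> A" for A
  proof (rule connected_edges_closed[OF hyp con ne A(1,2)])
    fix x y assume "x \<in> A" "y \<in> ?E" "x \<inter> y \<noteq> {}"
    then show "y \<in> A" using A(3)[of x] by (cases "x = y") (auto simp: N_def adj_def)
  qed
  have pos: "card (N x) \<ge> 1" if x: "x \<in> ?E" for x
  proof (rule ccontr)
    assume "\<not> ?thesis"
    moreover have "finite (N x)" using finE by (simp add: N_def)
    ultimately have "N x = {}" using card_0_eq[of "N x"] by linarith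
    then have "{x} = ?E" using x by (intro closed) auto
    then have "card ?E = 1" by (metis card_1_singleton_iff One_nat_def)
    then show False using cE m by simp
  qed
  \<comment> \<open>\<open>x0\<close> is the leaf if there is one and arbitrary otherwise.\<close>
  have "\<exists>x0\<in>?E. \<forall>x\<in>?E. x \<noteq> x0 \<longrightarrow> joints H x \<noteq> 1"
  proof (cases "{x\<in>?E. joints H x = 1} = {}")
    case True
    have "?E \<noteq> {}" using cE m by auto
    with True show ?thesis by blast
  next
    case False
    then obtain x0 where x0: "x0 \<in> ?E" "joints H x0 = 1" by auto
    have "x = x0" if "x \<in> ?E" "joints H x = 1" for x
    proof (rule ccontr)
      assume "x \<noteq> x0"
      have "card {x, x0} \<le> card {x\<in>?E. joints H x = 1}"
        using x0 that finE by (intro card_mono) auto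
      then show False using leaves \<open>x \<noteq> x0\<close> by simp
    qed
    then show ?thesis using x0 by auto
  qed
  then obtain x0 where x0: "x0 \<in> ?E" "\<And>x. x \<in> ?E \<Longrightarrow> x \<noteq> x0 \<Longrightarrow> joints H x \<noteq> 1" by auto
  have two: "card (N x) \<ge> 2" if "x \<in> ?E" "x \<noteq> x0" for x
    using pos[OF that(1)] x0(2)[OF that] card_N[OF that(1)] by linarith
  have "\<exists>fs q. distinct fs \<and> set fs = ?E \<and> q + 2 < length fs \<and>
    (\<forall>i<length fs. \<forall>j<length fs. adj (fs ! i) (fs ! j) \<longleftrightarrow>
      j = i + 1 \<or> i = j + 1 \<or> (i = q \<and> j = length fs - 1) \<or> (j = q \<and> i = length fs - 1))"
    by (rule lollipop_graph[OF finE _ _ closed[unfolded N_def] x0(1) pos[OF x0(1), unfolded N_def] two[unfolded N_def] total[unfolded N_def]])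
       (auto simp: adj_def)
  then obtain fs q where fs: "distinct fs" "set fs = ?E" "q + 2 < length fs"
    "\<And>i j. i < length fs \<Longrightarrow> j < length fs \<Longrightarrow> adj (fs ! i) (fs ! j) \<longleftrightarrow>
      j = i + 1 \<or> i = j + 1 \<or> (i = q \<and> j = length fs - 1) \<or> (j = q \<and> i = length fs - 1)"
    by blast
  have len: "length fs = m" using fs(1,2) cE distinct_card by metis
  \<comment> \<open>The list starts at the possible leaf and ends on the cycle, so it is reversed.
    The chord between \<open>q\<close> and \<open>m - 1\<close> becomes one between
    \<open>m - 1 - q\<close> and 0, which gives the cycle length \<open>m - q\<close>.\<close>
  define e where "e i = fs ! (m - 1 - i)" for i
  have inj: "inj_on e {..<m}"
    using fs(1) len by (auto simp: inj_on_def e_def nth_eq_iff_index_eq)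
  have im: "?E = e ` {..<m}"
  proof (rule card_subset_eq[symmetric, OF finE])
    show "e ` {..<m} \<subseteq> ?E" using fs(2) len nth_mem[of _ fs] m by (auto simp: e_def)
    show "card (e ` {..<m}) = card ?E" using inj cE by (simp add: card_image)
  qed
  have "lollipop k m (m - q) H e"
    unfolding lollipop_def
  proof (intro conjI allI impI ballI)
    fix i j assume ij: "i < m" "j < m" "i \<noteq> j"
    have "adj (e i) (e j) \<longleftrightarrow> link (m - q) i j"
      unfolding e_def link_def using fs(3) len ij by (subst fs(4)) auto
    moreover have "e i \<noteq> e j" using inj ij by (auto simp: inj_on_def)
    moreover have "e i \<in> ?E" "e j \<in> ?E" using im ij by auto
    moreover have "card (e i \<inter> e j) \<le> 1" using lin calculation by (auto simp: linear_hg_def)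
    moreover have "card (e i \<inter> e j) = 0 \<longleftrightarrow> e i \<inter> e j = {}"
      using hypergraph_finite_edge[OF hyp \<open>e i \<in> ?E\<close>] by simp
    ultimately show "card (e i \<inter> e j) = (if link (m - q) i j then 1 else 0)"
      unfolding adj_def by (auto simp del: card_0_eq)
  qed (use k fs(3) len hyp uni V(1) deg inj im in auto)
  moreover from lollipop_linear_unicyclic[OF this] have "m - q = g"
    using girth by (simp add: linear_unicyclic_def)
  ultimately show ?thesis by auto
qed

section \<open>The hypercycle with a hyperpath has the required intersection pattern\<close>

context
  fixes k g r :: nat
  assumes k: "k \<ge> 3" and g: "g \<ge> 3"
begin

definition power_edge :: "nat set \<Rightarrow> nat power_vertex set" where
  "power_edge s = Inl ` s \<union> Inr ` ({s} \<times> {..<k - 2})"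

text \<open>The identification map inside \<open>coalescence\<close>: the end 0 of the path becomes
  the chosen cored vertex of the cycle.\<close>

definition glue :: "nat power_vertex \<Rightarrow> nat power_vertex + nat power_vertex" where
  "glue x = (if x = Inl 0 then Inl (Inr ({0, 1}, 0)) else Inr x)"

definition succ_mod :: "nat \<Rightarrow> nat" where
  "succ_mod i = (if i + 1 = g then 0 else i + 1)"

definition cycle_edge :: "nat \<Rightarrow> (nat power_vertex + nat power_vertex) set" where
  "cycle_edge i = Inl ` power_edge {i, succ_mod i}"

definition tail_edge :: "nat \<Rightarrow> (nat power_vertex + nat power_vertex) set" where
  "tail_edge i = glue ` power_edge {i, i + 1}"

text \<open>The path hangs off the cycle edge 0, while the pattern expects it at index
  \<open>g - 1\<close>; the shift by \<open>succ_mod\<close> adjusts the numbering.\<close>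

definition lollipop_edge_fun :: "nat \<Rightarrow> (nat power_vertex + nat power_vertex) set" where
  "lollipop_edge_fun i = (if i < g then cycle_edge (succ_mod i) else tail_edge (i - g))"

lemma succ_mod_less: "i < g \<Longrightarrow> succ_mod i < g"
  using g by (auto simp: succ_mod_def)

lemma succ_mod_inj: "i < g \<Longrightarrow> j < g \<Longrightarrow> succ_mod i = succ_mod j \<longleftrightarrow> i = j"
  by (auto simp: succ_mod_def split: if_splits)

lemma succ_mod_surj: "i < g \<Longrightarrow> \<exists>j<g. succ_mod j = i"
  using g by (cases i) (auto simp: succ_mod_def intro: exI[of _ "g - 1"] exI[of _ "i - 1"])

lemma succ_mod_pair: "i < g \<Longrightarrow> j < g \<Longrightarrow> {i, succ_mod i} = {j, succ_mod j} \<longleftrightarrow> i = j"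
  using g by (auto simp: succ_mod_def doubleton_eq_iff split: if_splits)

lemma link_succ_mod: "i < g \<Longrightarrow> j < g \<Longrightarrow> link g i j \<longleftrightarrow> j = succ_mod i \<or> i = succ_mod j"
  using g by (auto simp: link_def succ_mod_def)

lemma succ_mod_01: "i < g \<Longrightarrow> {i, succ_mod i} = {0, 1} \<longleftrightarrow> i = 0"
  using g succ_mod_pair[of i 0] by (simp add: succ_mod_def)

lemma in_cycle_edge:
  "Inl (Inl a) \<in> cycle_edge i \<longleftrightarrow> a = i \<or> a = succ_mod i"
  "Inl (Inr (s, t)) \<in> cycle_edge i \<longleftrightarrow> s = {i, succ_mod i} \<and> t < k - 2"
  "Inr x \<notin> cycle_edge i"
  by (auto simp: cycle_edge_def power_edge_def image_iff)

lemma in_tail_edge: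
  "Inl (Inl a) \<notin> tail_edge i"
  "Inl (Inr (s, t)) \<in> tail_edge i \<longleftrightarrow> i = 0 \<and> s = {0, 1} \<and> t = 0"
  "Inr (Inl a) \<in> tail_edge i \<longleftrightarrow> a \<noteq> 0 \<and> (a = i \<or> a = i + 1)"
  "Inr (Inr (s, t)) \<in> tail_edge i \<longleftrightarrow> s = {i, i + 1} \<and> t < k - 2"
  by (auto simp: tail_edge_def glue_def power_edge_def image_iff)

lemma cycle_edge_Int:
  assumes "i < g" "j < g" "i \<noteq> j"
  shows "card (cycle_edge (succ_mod i) \<inter> cycle_edge (succ_mod j)) = (if link g i j then 1 else 0)"
proof -
  let ?s = succ_mod
  have neq: "?s i \<noteq> ?s j" "?s (?s i) \<noteq> ?s (?s j)"
    using assms succ_mod_less by (simp_all add: succ_mod_inj)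
  have *: "cycle_edge (?s i) \<inter> cycle_edge (?s j) = (if ?s j = ?s (?s i) then {Inl (Inl (?s j))} else {}) \<union>
      (if ?s i = ?s (?s j) then {Inl (Inl (?s i))} else {})" (is "?A = ?B")
  proof (rule set_eqI)
    fix v
    show "v \<in> ?A \<longleftrightarrow> v \<in> ?B"
    proof (cases v)
      case (Inl u)
      show ?thesis
      proof (cases u)
        case (Inl a)
        then show ?thesis
          unfolding \<open>v = Inl u\<close> using neq by (auto simp: in_cycle_edge)
      next
        case (Inr st)
        have "{?s i, ?s (?s i)} \<noteq> {?s j, ?s (?s j)}"
          using succ_mod_pair[of "?s i" "?s j"] succ_mod_inj[of i j] succ_mod_less assms by blast
        moreover obtain s t where "st = (s, t)" by (cases st)
        ultimately have "v \<notin> ?A"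
          unfolding \<open>v = Inl u\<close> Inr using in_cycle_edge(2)[of s t] by blast
        moreover have "v \<notin> ?B" unfolding \<open>v = Inl u\<close> Inr by simp
        ultimately show ?thesis by blast
      qed
    qed (auto simp: in_cycle_edge)
  qed
  \<comment> \<open>Since \<open>g \<ge> 3\<close>, two indices cannot be successors of each other,
    so at most one of the two candidate vertices is shared.\<close>
  have one: "\<not> (j = ?s i \<and> i = ?s j)" using assms g by (auto simp: succ_mod_def split: if_splits)
  have iff: "?s j = ?s (?s i) \<longleftrightarrow> j = ?s i" "?s i = ?s (?s j) \<longleftrightarrow> i = ?s j"
    using succ_mod_inj[OF assms(2) succ_mod_less[OF assms(1)]]
      succ_mod_inj[OF assms(1) succ_mod_less[OF assms(2)]] by blast+
  have "card ((if P then {x} else {}) \<union> (if Q then {y} else {})) = (if P \<or> Q then 1 else 0)"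
    if "\<not> (P \<and> Q)" for P Q and x y :: "nat power_vertex + nat power_vertex"
    using that by auto
  from this[OF one] show ?thesis unfolding * iff link_succ_mod[OF assms(1,2)] .
qed

lemma cycle_tail_Int:
  assumes "i < g"
  shows "card (cycle_edge (succ_mod i) \<inter> tail_edge j) = (if link g i (g + j) then 1 else 0)"
proof -
  have *: "cycle_edge (succ_mod i) \<inter> tail_edge j =
      (if succ_mod i = 0 \<and> j = 0 then {Inl (Inr ({0, 1}, 0))} else {})" (is "?A = ?B")
  proof (rule set_eqI)
    fix v
    show "v \<in> ?A \<longleftrightarrow> v \<in> ?B"
    proof (cases v)
      case (Inl u)
      show ?thesis
      proof (cases u)
        case (Inl a)
        then show ?thesis unfolding \<open>v = Inl u\<close> by (simp add: in_tail_edge)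
      next
        case (Inr st)
        obtain s t where st: "st = (s, t)" by (cases st)
        define S where "S = {succ_mod i, succ_mod (succ_mod i)}"
        have "S = {0, 1} \<longleftrightarrow> succ_mod i = 0"
          unfolding S_def by (rule succ_mod_01[OF succ_mod_less[OF assms]])
        then show ?thesis
          unfolding \<open>v = Inl u\<close> Inr st Int_iff in_cycle_edge in_tail_edge S_def[symmetric] using k by auto
      qed
    qed (auto simp: in_cycle_edge)
  qed
  show ?thesis unfolding * using assms g by (auto simp: succ_mod_def link_def)
qed

lemma tail_edge_Int:
  assumes "i < j"
  shows "card (tail_edge i \<inter> tail_edge j) = (if link g (g + i) (g + j) then 1 else 0)"
proof -
  have *: "tail_edge i \<inter> tail_edge j = (if j = i + 1 then {Inr (Inl j)} else {})" (is "?A = ?B")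
  proof (rule set_eqI)
    fix v
    show "v \<in> ?A \<longleftrightarrow> v \<in> ?B"
    proof (cases v)
      case (Inl u)
      then show ?thesis using assms by (cases u) (auto simp: in_tail_edge)
    next
      case (Inr u)
      then show ?thesis using assms by (cases u) (auto simp: in_tail_edge doubleton_eq_iff)
    qed
  qed
  show ?thesis unfolding * using assms g by (auto simp: link_def)
qed

lemma lollipop_edge_Int:
  assumes "i \<noteq> j"
  shows "card (lollipop_edge_fun i \<inter> lollipop_edge_fun j) = (if link g i j then 1 else 0)"
proof -
  have less: "card (lollipop_edge_fun i \<inter> lollipop_edge_fun j) = (if link g i j then 1 else 0)" if "i < j" for i j
  proof (cases "i < g"; cases "j < g")
    assume "i < g" "j < g"
    then show ?thesis using cycle_edge_Int[of i j] that by (simp add: lollipop_edge_fun_def)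
  next
    assume "i < g" "\<not> j < g"
    then show ?thesis using cycle_tail_Int[of i "j - g"] by (simp add: lollipop_edge_fun_def)
  next
    assume "\<not> i < g" "\<not> j < g"
    then show ?thesis using tail_edge_Int[of "i - g" "j - g"] that by (simp add: lollipop_edge_fun_def)
  qed (use that in simp)
  have "link g i j \<longleftrightarrow> link g j i" by (auto simp: link_def)
  then show ?thesis
    using less[of i j] less[of j i] assms by (metis Int_commute nat_neq_iff)
qed

lemma card_power_edge: "i \<noteq> j \<Longrightarrow> card (power_edge {i, j}) = k"
  using k unfolding power_edge_def
  by (subst card_Un_disjoint) (auto simp: card_image inj_on_def card_cartesian_product_singleton)

lemma card_lollipop_edge: "card (lollipop_edge_fun i) = k"
proof -
  have "inj glue" by (auto simp: inj_on_def glue_def split: if_splits)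
  then have "card (tail_edge j) = k" for j
    unfolding tail_edge_def by (subst card_image) (auto intro: inj_on_subset simp: card_power_edge)
  moreover have "card (cycle_edge j) = k" for j
    unfolding cycle_edge_def using g by (subst card_image) (auto simp: card_power_edge succ_mod_def)
  ultimately show ?thesis by (simp add: lollipop_edge_fun_def)
qed

lemma hedges_hypercycle_hyperpath:
  "hedges (hypercycle_hyperpath k g r) = lollipop_edge_fun ` {..<g + r}"
proof -
  have mod: "(i + 1) mod g = succ_mod i" if "i < g" for i
    using that by (auto simp: succ_mod_def)
  have "hedges (hypercycle k g) = (\<lambda>i. power_edge {i, succ_mod i}) ` {..<g}"
  proof -
    have "{{i, (i + 1) mod g} | i. i < g} = (\<lambda>i. {i, succ_mod i}) ` {..<g}"
      using mod by (force simp: image_iff)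
    then show ?thesis
      by (simp add: hypercycle_def power_hg_def cycle_graph_def power_edge_def image_image)
  qed
  moreover have "hedges (hyperpath k r) = (\<lambda>i. power_edge {i, i + 1}) ` {..<r}"
  proof -
    have "{{i, i + 1} | i. i < r} = (\<lambda>i. {i, i + 1}) ` {..<r}" by auto
    then show ?thesis
      by (simp add: hyperpath_def power_hg_def path_graph_def power_edge_def image_image)
  qed
  ultimately have "hedges (hypercycle_hyperpath k g r) = cycle_edge ` {..<g} \<union> tail_edge ` {..<r}"
    unfolding hypercycle_hyperpath_def coalescence_def Let_def cycle_edge_def tail_edge_def
    by (simp add: image_image glue_def[abs_def])
  also have "cycle_edge ` {..<g} = lollipop_edge_fun ` {..<g}"
  proof -
    have "{..<g} = succ_mod ` {..<g}" using succ_mod_less succ_mod_surj by force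
    then have "cycle_edge ` {..<g} = cycle_edge ` succ_mod ` {..<g}" by simp
    then show ?thesis by (simp add: image_image lollipop_edge_fun_def)
  qed
  also have "tail_edge ` {..<r} = lollipop_edge_fun ` {g..<g + r}"
  proof -
    have "{g..<g + r} = (\<lambda>i. g + i) ` {..<r}" by (simp add: lessThan_atLeast0 add.commute)
    moreover have "lollipop_edge_fun ` (\<lambda>i. g + i) ` {..<r} = tail_edge ` {..<r}"
      unfolding image_image by (simp add: lollipop_edge_fun_def)
    ultimately show ?thesis by simp
  qed
  also have "lollipop_edge_fun ` {..<g} \<union> lollipop_edge_fun ` {g..<g + r} = lollipop_edge_fun ` {..<g + r}"
    unfolding image_Un[symmetric] by (rule arg_cong[of _ _ "image _"]) auto
  finally show ?thesis .
qed

lemma verts_hypercycle_hyperpath: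
  "verts (hypercycle_hyperpath k g r) = \<Union>(hedges (hypercycle_hyperpath k g r))"
proof -
  have U: "verts (power_hg k G) = \<Union>(hedges (power_hg k G))" if "verts G = \<Union>(hedges G)" for G :: "nat hypergraph"
    using that unfolding power_hg_def by auto
  have "verts (cycle_graph g) = \<Union>(hedges (cycle_graph g))"
    using g by (auto simp: cycle_graph_def)
  from U[OF this] have c: "verts (hypercycle k g) = \<Union>(hedges (hypercycle k g))"
    by (simp add: hypercycle_def)
  have v: "Inr ({0, 1}, 0) \<in> \<Union>(hedges (hypercycle k g))"
    using cored_hypercycle[OF k g] c by (simp add: cored_def)
  \<comment> \<open>For \<open>r = 0\<close> the path is the isolated vertex 0 without edges; after
    gluing it is covered by the cycle edge of the cored vertex.\<close>
  have p: "verts (hyperpath k r) = insert (Inl 0) (\<Union>(hedges (hyperpath k r)))"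
  proof (cases r)
    case 0
    then show ?thesis by (simp add: hyperpath_def power_hg_def path_graph_def)
  next
    case (Suc r')
    have "i \<in> \<Union>(hedges (path_graph r))" if "i \<le> r" for i
    proof (cases "i < r")
      case False
      then have "i = r' + 1" "r' < r" using that Suc by auto
      then show ?thesis by (auto simp: path_graph_def)
    qed (auto simp: path_graph_def)
    then have "verts (path_graph r) = \<Union>(hedges (path_graph r))"
      by (auto simp: path_graph_def)
    from U[OF this] have "verts (hyperpath k r) = \<Union>(hedges (hyperpath k r))" by (simp add: hyperpath_def)
    moreover have "Inl 0 \<in> verts (hyperpath k r)" by (simp add: hyperpath_def power_hg_def path_graph_def)
    ultimately show ?thesis by auto
  qed
  show ?thesis
    unfolding hypercycle_hyperpath_def coalescence_def Let_def fst_conv snd_conv p c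
    using v by (auto simp: image_iff)
qed

lemma lollipop_hypercycle_hyperpath:
  "lollipop k (g + r) g (hypercycle_hyperpath k g r) lollipop_edge_fun"
proof -
  let ?X = "hypercycle_hyperpath k g r"
  have fin: "finite (lollipop_edge_fun i)" for i
    using card_lollipop_edge[of i] k by (intro card_ge_0_finite) auto
  have inj: "inj_on lollipop_edge_fun {..<g + r}"
  proof (rule inj_onI, rule ccontr)
    fix i j assume "lollipop_edge_fun i = lollipop_edge_fun j" "i \<noteq> j"
    then have "card (lollipop_edge_fun i) \<le> 1" using lollipop_edge_Int[of i j] by (simp split: if_splits)
    then show False using card_lollipop_edge[of i] k by simp
  qed
  have hyp: "hypergraph ?X"
    unfolding hypergraph_def verts_hypercycle_hyperpath hedges_hypercycle_hyperpath
  proof (intro conjI)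
    have "lollipop_edge_fun 0 \<noteq> {}" using card_lollipop_edge[of 0] k by auto
    then show "\<Union>(lollipop_edge_fun ` {..<g + r}) \<noteq> {}" using g by force
  qed (use fin in auto)
  \<comment> \<open>Degrees are bounded by enclosing, for each shape of vertex, the indices of its
    edges in a set of at most two elements.\<close>
  have sub: "\<exists>x y. {i. v \<in> lollipop_edge_fun i} \<subseteq> {x, y}" for v
  proof (cases v)
    case (Inl u)
    show ?thesis
    proof (cases u)
      case (Inl a)
      show ?thesis
      proof (cases "a < g")
        case True
        obtain b where b: "b < g" "succ_mod b = a" using succ_mod_surj[OF True] by auto
        obtain c where c: "c < g" "succ_mod c = b" using succ_mod_surj[OF b(1)] by auto
        have "{i. v \<in> lollipop_edge_fun i} \<subseteq> {b, c}"
          unfolding \<open>v = Inl u\<close> Inl using b c succ_mod_less succ_mod_inj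
          by (auto simp: lollipop_edge_fun_def in_cycle_edge in_tail_edge split: if_splits)
        then show ?thesis by blast
      next
        case False
        then have "{i. v \<in> lollipop_edge_fun i} = {}"
          unfolding \<open>v = Inl u\<close> Inl using succ_mod_less
          by (auto simp: lollipop_edge_fun_def in_cycle_edge in_tail_edge split: if_splits)
        then show ?thesis by blast
      qed
    next
      case (Inr st)
      obtain s t where st: "st = (s, t)" by (cases st)
      \<comment> \<open>At most one cycle edge fits the pair \<open>s\<close>, and
        \<open>THE\<close> names it if it exists; the only tail edge that can contain such a vertex
        has index \<open>g\<close>.\<close>
      have "{i. v \<in> lollipop_edge_fun i} \<subseteq> {THE i. i < g \<and> s = {succ_mod i, succ_mod (succ_mod i)}, g}"
      proof
        fix i assume i: "i \<in> {i. v \<in> lollipop_edge_fun i}"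
        show "i \<in> {THE i. i < g \<and> s = {succ_mod i, succ_mod (succ_mod i)}, g}"
        proof (cases "i < g")
          case True
          have "(THE i. i < g \<and> s = {succ_mod i, succ_mod (succ_mod i)}) = i"
          proof (rule the_equality)
            show s: "i < g \<and> s = {succ_mod i, succ_mod (succ_mod i)}"
              using i True unfolding \<open>v = Inl u\<close> Inr st by (auto simp: lollipop_edge_fun_def in_cycle_edge)
            fix j assume "j < g \<and> s = {succ_mod j, succ_mod (succ_mod j)}"
            then show "j = i" using s succ_mod_pair[of "succ_mod i" "succ_mod j"] succ_mod_less succ_mod_inj by auto
          qed
          then show ?thesis by simp
        next
          case False
          then show ?thesis
            using i unfolding \<open>v = Inl u\<close> Inr st by (auto simp: lollipop_edge_fun_def in_tail_edge)
        qed
      qed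
      then show ?thesis by blast
    qed
  next
    case (Inr u)
    show ?thesis
    proof (cases u)
      case (Inl a)
      have "{i. v \<in> lollipop_edge_fun i} \<subseteq> {g + a, g + a - 1}"
        unfolding \<open>v = Inr u\<close> Inl
        by (auto simp: lollipop_edge_fun_def in_cycle_edge in_tail_edge split: if_splits)
      then show ?thesis by blast
    next
      case (Inr st)
      obtain s t where st: "st = (s, t)" by (cases st)
      \<comment> \<open>An inserted vertex of the path lies on one tail edge, whose pair
        \<open>s = {i, i + 1}\<close> has minimum \<open>i\<close>; the second element only pads the
        set.\<close>
      have "{i. v \<in> lollipop_edge_fun i} \<subseteq> {g + Min s, g}"
        unfolding \<open>v = Inr u\<close> Inr st
        by (auto simp: lollipop_edge_fun_def in_cycle_edge in_tail_edge split: if_splits)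
      then show ?thesis by blast
    qed
  qed
  have deg: "degree ?X v \<le> 2" for v
  proof -
    obtain x y where xy: "{i. v \<in> lollipop_edge_fun i} \<subseteq> {x, y}" using sub by blast
    then have "{e\<in>hedges ?X. v \<in> e} \<subseteq> lollipop_edge_fun ` {x, y}"
      unfolding hedges_hypercycle_hyperpath by auto
    then have "degree ?X v \<le> card (lollipop_edge_fun ` {x, y})"
      unfolding degree_def by (intro card_mono) auto
    also have "\<dots> \<le> card {x, y}" by (rule card_image_le) simp
    also have "\<dots> \<le> 2" by (simp add: card_insert_if)
    finally show ?thesis .
  qed
  show ?thesis
    unfolding lollipop_def
    using k g hyp card_lollipop_edge verts_hypercycle_hyperpath deg inj lollipop_edge_Int
    by (auto simp: uniform_def hedges_hypercycle_hyperpath)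
qed

end

section \<open>Comparison of traces\<close>

lemma ex_edge_bij:
  assumes "hypergraph H" "uniform k H"
  shows "\<exists>\<pi>. \<forall>x\<in>hedges H. bij_betw (\<pi> x) {..<k} x"
proof (rule bchoice, rule ballI)
  fix x assume x: "x \<in> hedges H"
  show "\<exists>f. bij_betw f {..<k} x"
    using assms(2) x hypergraph_finite_edge[OF assms(1) x]
    by (intro finite_same_card_bij) (auto simp: uniform_def)
qed

lemma Tr_A_low:
  assumes "hypergraph H" "uniform k H" "linear_hg H" and "k \<ge> 3" and "1 \<le> d" "d < k"
  shows "Tr_A \<alpha> k d H = real (k - 1) ^ (card (verts H) - 1) * vertex_coeff k d * \<alpha> ^ d *
    (\<Sum>v\<in>verts H. real (degree H v) ^ d)"
proof -
  obtain \<pi> where "\<forall>x\<in>hedges H. bij_betw (\<pi> x) {..<k} x" using ex_edge_bij[OF assms(1,2)] by blast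
  moreover have "(\<Sum>v\<in>verts H. (\<alpha> * real (degree H v)) ^ d) = \<alpha> ^ d * (\<Sum>v\<in>verts H. real (degree H v) ^ d)"
    by (simp add: power_mult_distrib sum_distrib_left)
  ultimately show ?thesis
    using Tr_A_decomposition[OF assms(1-5), of \<pi> \<alpha>] assms(6) by (simp add: edge_sum_eq_0)
qed

text \<open>On the values 1 and 2 the power \<open>x ^ d\<close> agrees with the affine function
  \<open>1 + (x - 1) * (2 ^ d - 1)\<close>, so the vertex part depends only on the numbers of
  vertices and edges.\<close>

lemma Tr_A_degree_le_2:
  assumes "hypergraph H" "uniform k H" "linear_hg H" and k: "k \<ge> 3" and "1 \<le> d" "d \<le> k + 2"
    and V: "verts H = \<Union>(hedges H)" and deg: "\<And>v. v \<in> verts H \<Longrightarrow> degree H v \<le> 2"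
  shows "Tr_A \<alpha> k d H = real (k - 1) ^ (card (verts H) - 1) *
    (vertex_coeff k d * \<alpha> ^ d * (real (card (verts H)) +
       (real (k * card (hedges H)) - real (card (verts H))) * (2 ^ d - 1)) +
     (\<Sum>x\<in>hedges H. edge_fun \<alpha> k d (joints H x)))"
proof -
  obtain \<pi> where \<pi>: "\<And>x. x \<in> hedges H \<Longrightarrow> bij_betw (\<pi> x) {..<k} x"
    using ex_edge_bij[OF assms(1,2)] by blast
  have deg12: "degree H v = 1 \<or> degree H v = 2" if "v \<in> verts H" for v
    using deg[OF that] degree_pos[OF assms(1) V that] by linarith
  have "(\<Sum>v\<in>verts H. (\<alpha> * real (degree H v)) ^ d) =
      (\<Sum>v\<in>verts H. \<alpha> ^ d * (1 + (real (degree H v) - 1) * (2 ^ d - 1)))"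
  proof (rule sum.cong[OF refl])
    fix v assume "v \<in> verts H"
    from deg12[OF this] show "(\<alpha> * real (degree H v)) ^ d = \<alpha> ^ d * (1 + (real (degree H v) - 1) * (2 ^ d - 1))"
      by (elim disjE) (simp_all add: power_mult_distrib)
  qed
  also have "\<dots> = \<alpha> ^ d * (real (card (verts H)) + (real (\<Sum>v\<in>verts H. degree H v) - real (card (verts H))) * (2 ^ d - 1))"
    by (simp add: sum_distrib_left[symmetric] sum.distrib sum_distrib_right[symmetric] sum_subtractf)
  also have "(\<Sum>v\<in>verts H. degree H v) = k * card (hedges H)" by (rule sum_degree[OF assms(1,2)])
  finally have vs: "(\<Sum>v\<in>verts H. (\<alpha> * real (degree H v)) ^ d) = \<alpha> ^ d * (real (card (verts H)) +
       (real (k * card (hedges H)) - real (card (verts H))) * (2 ^ d - 1))" .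
  have es: "edge_sum \<alpha> k d (\<lambda>i. real (degree H (\<pi> x i))) = edge_fun \<alpha> k d (joints H x)" if x: "x \<in> hedges H" for x
  proof -
    have b: "inj_on (\<pi> x) {..<k}" "\<pi> x ` {..<k} = x" using \<pi>[OF x] by (auto simp: bij_betw_def)
    have "real (degree H (\<pi> x i)) = 1 \<or> real (degree H (\<pi> x i)) = 2" if "i < k" for i
      using deg12[of "\<pi> x i"] b that hypergraph_edge_subset[OF assms(1) x] by force
    then have "edge_sum \<alpha> k d (\<lambda>i. real (degree H (\<pi> x i))) =
        edge_fun \<alpha> k d (card {i. i < k \<and> real (degree H (\<pi> x i)) = 2})"
      using k by (intro edge_sum_eq_edge_fun) auto
    moreover have "{v\<in>x. degree H v = 2} = \<pi> x ` {i. i < k \<and> real (degree H (\<pi> x i)) = 2}"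
      using b(2) by auto
    moreover have "card (\<pi> x ` {i. i < k \<and> real (degree H (\<pi> x i)) = 2}) = card {i. i < k \<and> real (degree H (\<pi> x i)) = 2}"
      by (rule card_image) (rule inj_on_subset[OF b(1)], auto)
    ultimately show ?thesis by (simp add: joints_def)
  qed
  have "(\<Sum>x\<in>hedges H. edge_sum \<alpha> k d (\<lambda>i. real (degree H (\<pi> x i)))) = (\<Sum>x\<in>hedges H. edge_fun \<alpha> k d (joints H x))"
    by (rule sum.cong[OF refl es])
  then show ?thesis
    using Tr_A_decomposition[OF assms(1-6), of \<pi> \<alpha>] \<pi> by (simp only: vs) (simp add: mult.assoc)
qed

lemma joints_le:
  assumes "hypergraph H" "uniform k H" "x \<in> hedges H"
  shows "joints H x \<le> k"
  using card_mono[of x "{v\<in>x. degree H v = 2}"] hypergraph_finite_edge[OF assms(1,3)] assms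
  by (auto simp: joints_def uniform_def)

lemma edge_fun_eq_affine:
  assumes "j \<le> k" and "k \<ge> 2" and d: "d \<le> k + 1"
  shows "edge_fun \<alpha> k d j = edge_fun \<alpha> k d 0 + real j * (edge_fun \<alpha> k d 1 - edge_fun \<alpha> k d 0)"
  using assms(1)
proof (induction j rule: less_induct)
  case (less j)
  consider "j = 0" | "j = 1" | i where "j = i + 2"
  proof -
    have "j = 0 \<or> j = 1 \<or> j = (j - 2) + 2" by linarith
    then show thesis using that by blast
  qed
  then show ?case
  proof cases
    case 3
    then show ?thesis
      using edge_fun_affine[of i k d \<alpha>] less.IH[of i] less.IH[of "i + 1"] less.prems d
      by (simp add: algebra_simps)
  qed auto
qed

lemma sum_edge_fun_affine:
  assumes "hypergraph H" "uniform k H" and "k \<ge> 2" "d \<le> k + 1"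
    and "(\<Sum>x\<in>hedges H. joints H x) = s"
  shows "(\<Sum>x\<in>hedges H. edge_fun \<alpha> k d (joints H x)) =
    real (card (hedges H)) * edge_fun \<alpha> k d 0 + real s * (edge_fun \<alpha> k d 1 - edge_fun \<alpha> k d 0)"
proof -
  have "(\<Sum>x\<in>hedges H. edge_fun \<alpha> k d (joints H x)) =
      (\<Sum>x\<in>hedges H. edge_fun \<alpha> k d 0 + real (joints H x) * (edge_fun \<alpha> k d 1 - edge_fun \<alpha> k d 0))"
    by (rule sum.cong[OF refl], rule edge_fun_eq_affine) (use joints_le[OF assms(1,2)] assms(3,4) in auto)
  then show ?thesis
    unfolding assms(5)[symmetric] by (simp add: sum.distrib sum_distrib_right[symmetric])
qed

text \<open>The height of the edge term of order \<open>k + 2\<close> above its secant through 2 and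
  3, the line-graph degrees of all edges but possibly the last in the extremal case.\<close>

definition secant_gap :: "real \<Rightarrow> nat \<Rightarrow> nat \<Rightarrow> real" where
  "secant_gap \<alpha> k j = edge_fun \<alpha> k (k + 2) j - edge_fun \<alpha> k (k + 2) 2 -
     (edge_fun \<alpha> k (k + 2) 3 - edge_fun \<alpha> k (k + 2) 2) * (real j - 2)"

lemma secant_gap_2_3: "secant_gap \<alpha> k 2 = 0" "secant_gap \<alpha> k 3 = 0"
  by (simp_all add: secant_gap_def)

text \<open>At 1 the gap is the second difference of the edge term over 1, 2, 3.\<close>

lemma secant_gap_1_pos:
  assumes "k \<ge> 3" "0 < \<alpha>" "\<alpha> < 1"
  shows "secant_gap \<alpha> k 1 > 0"
  using edge_fun_strictly_convex[of 1 k \<alpha>] assms by (simp add: secant_gap_def numeral_2_eq_2 numeral_3_eq_3)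

text \<open>Subtracting an affine function preserves convexity; the gap vanishes at 2 and 3, so it
  cannot decrease afterwards.\<close>

lemma secant_gap_nonneg:
  assumes k: "k \<ge> 3" and \<alpha>: "0 < \<alpha>" "\<alpha> < 1" and j: "1 \<le> j" "j \<le> k"
  shows "secant_gap \<alpha> k j \<ge> 0"
proof -
  have rise: "secant_gap \<alpha> k (j + 3) \<ge> secant_gap \<alpha> k (j + 2) \<and> secant_gap \<alpha> k (j + 2) \<ge> 0" if "j + 3 \<le> k" for j
    using that
  proof (induction j)
    case 0
    show ?case by (simp only: add_0 secant_gap_2_3) simp
  next
    case (Suc j)
    have "edge_fun \<alpha> k (k + 2) (j + 4) - 2 * edge_fun \<alpha> k (k + 2) (j + 3) + edge_fun \<alpha> k (k + 2) (j + 2) > 0"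
    proof -
      have "j + 2 + 2 = j + 4" "j + 2 + 1 = j + 3" by simp_all
      then show ?thesis
        using edge_fun_strictly_convex[of "j + 2" k \<alpha>] Suc.prems \<alpha> by (simp only:)
    qed
    then have "secant_gap \<alpha> k (j + 4) - 2 * secant_gap \<alpha> k (j + 3) + secant_gap \<alpha> k (j + 2) > 0"
      by (simp add: secant_gap_def algebra_simps)
    moreover have "secant_gap \<alpha> k (j + 3) \<ge> secant_gap \<alpha> k (j + 2)" "secant_gap \<alpha> k (j + 2) \<ge> 0"
      using Suc by auto
    moreover have "Suc j + 3 = j + 4" "Suc j + 2 = j + 3" by simp_all
    ultimately show ?case by (simp only:) linarith
  qed
  consider "j = 1" | "j = 2" | i where "j = i + 3"
  proof -
    have "j = 1 \<or> j = 2 \<or> j = (j - 3) + 3" using j(1) by linarith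
    then show thesis using that by blast
  qed
  then show ?thesis
  proof cases
    case 1
    then show ?thesis using secant_gap_1_pos[OF k \<alpha>] by simp
  next
    case 3
    then show ?thesis using rise[of i] j by auto
  qed (simp add: secant_gap_2_3)
qed

text \<open>The average number of joints is 2, so the slope term of the secant cancels in the
  sum.\<close>

lemma sum_edge_fun_secant_gap:
  assumes "(\<Sum>x\<in>hedges H. joints H x) = 2 * card (hedges H)"
  shows "(\<Sum>x\<in>hedges H. edge_fun \<alpha> k (k + 2) (joints H x)) =
    real (card (hedges H)) * edge_fun \<alpha> k (k + 2) 2 + (\<Sum>x\<in>hedges H. secant_gap \<alpha> k (joints H x))"
proof -
  have "(\<Sum>x\<in>hedges H. real (joints H x) - 2) = 0"
    using assms by (simp add: sum_subtractf flip: of_nat_sum)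
  then have "(\<Sum>x\<in>hedges H. (edge_fun \<alpha> k (k + 2) 3 - edge_fun \<alpha> k (k + 2) 2) * (real (joints H x) - 2)) = 0"
    by (simp add: sum_distrib_left[symmetric])
  then show ?thesis by (simp add: secant_gap_def sum_subtractf)
qed

text \<open>All edges but the last have 2 or 3 joints and hence no gap; the last contributes the gap
  at 1 or nothing.\<close>

lemma lollipop_sum_secant_gap:
  assumes L: "lollipop k m g X e" and k: "k \<ge> 3" and \<alpha>: "0 < \<alpha>" "\<alpha> < 1"
  shows "(\<Sum>x\<in>hedges X. secant_gap \<alpha> k (joints X x)) \<le> secant_gap \<alpha> k 1"
proof -
  note D = lollipop_D[OF L]
  have "(\<Sum>x\<in>hedges X. secant_gap \<alpha> k (joints X x)) = (\<Sum>i<m. secant_gap \<alpha> k (joints X (e i)))"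
    unfolding D(8) using D(7) by (simp add: sum.reindex)
  also have "\<dots> = secant_gap \<alpha> k (joints X (e (m - 1))) + (\<Sum>i\<in>{..<m} - {m - 1}. secant_gap \<alpha> k (joints X (e i)))"
    using D(2,3) by (intro sum.remove) auto
  also have "(\<Sum>i\<in>{..<m} - {m - 1}. secant_gap \<alpha> k (joints X (e i))) = 0"
  proof (intro sum.neutral ballI)
    fix i assume "i \<in> {..<m} - {m - 1}"
    then have "joints X (e i) = 2 \<or> joints X (e i) = 3" by (intro lollipop_joints_inner[OF L]) auto
    then show "secant_gap \<alpha> k (joints X (e i)) = 0" using secant_gap_2_3[of \<alpha> k] by auto
  qed
  also have "secant_gap \<alpha> k (joints X (e (m - 1))) + 0 \<le> secant_gap \<alpha> k 1"
    using lollipop_joints_last[OF L] secant_gap_2_3[of \<alpha> k] secant_gap_1_pos[OF k \<alpha>] by auto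
  finally show ?thesis .
qed

text \<open>Two leaves contribute twice the gap at 1, and no other edge contributes
  negatively.\<close>

lemma sum_secant_gap_greater:
  assumes H: "hypergraph H" "uniform k H" and k: "k \<ge> 3" and \<alpha>: "0 < \<alpha>" "\<alpha> < 1"
    and pos: "\<And>x. x \<in> hedges H \<Longrightarrow> joints H x \<ge> 1"
    and leaves: "card {x\<in>hedges H. joints H x = 1} \<ge> 2"
  shows "(\<Sum>x\<in>hedges H. secant_gap \<alpha> k (joints H x)) > secant_gap \<alpha> k 1"
proof -
  let ?A = "{x\<in>hedges H. joints H x = 1}"
  have "secant_gap \<alpha> k 1 < 2 * secant_gap \<alpha> k 1" using secant_gap_1_pos[OF k \<alpha>] by simp
  also have "\<dots> \<le> real (card ?A) * secant_gap \<alpha> k 1"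
    using leaves secant_gap_1_pos[OF k \<alpha>] by (intro mult_right_mono) auto
  also have "\<dots> = (\<Sum>x\<in>?A. secant_gap \<alpha> k (joints H x))" by simp
  also have "\<dots> \<le> (\<Sum>x\<in>hedges H. secant_gap \<alpha> k (joints H x))"
    using hypergraph_finite_edges[OF H(1)] pos joints_le[OF H] secant_gap_nonneg[OF k \<alpha>]
    by (intro sum_mono2) auto
  finally show ?thesis .
qed

text \<open>\<open>(x - 1) * (x - 2)\<close> is 0 at 1 and 2 and positive at larger integers; with
  the numbers of vertices and edges fixed, it measures the excess of the sum of squares.\<close>

lemma sum_degree_squares:
  assumes "hypergraph H" "uniform k H"
  shows "(\<Sum>v\<in>verts H. real (degree H v) ^ 2) =
    (\<Sum>v\<in>verts H. (real (degree H v) - 1) * (real (degree H v) - 2)) + 3 * real (k * card (hedges H)) - 2 * real (card (verts H))"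
proof -
  have "(\<Sum>v\<in>verts H. real (degree H v) ^ 2) =
      (\<Sum>v\<in>verts H. (real (degree H v) - 1) * (real (degree H v) - 2) + 3 * real (degree H v) - 2)"
    by (intro sum.cong) (auto simp: power2_eq_square algebra_simps)
  also have "\<dots> = (\<Sum>v\<in>verts H. (real (degree H v) - 1) * (real (degree H v) - 2)) +
      3 * real (\<Sum>v\<in>verts H. degree H v) - 2 * real (card (verts H))"
    by (simp add: sum.distrib sum_subtractf sum_distrib_left)
  finally show ?thesis by (simp only: sum_degree[OF assms])
qed

lemma joints_pos:
  assumes H: "hypergraph H" "uniform k H" "linear_hg H" "connected_hg H" and k: "k \<ge> 1"
    and deg: "\<And>v. v \<in> verts H \<Longrightarrow> degree H v \<le> 2" and m: "card (hedges H) \<ge> 2" and x: "x \<in> hedges H"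
  shows "joints H x \<ge> 1"
proof (rule ccontr)
  assume "\<not> ?thesis"
  then have "card {f\<in>hedges H. f \<noteq> x \<and> x \<inter> f \<noteq> {}} = 0"
    using joints_eq_card[OF H(1,3) deg x] by simp
  then have none: "{f\<in>hedges H. f \<noteq> x \<and> x \<inter> f \<noteq> {}} = {}"
    using hypergraph_finite_edges[OF H(1)] by simp
  have "{} \<notin> hedges H" using H(2) k by (auto simp: uniform_def)
  then have "{x} = hedges H"
    by (rule connected_edges_closed[OF H(1,4)]) (use x none in auto)
  then have "card (hedges H) = 1" by (metis One_nat_def card_1_singleton_iff)
  then show False using m by simp
qed

theorem theorem5p5:
  fixes k m g :: nat and \<alpha> :: real
  assumes "k \<ge> 3" and "m \<ge> 3" and "3 \<le> g" and "g \<le> m"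
    and "0 < \<alpha>" and "\<alpha> < 1"
  shows "hypercycle_hyperpath k g (m - g) \<in> linear_unicyclic k m g \<and>
    (\<forall>H :: 'v hypergraph. H \<in> linear_unicyclic k m g \<longrightarrow>
       \<not> isomorphic H (hypercycle_hyperpath k g (m - g)) \<longrightarrow>
       S_less \<alpha> k (hypercycle_hyperpath k g (m - g)) H)"
proof -
  let ?X = "hypercycle_hyperpath k g (m - g)"
  note k = assms(1) and \<alpha> = assms(5,6)
  have "\<exists>e. lollipop k m g ?X e"
    using lollipop_hypercycle_hyperpath[OF k assms(3), of "m - g"] assms(4) by auto
  then obtain e where L: "lollipop k m g ?X e" by blast
  note X = lollipop_D[OF L]
  have XU: "?X \<in> linear_unicyclic k m g" by (rule lollipop_linear_unicyclic[OF L])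
  have props: "hypergraph H" "uniform k H" "linear_hg H" "connected_hg H" "card (hedges H) = m"
      "card (verts H) = m * (k - 1)" and cover: "verts H = \<Union>(hedges H)"
    if "H \<in> linear_unicyclic k m g" for H :: "'x hypergraph"
    using that unicyclic_verts[of H k] k by (auto simp: linear_unicyclic_def unicyclic_def)
  note CX = props[OF XU]
  have "S_less \<alpha> k ?X H" if H: "H \<in> linear_unicyclic k m g" and iso: "\<not> isomorphic H ?X" for H :: "'v hypergraph"
  proof -
    note CH = props[OF H]
    let ?n = "m * (k - 1)"
    define c where "c = real (k - 1) ^ (?n - 1)"
    have c: "c > 0" using k by (simp add: c_def)
    have n: "?n \<ge> 2" using mult_le_mono[of 1 m 2 "k - 1"] assms by simp
    \<comment> \<open>The order \<open>k + 2\<close> has to be admissible; the bound is at least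
      \<open>3 * (k - 1) * 2 - 1\<close>.\<close>
    have range: "k + 2 \<le> ?n * (k - 1) ^ (?n - 1) - 1"
    proof -
      have "(k - 1) ^ 1 \<le> (k - 1) ^ (?n - 1)" using n k by (intro power_increasing) auto
      then have "?n * (k - 1) \<le> ?n * (k - 1) ^ (?n - 1)" by simp
      moreover have "3 * (k - 1) * (k - 1) \<le> ?n * (k - 1)" using assms by simp
      moreover have "3 * (k - 1) * 2 \<le> 3 * (k - 1) * (k - 1)" using k by (intro mult_le_mono) auto
      ultimately show ?thesis using k by linarith
    qed
    have Tr0: "Tr_A \<alpha> k 0 ?X = Tr_A \<alpha> k 0 H" using CX(6) CH(6) by (simp add: Tr_A_def Tr_def)
    show ?thesis
    proof (cases "\<forall>v\<in>verts H. degree H v \<le> 2")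
      \<comment> \<open>Order 2 is below \<open>k\<close>, where edges do not contribute
        yet.\<close>
      case False
      have low: "Tr_A \<alpha> k d G = c * vertex_coeff k d * \<alpha> ^ d * (\<Sum>v\<in>verts G. real (degree G v) ^ d)"
        if "G \<in> linear_unicyclic k m g" "1 \<le> d" "d < k" for G :: "'x hypergraph" and d
        using Tr_A_low[of G k d \<alpha>] props[OF that(1)] that k by (simp add: c_def)
      have deg_sum: "(\<Sum>v\<in>verts G. real (degree G v)) = real (k * m)" if "G \<in> linear_unicyclic k m g" for G :: "'x hypergraph"
        using sum_degree[OF props(1,2)[OF that]] props(5)[OF that] by (metis of_nat_sum)
      have Tr1: "Tr_A \<alpha> k 1 ?X = Tr_A \<alpha> k 1 H"
        using low[OF XU, of 1] low[OF H, of 1] deg_sum[OF XU] deg_sum[OF H] k by simp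
      obtain u where u: "u \<in> verts H" "degree H u \<ge> 3" using False by force
      have "(\<Sum>v\<in>verts ?X. (real (degree ?X v) - 1) * (real (degree ?X v) - 2)) = 0"
      proof (intro sum.neutral ballI)
        fix v assume "v \<in> verts ?X"
        then have "degree ?X v = 1 \<or> degree ?X v = 2"
          using X(9)[of v] degree_pos[OF X(4,6), of v] by linarith
        then show "(real (degree ?X v) - 1) * (real (degree ?X v) - 2) = 0" by auto
      qed
      moreover have "(\<Sum>v\<in>verts H. (real (degree H v) - 1) * (real (degree H v) - 2)) > 0"
      proof (rule sum_pos2[OF _ u(1)])
        show "(real (degree H u) - 1) * (real (degree H u) - 2) > 0" using u by simp
        fix v assume v: "v \<in> verts H"
        have "degree H v \<ge> 1" by (rule degree_pos[OF CH(1) cover[OF H] v])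
        then have "degree H v = 1 \<or> degree H v \<ge> 2" by linarith
        then show "(real (degree H v) - 1) * (real (degree H v) - 2) \<ge> 0" by auto
      qed (rule hypergraph_finite_verts[OF CH(1)])
      ultimately have "(\<Sum>v\<in>verts ?X. real (degree ?X v) ^ 2) < (\<Sum>v\<in>verts H. real (degree H v) ^ 2)"
        using sum_degree_squares[of ?X k] sum_degree_squares[of H k] CX CH by simp
      moreover have "c * vertex_coeff k 2 * \<alpha> ^ 2 > 0"
        using c vertex_coeff_pos[of 2 k] \<alpha> by simp
      ultimately have "c * vertex_coeff k 2 * \<alpha> ^ 2 * (\<Sum>v\<in>verts ?X. real (degree ?X v) ^ 2) <
          c * vertex_coeff k 2 * \<alpha> ^ 2 * (\<Sum>v\<in>verts H. real (degree H v) ^ 2)"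
        by (rule mult_strict_left_mono)
      then have "Tr_A \<alpha> k 2 ?X < Tr_A \<alpha> k 2 H"
        using low[OF XU, of 2] low[OF H, of 2] k by simp
      moreover have "\<forall>t<2. Tr_A \<alpha> k t ?X = Tr_A \<alpha> k t H" using Tr0 Tr1 by (auto simp: less_2_cases_iff)
      ultimately show ?thesis
        unfolding S_less_def using CX CH range k by (intro conjI bexI[of _ 2]) auto
    next
      case True
      then have deg: "\<And>v. v \<in> verts H \<Longrightarrow> degree H v \<le> 2" by blast
      have tr: "Tr_A \<alpha> k d G = c * (vertex_coeff k d * \<alpha> ^ d * (real ?n + (real (k * m) - real ?n) * (2 ^ d - 1)) +
          (\<Sum>x\<in>hedges G. edge_fun \<alpha> k d (joints G x)))"
        if "G \<in> linear_unicyclic k m g" "\<And>v. v \<in> verts G \<Longrightarrow> degree G v \<le> 2" "1 \<le> d" "d \<le> k + 2"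
        for G :: "'x hypergraph" and d
        using Tr_A_degree_le_2[OF props(1-3)[OF that(1)] k that(3,4) cover[OF that(1)] that(2), of \<alpha>] props(5,6)[OF that(1)]
        by (simp add: c_def)
      have joints: "(\<Sum>x\<in>hedges G. joints G x) = 2 * card (hedges G)"
        if "G \<in> linear_unicyclic k m g" "\<And>v. v \<in> verts G \<Longrightarrow> degree G v \<le> 2" for G :: "'x hypergraph"
        using sum_joints[OF props(1,2)[OF that(1)] cover[OF that(1)] _ _ that(2)] props(5,6)[OF that(1)] k by simp
      \<comment> \<open>With at most one leaf \<open>H\<close> would have the intersection pattern
        of \<open>?X\<close> with the same parameters and be isomorphic to it.\<close>
      have "card {x\<in>hedges H. joints H x = 1} \<ge> 2"
      proof (rule ccontr)
        assume "\<not> ?thesis"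
        then obtain e' where "lollipop k m g H e'"
          using ex_lollipop[OF H _ _ deg] assms by auto
        then show False using lollipop_isomorphic[OF _ L] iso by blast
      qed
      then have "secant_gap \<alpha> k 1 < (\<Sum>x\<in>hedges H. secant_gap \<alpha> k (joints H x))"
        using CH assms joints_pos[of H k, OF _ _ _ _ _ deg]
        by (intro sum_secant_gap_greater[OF _ _ k \<alpha>]) auto
      with lollipop_sum_secant_gap[OF L k \<alpha>]
      have "(\<Sum>x\<in>hedges ?X. edge_fun \<alpha> k (k + 2) (joints ?X x)) < (\<Sum>x\<in>hedges H. edge_fun \<alpha> k (k + 2) (joints H x))"
        using sum_edge_fun_secant_gap[OF joints[OF XU X(9)], of \<alpha> k] sum_edge_fun_secant_gap[OF joints[OF H deg], of \<alpha> k] CX CH by simp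
      then have "Tr_A \<alpha> k (k + 2) ?X < Tr_A \<alpha> k (k + 2) H"
        using tr[OF XU X(9), of "k + 2"] tr[OF H deg, of "k + 2"] c by simp
      \<comment> \<open>Below \<open>k + 2\<close> the edge term is affine, so its sum is fixed by
        the number of edges and the sum of joints.\<close>
      moreover have "Tr_A \<alpha> k t ?X = Tr_A \<alpha> k t H" if t: "t < k + 2" for t
      proof (cases "t = 0")
        case False
        have "(\<Sum>x\<in>hedges ?X. edge_fun \<alpha> k t (joints ?X x)) = (\<Sum>x\<in>hedges H. edge_fun \<alpha> k t (joints H x))"
          using sum_edge_fun_affine[of ?X k t, OF _ _ _ _ joints[OF XU X(9)]]
            sum_edge_fun_affine[of H k t, OF _ _ _ _ joints[OF H deg]] CX CH k t by simp
        then show ?thesis using tr[OF XU X(9), of t] tr[OF H deg, of t] False t by simp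
      qed (simp add: Tr0)
      ultimately show ?thesis
        unfolding S_less_def using CX CH range by (intro conjI bexI[of _ "k + 2"]) auto
    qed
  qed
  then show ?thesis using XU by blast
qed

end
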